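(* Let $A_G\in\mathbb{R}^{n\times n}$ be the adjacency matrix of a graph $G$, let $E_{ij}=\mathbf e_i\mathbf e_j^T\in\mathbb{R}^{n\times n}$, and denote by $W(A_G)$ the numerical range of $A_G$. Then $$\bigl|[L_f(A_G,E_{ij})]_{uv}\bigr| \le C\cdot \min_{p\in\Pi_{m(u,v)-1}}\ \max_{z\in W(A_G)} |f'(z)-p(z)|,$$ where $m(u,v) = d(u,i)+d(j,v)$ and $$C=\begin{cases}1 & \text{if } A_G \text{ is normal},\\ (1+\sqrt2)^2 & \text{otherwise.}\end{cases}$$
   Context: A (possibly weighted, possibly directed) graph $G$ has node set $\mathcal V=\{1,\dots,n\}$, edge set $\mathcal E\subseteq \mathcal V\times\mathcal V$ (no self loops, no multiple edges with the same direction) and weights $w_{ij}>0$ for $(i,j)\in\mathcal E$ (all equal to $1$ if unweighted); its adjacency matrix $A_G$ has entries $a_{ij}=w_{ij}$ if $(i,j)\in\mathcal E$ and $0$ otherwise. $i,j,u,v$ are nodes of $G$. $d(u,v)$ is the geodesic distance in $G$: the smallest number of edges on any path connecting node $u$ to node $v$. $\Pi_m$ is the set of all polynomials of degree at most $m$. The numerical range (field of values) is $W(A_G)=\{\mathbf x^*A_G\mathbf x : \mathbf x\in\mathbb{C}^n,\ \|\mathbf x\|=1\}\subset\mathbb{C}$, with $\|\cdot\|$ the Euclidean norm. $\mathbf e_i$ is the $i$th canonical unit vector of $\mathbb{R}^n$, and $[M]_{uv}$ is the $(u,v)$ entry of a matrix $M$. $L_f(A,\cdot)$ is the Fréchet derivative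 of the matrix function $f$ at $A$: the linear operator satisfying $f(A+E)-f(A)=L_f(A,E)+o(\|E\|)$ for all $E\in\mathbb{R}^{n\times n}$; here matrix functions are defined by the Cauchy integral formula for functions analytic on a region containing the spectrum of the matrix. *)

theory Defs
  imports
    "Graph_Theory.Pair_Digraph"
    "HOL-Library.Extended_Nat"
    "HOL-Complex_Analysis.Complex_Analysis"
begin

definition adjacency_matrix :: "'n::finite pair_pre_digraph \<Rightarrow> ('n \<times> 'n \<Rightarrow> real) \<Rightarrow> real^'n^'n" where
  "adjacency_matrix G w = (\<chi> i j. if (i, j) \<in> parcs G then w (i, j) else 0)"

text \<open>The value is \<open>\<infinity>\<close> (the infimum of the empty set) if no path connects \<open>u\<close> to \<open>v\<close>.\<close>

definition geodesic_dist :: "'a pair_pre_digraph \<Rightarrow> 'a \<Rightarrow> 'a \<Rightarrow> enat" where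
  "geodesic_dist G u v = (INF p\<in>{p. pre_digraph.apath (with_proj G) u p v}. enat (length p))"

text \<open>
  \<open>polys_deg_less M\<close> is the set of polynomials of degree at most \<open>M - 1\<close>.  It is indexed by \<open>M\<close>
  so that \<open>M = 0\<close> gives the zero polynomial only (the library sets \<open>degree 0 = 0\<close>, whence the
  separate disjunct) and \<open>M = \<infinity>\<close> gives all polynomials.
\<close>

definition polys_deg_less :: "enat \<Rightarrow> complex poly set" where
  "polys_deg_less M = {p. p = 0 \<or> enat (degree p) < M}"

abbreviation complex_matrix :: "real^'n^'m \<Rightarrow> complex^'n^'m" where
  "complex_matrix \<equiv> map_matrix complex_of_real"

definition conj_transpose :: "complex^'n^'m \<Rightarrow> complex^'m^'n" where
  "conj_transpose A = map_matrix cnj (transpose A)"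

definition normal_matrix :: "complex^'n^'n \<Rightarrow> bool" where
  "normal_matrix A \<longleftrightarrow> A ** conj_transpose A = conj_transpose A ** A"

definition matrix_spectrum :: "complex^'n^'n \<Rightarrow> complex set" where
  "matrix_spectrum A = {z. \<exists>x. x \<noteq> 0 \<and> A *v x = z *s x}"

definition numerical_range :: "complex^'n^'n \<Rightarrow> complex set" where
  "numerical_range A = {\<Sum>k\<in>UNIV. cnj (x $ k) * (A *v x) $ k | x. norm x = 1}"

definition unit_matrix :: "'n::finite \<Rightarrow> 'n \<Rightarrow> real^'n^'n" where
  "unit_matrix i j = (\<chi> r s. axis i 1 $ r * axis j 1 $ s)"

text \<open>
  The Cauchy integral \<open>1 / (2 \<pi> \<i>) \<integral>\<^sub>\<gamma> f(z) (z I - A)\<^sup>-\<^sup>1 dz\<close>, taken entrywise, along some closed contour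
  \<open>\<gamma>\<close> in a region \<open>\<Omega>\<close> on which \<open>f\<close> is analytic, where \<open>\<gamma>\<close> winds once around each eigenvalue and
  does not wind around any point outside \<open>\<Omega>\<close>.
\<close>

definition has_matrix_fun :: "(complex \<Rightarrow> complex) \<Rightarrow> complex^'n^'n \<Rightarrow> complex^'n^'n \<Rightarrow> bool" where
  "has_matrix_fun f A B \<longleftrightarrow>
     (\<exists>\<Omega> \<gamma>. open \<Omega> \<and> connected \<Omega> \<and> f holomorphic_on \<Omega> \<and> matrix_spectrum A \<subseteq> \<Omega> \<and>
        valid_path \<gamma> \<and> pathfinish \<gamma> = pathstart \<gamma> \<and> path_image \<gamma> \<subseteq> \<Omega> - matrix_spectrum A \<and>
        (\<forall>z\<in>matrix_spectrum A. winding_number \<gamma> z = 1) \<and>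
        (\<forall>z. z \<notin> \<Omega> \<longrightarrow> winding_number \<gamma> z = 0) \<and>
        B = (\<chi> r s. 1 / (2 * of_real pi * \<i>) *
               contour_integral \<gamma> (\<lambda>z. f z * matrix_inv (mat z - A) $ r $ s)))"

text \<open>
  The residue theorem makes the value independent of the choice of \<open>\<Omega>\<close> and \<open>\<gamma>\<close>.
\<close>

definition matrix_fun :: "(complex \<Rightarrow> complex) \<Rightarrow> complex^'n^'n \<Rightarrow> complex^'n^'n" where
  "matrix_fun f A = (THE B. has_matrix_fun f A B)"

text \<open>
  Directions are real matrices, values are complex since \<open>f\<close> need not be real on the real line.
\<close>

definition matrix_frechet :: "(complex \<Rightarrow> complex) \<Rightarrow> real^'n^'n \<Rightarrow> real^'n^'n \<Rightarrow> complex^'n^'n" where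
  "matrix_frechet f A E = frechet_derivative (\<lambda>X. matrix_fun f (complex_matrix X)) (at A) E"

end

theory Submission
  imports Defs
begin

text \<open>
  The \<open>(u, v)\<close> entry of \<open>L\<^sub>f(A, E\<^sub>i\<^sub>j)\<close> is the Cauchy integral of \<open>f R\<^sub>u\<^sub>i R\<^sub>j\<^sub>v\<close>, where \<open>R\<close> is the resolvent of \<open>A\<close>.  For
  \<open>f z = z ^ k\<close> it is the sum of \<open>(A ^ a)\<^sub>u\<^sub>i (A ^ b)\<^sub>j\<^sub>v\<close> over \<open>a + b = k - 1\<close>, which vanishes unless there are walks
  from \<open>u\<close> to \<open>i\<close> and from \<open>j\<close> to \<open>v\<close> of total length \<open>k - 1\<close>.  Hence \<open>f\<close> may be replaced by \<open>g = f - q\<close> with \<open>q' = p\<close>.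
  The integral equals \<open>\<phi>(A)\<^sub>u\<^sub>i\<close>, where \<open>\<phi> x = \<Phi>(x, A)\<^sub>j\<^sub>v\<close> and \<open>\<Phi>\<close> is the divided difference of \<open>g\<close>, bounded by the
  maximum of \<open>|g'|\<close> on a convex set.  Two applications of the bound \<open>\<parallel>h(A)\<parallel> \<le> (1 + sqrt 2) max |h|\<close> of Crouzeix
  and Palencia give the claim.

  That bound is proved on convex neighbourhoods \<open>U\<close> of the numerical range (which is convex by
  Toeplitz--Hausdorff).  A Riemann map \<open>F\<close> from the disc onto \<open>U\<close>, restricted to a slightly smaller disc, still has a
  convex image by Study's theorem, and transports all contour integrals to the unit circle, where its
  analyticity across the boundary makes boundary values unproblematic.
\<close>

unbundle no fps_syntax

section \<open>Means over the unit circle\<close>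

text \<open>The numerical range may be a point or a segment, and its boundary need not be smooth.
  The estimates are therefore made on open convex neighbourhoods on which \<open>|f' - p|\<close>
  exceeds its supremum over the numerical range by at most \<open>\<delta>\<close>; then
  \<open>\<delta>\<close> tends to 0. Crouzeix and Palencia need a second function, the Cauchy
  transform of conjugated boundary values, bounded up to the boundary. In disc coordinates the
  kernel \<open>F' z / (F z - F w)\<close> is the kernel \<open>1 / (z - w)\<close> of the disc plus
  a part that is holomorphic across the circle. The transform against the first is the constant
  \<open>cnj (h 0)\<close>, and the second raises no question of boundary values. Convexity enters
  there as the sign of one real part, which makes a scalar kernel and a matrix-valued kernel
  positive. The constant 1 + sqrt 2 is the positive root of \<open>K ^ 2 = 2 * K + 1\<close>; the
  best constant \<open>K\<close> for one fixed map and matrix satisfies the corresponding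
  inequality. It is squared because the divided difference has two variables and \<open>A\<close> is
  inserted for each in turn.\<close>

definition circle_mean :: "(complex \<Rightarrow> complex) \<Rightarrow> complex" where
  "circle_mean \<phi> = integral {0..1} (\<lambda>t. \<phi> (cis (2 * pi * t)))"

lemma continuous_on_circle_param:
  assumes "continuous_on (sphere 0 1) \<phi>"
  shows "continuous_on {0..1} (\<lambda>t. \<phi> (cis (2 * pi * t)))"
  by (rule continuous_on_compose2[OF assms]) (auto intro!: continuous_intros)

lemma integrable_circle_param:
  fixes \<phi> :: "complex \<Rightarrow> 'a::banach"
  assumes "continuous_on (sphere 0 1) \<phi>"
  shows "(\<lambda>t. \<phi> (cis (2 * pi * t))) integrable_on {0..1}"
  by (intro integrable_continuous_real continuous_on_circle_param assms)

lemma circle_mean_cong: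
  assumes "\<And>z. norm z = 1 \<Longrightarrow> \<phi> z = \<psi> z"
  shows "circle_mean \<phi> = circle_mean \<psi>"
  unfolding circle_mean_def by (intro integral_cong assms) simp

lemma circle_mean_add:
  assumes "continuous_on (sphere 0 1) \<phi>" "continuous_on (sphere 0 1) \<psi>"
  shows "circle_mean (\<lambda>z. \<phi> z + \<psi> z) = circle_mean \<phi> + circle_mean \<psi>"
  unfolding circle_mean_def by (intro Henstock_Kurzweil_Integration.integral_add integrable_circle_param assms)

lemma circle_mean_diff:
  assumes "continuous_on (sphere 0 1) \<phi>" "continuous_on (sphere 0 1) \<psi>"
  shows "circle_mean (\<lambda>z. \<phi> z - \<psi> z) = circle_mean \<phi> - circle_mean \<psi>"
  unfolding circle_mean_def by (intro Henstock_Kurzweil_Integration.integral_diff integrable_circle_param assms)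

lemma circle_mean_sum:
  assumes "finite I" "\<And>i. i \<in> I \<Longrightarrow> continuous_on (sphere 0 1) (\<phi> i)"
  shows "circle_mean (\<lambda>z. \<Sum>i\<in>I. \<phi> i z) = (\<Sum>i\<in>I. circle_mean (\<phi> i))"
  unfolding circle_mean_def using assms
  by (intro Henstock_Kurzweil_Integration.integral_sum integrable_circle_param) auto

lemma circle_mean_cmult: "circle_mean (\<lambda>z. c * \<phi> z) = c * circle_mean \<phi>"
  unfolding circle_mean_def by simp

lemma circle_mean_cmult_right: "circle_mean (\<lambda>z. \<phi> z * c) = circle_mean \<phi> * c"
  unfolding circle_mean_def by simp

lemma circle_mean_const [simp]: "circle_mean (\<lambda>z. c) = c"
  unfolding circle_mean_def by simp

lemma circle_mean_cnj: "circle_mean (\<lambda>z. cnj (\<phi> z)) = cnj (circle_mean \<phi>)"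
  unfolding circle_mean_def by (rule integral_cnj[symmetric])

lemma circle_mean_norm_le:
  assumes "continuous_on (sphere 0 1) \<phi>" "continuous_on (sphere 0 1) \<psi>"
    and "\<And>z. norm z = 1 \<Longrightarrow> norm (\<phi> z) \<le> Re (\<psi> z)"
  shows "norm (circle_mean \<phi>) \<le> Re (circle_mean \<psi>)"
proof -
  have "norm (circle_mean \<phi>) \<le> integral {0..1} (\<lambda>t. Re (\<psi> (cis (2 * pi * t))))"
    unfolding circle_mean_def
    using continuous_on_Re[OF assms(2)] assms
    by (intro Henstock_Kurzweil_Integration.integral_norm_bound_integral integrable_circle_param) auto
  also have "\<dots> = Re (circle_mean \<psi>)"
    unfolding circle_mean_def
    using integral_linear[OF integrable_circle_param[OF assms(2)] bounded_linear_Re]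
    by (simp add: o_def)
  finally show ?thesis .
qed

lemma circle_mean_bound:
  assumes "continuous_on (sphere 0 1) \<phi>" "\<And>z. norm z = 1 \<Longrightarrow> norm (\<phi> z) \<le> c"
  shows "norm (circle_mean \<phi>) \<le> c"
  using circle_mean_norm_le[OF assms(1) continuous_on_const, of "of_real c"] assms(2) by simp

lemma contour_integral_circlepath_eq_circle_mean:
  assumes "r \<ge> 0"
  shows "contour_integral (circlepath 0 r) \<phi> = 2 * of_real pi * \<i> * circle_mean (\<lambda>z. of_real r * z * \<phi> (of_real r * z))"
proof -
  have "contour_integral (circlepath 0 r) \<phi> =
      integral {0..1} (\<lambda>t. 2 * of_real pi * \<i> * (of_real r * cis (2 * pi * t) * \<phi> (of_real r * cis (2 * pi * t))))"
    unfolding contour_integral_integral vector_derivative_circlepath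
    by (simp add: circlepath cis_conv_exp mult_ac)
  then show ?thesis
    unfolding circle_mean_def by simp
qed

lemma circle_mean_holomorphic:
  assumes "\<phi> holomorphic_on ball 0 R" "1 < R"
  shows "circle_mean \<phi> = \<phi> 0"
proof -
  have *: "cball 0 1 \<subseteq> ball (0::complex) R"
    using assms by auto
  have "((\<lambda>u. \<phi> u / (u - 0)) has_contour_integral (2 * of_real pi * \<i> * \<phi> 0)) (circlepath 0 1)"
  proof (rule Cauchy_integral_circlepath)
    show "continuous_on (cball 0 1) \<phi>"
      using assms * holomorphic_on_imp_continuous_on continuous_on_subset by blast
    show "\<phi> holomorphic_on ball 0 1"
      using assms by (auto intro: holomorphic_on_subset)
  qed auto
  then have "contour_integral (circlepath 0 1) (\<lambda>u. \<phi> u / u) = 2 * of_real pi * \<i> * \<phi> 0"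
    by (simp add: contour_integral_unique)
  then have "2 * of_real pi * \<i> * circle_mean (\<lambda>z. z * (\<phi> z / z)) = 2 * of_real pi * \<i> * \<phi> 0"
    by (simp add: contour_integral_circlepath_eq_circle_mean)
  moreover have "circle_mean (\<lambda>z. z * (\<phi> z / z)) = circle_mean \<phi>"
    by (rule circle_mean_cong) auto
  ultimately show ?thesis by simp
qed

text \<open>Cauchy's theorem as a mean value property: the factor \<open>z\<close> makes the value
  at 0 vanish. It discards the terms that have no pole in the disc.\<close>

lemma circle_mean_mult_holomorphic:
  assumes "\<phi> holomorphic_on ball 0 R" "1 < R"
  shows "circle_mean (\<lambda>z. z * \<phi> z) = 0"
proof -
  have "(\<lambda>z. z * \<phi> z) holomorphic_on ball 0 R"
    by (intro holomorphic_intros assms)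
  from circle_mean_holomorphic[OF this assms(2)] show ?thesis
    by simp
qed

lemma circle_mean_Cauchy_kernel:
  assumes "norm w < 1"
  shows "circle_mean (\<lambda>z. z / (z - w)) = 1"
proof -
  have "contour_integral (circlepath 0 1) (\<lambda>z. 1 / (z - w)) = 2 * of_real pi * \<i>"
    using Cauchy_integral_circlepath[of 0 1 "\<lambda>_. 1" w] assms
    by (simp add: contour_integral_unique)
  then show ?thesis
    by (simp add: contour_integral_circlepath_eq_circle_mean)
qed

lemma circle_mean_continuous_param:
  fixes S :: "complex set"
  assumes "continuous_on (S \<times> sphere 0 1) (\<lambda>(w, z). k w z)"
  shows "continuous_on S (\<lambda>w. circle_mean (k w))"
proof -
  have "continuous_on (S \<times> cbox 0 1) (\<lambda>(w, t). k w (cis (2 * pi * t)))"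
    unfolding case_prod_beta
    by (rule continuous_on_compose2[OF assms[unfolded case_prod_beta],
        where f = "\<lambda>p. (fst p, cis (2 * pi * snd p))", simplified])
       (auto intro!: continuous_intros)
  then show ?thesis
    unfolding circle_mean_def box_real[symmetric] by (rule integral_continuous_on_param)
qed

text \<open>Morera's theorem with an exchange of integrals avoids any control of derivatives of the kernel.\<close>

lemma circle_mean_holomorphic_param:
  assumes "open S" "continuous_on (S \<times> sphere 0 1) (\<lambda>(w, z). k w z)"
    and "\<And>z. norm z = 1 \<Longrightarrow> (\<lambda>w. k w z) holomorphic_on S"
  shows "(\<lambda>w. circle_mean (k w)) holomorphic_on S"
proof -
  \<comment> \<open>Recast as a contour integral so that the exchange of two contour integrals
    applies; the division by \<open>z\<close> compensates the line element of the circle.\<close>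
  have eq: "circle_mean (k w) = 1 / (2 * of_real pi * \<i>) * contour_integral (circlepath 0 1) (\<lambda>z. k w z / z)" for w
  proof -
    have "circle_mean (\<lambda>z. z * (k w z / z)) = circle_mean (k w)"
      by (rule circle_mean_cong) auto
    then show ?thesis
      by (simp add: contour_integral_circlepath_eq_circle_mean)
  qed
  have cont: "continuous_on S (\<lambda>w. circle_mean (k w))"
    by (rule circle_mean_continuous_param[OF assms(2)])
  have "(\<lambda>w. circle_mean (k w)) analytic_on S"
  proof (rule Morera_triangle[OF cont \<open>open S\<close>], intro impI)
    fix a b c assume hull: "convex hull {a, b, c} \<subseteq> S"
    have swap: "contour_integral (linepath p q) (\<lambda>w. circle_mean (k w)) =
        circle_mean (\<lambda>z. contour_integral (linepath p q) (\<lambda>w. k w z))"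
      and ccont: "continuous_on (sphere 0 1) (\<lambda>z. contour_integral (linepath p q) (\<lambda>w. k w z))"
      if sub: "closed_segment p q \<subseteq> S" for p q
    proof -
      have cseg: "continuous_on (closed_segment p q \<times> sphere 0 1) (\<lambda>(w, z). k w z)"
        by (rule continuous_on_subset[OF assms(2)]) (use sub in auto)
      have "contour_integral (linepath p q) (\<lambda>w. contour_integral (circlepath 0 1) (\<lambda>z. k w z / z)) =
          contour_integral (circlepath 0 1) (\<lambda>z. contour_integral (linepath p q) (\<lambda>w. k w z / z))"
      proof (rule contour_integral_swap)
        show "continuous_on (path_image (linepath p q) \<times> path_image (circlepath 0 1)) (\<lambda>(w, z). k w z / z)"
          using cseg unfolding case_prod_beta by (auto intro!: continuous_intros)
        show "continuous_on {0..1} (\<lambda>t. vector_derivative (linepath p q) (at t))"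
          by (auto intro!: continuous_intros)
        show "continuous_on {0..1} (\<lambda>t. vector_derivative (circlepath 0 1) (at t))"
          by (auto simp: vector_derivative_circlepath intro!: continuous_intros)
      qed auto
      also have "\<dots> = 2 * of_real pi * \<i> * circle_mean (\<lambda>z. z * contour_integral (linepath p q) (\<lambda>w. k w z / z))"
        by (simp add: contour_integral_circlepath_eq_circle_mean)
      also have "circle_mean (\<lambda>z. z * contour_integral (linepath p q) (\<lambda>w. k w z / z)) =
          circle_mean (\<lambda>z. contour_integral (linepath p q) (\<lambda>w. k w z))"
      proof (rule circle_mean_cong)
        fix z :: complex assume z: "norm z = 1"
        have "(\<lambda>w. k w z) contour_integrable_on linepath p q"
          by (intro contour_integrable_continuous_linepath continuous_on_subset[OF holomorphic_on_imp_continuous_on[OF assms(3)[OF z]] sub])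
        then have "contour_integral (linepath p q) (\<lambda>w. k w z / z) = contour_integral (linepath p q) (\<lambda>w. k w z) / z"
          by (rule contour_integral_div)
        then show "z * contour_integral (linepath p q) (\<lambda>w. k w z / z) = contour_integral (linepath p q) (\<lambda>w. k w z)"
          using z by auto
      qed
      finally have main: "contour_integral (linepath p q) (\<lambda>w. contour_integral (circlepath 0 1) (\<lambda>z. k w z / z)) = 2 * of_real pi * \<i> * circle_mean (\<lambda>z. contour_integral (linepath p q) (\<lambda>w. k w z))" .
      have int: "(\<lambda>w. contour_integral (circlepath 0 1) (\<lambda>z. k w z / z)) contour_integrable_on linepath p q"
      proof (rule contour_integrable_continuous_linepath)
        have "continuous_on (closed_segment p q) (\<lambda>w. 2 * of_real pi * \<i> * circle_mean (k w))"
          by (intro continuous_intros continuous_on_subset[OF cont sub])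
        then show "continuous_on (closed_segment p q) (\<lambda>w. contour_integral (circlepath 0 1) (\<lambda>z. k w z / z))"
          by (simp add: eq)
      qed
      show "contour_integral (linepath p q) (\<lambda>w. circle_mean (k w)) =
        circle_mean (\<lambda>z. contour_integral (linepath p q) (\<lambda>w. k w z))"
        unfolding eq[abs_def] contour_integral_lmul[OF int] main by (simp add: eq[symmetric])
      have "continuous_on (sphere 0 1 \<times> cbox 0 1) (\<lambda>(z, t). k (linepath p q t) z * (q - p))"
        unfolding case_prod_beta
      proof (intro continuous_intros)
        show "continuous_on (sphere 0 1 \<times> cbox 0 1) (\<lambda>x. k (linepath p q (snd x)) (fst x))"
          by (rule continuous_on_compose2[OF cseg[unfolded case_prod_beta],
              where f = "\<lambda>x. (linepath p q (snd x), fst x)", simplified])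
             (auto simp: linepath_in_path linepath_def intro!: continuous_intros
               intro: linepath_in_path[unfolded linepath_def])
      qed
      then have "continuous_on (sphere 0 1) (\<lambda>z. integral (cbox 0 1) (\<lambda>t. k (linepath p q t) z * (q - p)))"
        by (rule integral_continuous_on_param)
      then show "continuous_on (sphere 0 1) (\<lambda>z. contour_integral (linepath p q) (\<lambda>w. k w z))"
        unfolding contour_integral_integral by simp
    qed
    have s1: "closed_segment a b \<subseteq> S" and s2: "closed_segment b c \<subseteq> S" and s3: "closed_segment c a \<subseteq> S"
      using hull segments_subset_convex_hull[where a = a and b = b and c = c] by blast+
    have "contour_integral (linepath a b) (\<lambda>w. circle_mean (k w)) +
        contour_integral (linepath b c) (\<lambda>w. circle_mean (k w)) +
        contour_integral (linepath c a) (\<lambda>w. circle_mean (k w)) =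
       circle_mean (\<lambda>z. contour_integral (linepath a b) (\<lambda>w. k w z) + contour_integral (linepath b c) (\<lambda>w. k w z)
          + contour_integral (linepath c a) (\<lambda>w. k w z))"
      using s1 s2 s3 by (simp add: swap circle_mean_add ccont continuous_on_add)
    also have "\<dots> = circle_mean (\<lambda>z. 0)"
    proof (rule circle_mean_cong)
      fix z :: complex assume z: "norm z = 1"
      have hol: "(\<lambda>w. k w z) holomorphic_on convex hull {a, b, c}"
        by (rule holomorphic_on_subset[OF assms(3)[OF z] hull])
      have "((\<lambda>w. k w z) has_contour_integral 0) (linepath a b +++ linepath b c +++ linepath c a)"
        by (rule Cauchy_theorem_triangle[OF hol])
      then show "contour_integral (linepath a b) (\<lambda>w. k w z) + contour_integral (linepath b c) (\<lambda>w. k w z)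
          + contour_integral (linepath c a) (\<lambda>w. k w z) = 0"
        by (rule has_chain_integral_chain_integral3)
    qed
    finally show "contour_integral (linepath a b) (\<lambda>w. circle_mean (k w)) +
        contour_integral (linepath b c) (\<lambda>w. circle_mean (k w)) +
        contour_integral (linepath c a) (\<lambda>w. circle_mean (k w)) = 0"
      by simp
  qed
  then show ?thesis
    by (rule analytic_imp_holomorphic)
qed

section \<open>Divided differences\<close>

text \<open>The weight \<open>p\<close> makes the family closed under differentiation: moving the
  end point \<open>a\<close> or \<open>b\<close> brings down a factor \<open>t\<close> or
  \<open>1 - t\<close>.\<close>

definition segment_mean :: "(real \<Rightarrow> complex) \<Rightarrow> (complex \<Rightarrow> complex) \<Rightarrow> complex \<Rightarrow> complex \<Rightarrow> complex" where
  "segment_mean p f a b = integral {0..1} (\<lambda>t. p t * f (linepath b a t))"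

lemma linepath_in_convex:
  fixes a b :: "'a::real_normed_vector"
  assumes "convex U" "a \<in> U" "b \<in> U" "t \<in> {0..1}"
  shows "linepath b a t \<in> U"
  using assms linepath_in_path[of t b a] closed_segment_subset by blast

lemma continuous_on_segment_integrand:
  fixes f :: "complex \<Rightarrow> complex" and p :: "real \<Rightarrow> complex"
  assumes "convex U" "continuous_on U f" "continuous_on {0..1} p"
  shows "continuous_on ((U \<times> U) \<times> cbox 0 1) (\<lambda>(x, t). p t * f (linepath (snd x) (fst x) t))"
  unfolding case_prod_beta
proof (intro continuous_intros)
  show "continuous_on ((U \<times> U) \<times> cbox 0 1) (\<lambda>x. p (snd x))"
    by (rule continuous_on_compose2[OF assms(3)]) (auto intro!: continuous_intros)
  show "continuous_on ((U \<times> U) \<times> cbox 0 1) (\<lambda>x. f (linepath (snd (fst x)) (fst (fst x)) (snd x)))"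
  proof (rule continuous_on_compose2[OF assms(2)])
    show "continuous_on ((U \<times> U) \<times> cbox 0 1) (\<lambda>x. linepath (snd (fst x)) (fst (fst x)) (snd x))"
      unfolding linepath_def by (intro continuous_intros)
  qed (use assms(1) in \<open>auto intro!: linepath_in_convex\<close>)
qed

lemma continuous_on_segment_mean:
  assumes "convex U" "continuous_on U f" "continuous_on {0..1} p"
  shows "continuous_on (U \<times> U) (\<lambda>(a, b). segment_mean p f a b)"
proof -
  have "continuous_on (U \<times> U) (\<lambda>x. integral (cbox 0 1) (\<lambda>t. p t * f (linepath (snd x) (fst x) t)))"
    by (rule integral_continuous_on_param[OF continuous_on_segment_integrand[OF assms]])
  then show ?thesis
    by (simp add: segment_mean_def case_prod_beta)
qed

lemma segment_mean_has_field_derivative: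
  assumes "open U" "convex U" "f holomorphic_on U" "continuous_on {0..1} p" "a \<in> U" "b \<in> U"
  shows "((\<lambda>a. segment_mean p f a b) has_field_derivative segment_mean (\<lambda>t. of_real t * p t) (deriv f) a b) (at a)"
    and "((\<lambda>b. segment_mean p f a b) has_field_derivative segment_mean (\<lambda>t. of_real (1 - t) * p t) (deriv f) a b) (at b)"
proof -
  have f': "(f has_field_derivative deriv f z) (at z)" if "z \<in> U" for z
    using assms(1,3) that holomorphic_derivI by blast
  have contf: "continuous_on U f"
    using assms(3) holomorphic_on_imp_continuous_on by blast
  have cont': "continuous_on U (deriv f)"
    using assms(1,3) holomorphic_deriv holomorphic_on_imp_continuous_on by blast
  have c1: "continuous_on ((U \<times> U) \<times> cbox 0 1) (\<lambda>(x, t). (of_real t * p t) * deriv f (linepath (snd x) (fst x) t))"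
    by (rule continuous_on_segment_integrand[OF assms(2) cont']) (intro continuous_intros assms)
  have c2: "continuous_on ((U \<times> U) \<times> cbox 0 1) (\<lambda>(x, t). (of_real (1 - t) * p t) * deriv f (linepath (snd x) (fst x) t))"
    by (rule continuous_on_segment_integrand[OF assms(2) cont']) (intro continuous_intros assms)
  have c0: "continuous_on ((U \<times> U) \<times> cbox 0 1) (\<lambda>(x, t). p t * f (linepath (snd x) (fst x) t))"
    by (rule continuous_on_segment_integrand[OF assms(2) contf assms(4)])
  have int: "(\<lambda>t. p t * f (linepath d c t)) integrable_on cbox 0 1" if "c \<in> U" "d \<in> U" for c d
  proof -
    have "continuous_on (cbox 0 1) (\<lambda>t. (\<lambda>(x, t). p t * f (linepath (snd x) (fst x) t)) ((c, d), t))"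
      by (rule continuous_on_compose2[OF c0]) (use that in \<open>auto intro!: continuous_intros\<close>)
    then have "continuous_on (cbox 0 1) (\<lambda>t. p t * f (linepath d c t))"
      by simp
    then show ?thesis
      by (rule integrable_continuous)
  qed
  have 1: "((\<lambda>a. integral (cbox 0 1) (\<lambda>t. p t * f (linepath b a t))) has_field_derivative
      integral (cbox 0 1) (\<lambda>t. (of_real t * p t) * deriv f (linepath b a t))) (at a within U)"
  proof (rule leibniz_rule_field_derivative)
    fix c t assume c: "c \<in> U" and t: "t \<in> cbox (0::real) 1"
    have "linepath b c t \<in> U"
      using linepath_in_convex[OF assms(2) c assms(6)] t by auto
    note f'[OF this]
    moreover have "((\<lambda>a. linepath b a t) has_field_derivative of_real t) (at c)"
      unfolding linepath_def by (auto intro!: derivative_eq_intros simp: scaleR_conv_of_real)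
    ultimately have "((\<lambda>a. f (linepath b a t)) has_field_derivative deriv f (linepath b c t) * of_real t) (at c)"
      by (rule DERIV_chain2)
    then have "((\<lambda>a. p t * f (linepath b a t)) has_field_derivative p t * (deriv f (linepath b c t) * of_real t)) (at c)"
      by (rule DERIV_cmult)
    then show "((\<lambda>a. p t * f (linepath b a t)) has_field_derivative of_real t * p t * deriv f (linepath b c t)) (at c within U)"
      by (simp only: mult_ac has_field_derivative_at_within)
  next
    have "continuous_on (U \<times> cbox 0 1) (\<lambda>x. (\<lambda>(x, t). (of_real t * p t) * deriv f (linepath (snd x) (fst x) t)) (((fst x, b), snd x)))"
      by (rule continuous_on_compose2[OF c1]) (use assms(6) in \<open>auto intro!: continuous_intros\<close>)
    then show "continuous_on (U \<times> cbox 0 1) (\<lambda>(x, t). complex_of_real t * p t * deriv f (linepath b x t))"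
      by (simp add: case_prod_beta)
  qed (use int assms in auto)
  have 2: "((\<lambda>b. integral (cbox 0 1) (\<lambda>t. p t * f (linepath b a t))) has_field_derivative
      integral (cbox 0 1) (\<lambda>t. (of_real (1 - t) * p t) * deriv f (linepath b a t))) (at b within U)"
  proof (rule leibniz_rule_field_derivative)
    fix c t assume c: "c \<in> U" and t: "t \<in> cbox (0::real) 1"
    have "linepath c a t \<in> U"
      using linepath_in_convex[OF assms(2) assms(5) c] t by auto
    note f'[OF this]
    moreover have "((\<lambda>b. linepath b a t) has_field_derivative of_real (1 - t)) (at c)"
      unfolding linepath_def by (auto intro!: derivative_eq_intros simp: scaleR_conv_of_real)
    ultimately have "((\<lambda>b. f (linepath b a t)) has_field_derivative deriv f (linepath c a t) * of_real (1 - t)) (at c)"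
      by (rule DERIV_chain2)
    then have "((\<lambda>b. p t * f (linepath b a t)) has_field_derivative p t * (deriv f (linepath c a t) * of_real (1 - t))) (at c)"
      by (rule DERIV_cmult)
    then show "((\<lambda>b. p t * f (linepath b a t)) has_field_derivative of_real (1 - t) * p t * deriv f (linepath c a t)) (at c within U)"
      by (simp only: mult_ac has_field_derivative_at_within)
  next
    have "continuous_on (U \<times> cbox 0 1) (\<lambda>x. (\<lambda>(x, t). (of_real (1 - t) * p t) * deriv f (linepath (snd x) (fst x) t)) (((a, fst x), snd x)))"
      by (rule continuous_on_compose2[OF c2]) (use assms(5) in \<open>auto intro!: continuous_intros\<close>)
    then show "continuous_on (U \<times> cbox 0 1) (\<lambda>(x, t). complex_of_real (1 - t) * p t * deriv f (linepath x a t))"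
      by (simp add: case_prod_beta)
  qed (use int assms in auto)
  show "((\<lambda>a. segment_mean p f a b) has_field_derivative segment_mean (\<lambda>t. of_real t * p t) (deriv f) a b) (at a)"
    using 1 unfolding segment_mean_def at_within_open[OF assms(5,1)] box_real .
  show "((\<lambda>b. segment_mean p f a b) has_field_derivative segment_mean (\<lambda>t. of_real (1 - t) * p t) (deriv f) a b) (at b)"
    using 2 unfolding segment_mean_def at_within_open[OF assms(6,1)] box_real .
qed

lemma segment_mean_holomorphic:
  assumes "open U" "convex U" "f holomorphic_on U" "continuous_on {0..1} p"
  shows "b \<in> U \<Longrightarrow> (\<lambda>a. segment_mean p f a b) holomorphic_on U"
    and "a \<in> U \<Longrightarrow> (\<lambda>b. segment_mean p f a b) holomorphic_on U"
  unfolding holomorphic_on_open[OF assms(1)]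
  using segment_mean_has_field_derivative[OF assms] by blast+

text \<open>The Hermite-Genocchi form of \<open>(f a - f b) / (a - b)\<close>. As an integral over a
  segment it is regular on the diagonal, and on a convex domain it inherits any bound on
  \<open>deriv f\<close>.\<close>

definition divdiff :: "(complex \<Rightarrow> complex) \<Rightarrow> complex \<Rightarrow> complex \<Rightarrow> complex" where
  "divdiff f = segment_mean (\<lambda>_. 1) (deriv f)"

lemma divdiff_same [simp]: "divdiff f a a = deriv f a"
  by (simp add: divdiff_def segment_mean_def)

lemma divdiff_mult:
  assumes "open U" "convex U" "f holomorphic_on U" "a \<in> U" "b \<in> U"
  shows "(a - b) * divdiff f a b = f a - f b"
proof -
  have "(deriv f has_contour_integral (f (pathfinish (linepath b a)) - f (pathstart (linepath b a)))) (linepath b a)"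
  proof (rule contour_integral_primitive[where S = U])
    fix z assume "z \<in> U"
    then show "(f has_field_derivative deriv f z) (at z within U)"
      using assms(1,3) holomorphic_derivI by blast
  next
    show "path_image (linepath b a) \<subseteq> U"
      using assms by (simp add: closed_segment_subset)
  qed auto
  then have "f a - f b = contour_integral (linepath b a) (deriv f)"
    by (simp add: contour_integral_unique)
  then show ?thesis
    by (simp add: contour_integral_integral divdiff_def segment_mean_def mult.commute)
qed

lemma continuous_on_divdiff:
  assumes "open U" "convex U" "f holomorphic_on U"
  shows "continuous_on (U \<times> U) (\<lambda>(a, b). divdiff f a b)"
  unfolding divdiff_def using assms
  by (intro continuous_on_segment_mean holomorphic_on_imp_continuous_on holomorphic_deriv) auto

lemma divdiff_holomorphic:
  assumes "open U" "convex U" "f holomorphic_on U"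
  shows "b \<in> U \<Longrightarrow> (\<lambda>a. divdiff f a b) holomorphic_on U"
    and "a \<in> U \<Longrightarrow> (\<lambda>b. divdiff f a b) holomorphic_on U"
  unfolding divdiff_def using assms by (auto intro!: segment_mean_holomorphic holomorphic_deriv)

lemma divdiff_bound:
  assumes "open U" "convex U" "f holomorphic_on U" "a \<in> U" "b \<in> U" "\<And>z. z \<in> U \<Longrightarrow> norm (deriv f z) \<le> c"
  shows "norm (divdiff f a b) \<le> c"
proof -
  have "norm (integral {0..1} (\<lambda>t. deriv f (linepath b a t))) \<le> c * (1 - 0)"
  proof (rule integral_bound)
    have "continuous_on U (deriv f)"
      using assms(1,3) holomorphic_deriv holomorphic_on_imp_continuous_on by blast
    then show "continuous_on {0..1} (\<lambda>t. deriv f (linepath b a t))"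
      by (rule continuous_on_compose2)
         (use assms(2,4,5) in \<open>auto intro!: linepath_in_convex continuous_intros continuous_on_linepath\<close>)
  qed (use assms in \<open>auto intro!: assms(6) linepath_in_convex\<close>)
  then show ?thesis
    by (simp add: divdiff_def segment_mean_def)
qed

text \<open>Distinct points are settled by injectivity, the diagonal by the nonzero derivative of an
  injective holomorphic function. Quotients by this divided difference are thus regular
  everywhere.\<close>

lemma divdiff_nonzero:
  assumes "open U" "convex U" "f holomorphic_on U" "inj_on f U" "a \<in> U" "b \<in> U"
  shows "divdiff f a b \<noteq> 0"
proof (cases "a = b")
  case True
  then show ?thesis
    using holomorphic_injective_imp_regular[OF assms(3,1,4,5)] by simp
next
  case False
  then have "f a - f b \<noteq> 0"
    using assms(4-6) by (auto dest: inj_onD)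
  then show ?thesis
    using divdiff_mult[OF assms(1-3,5,6)] by auto
qed

text \<open>This is the logarithmic derivative in \<open>a\<close> of the divided difference, i.e. the regular part
  \<open>f' a / (f a - f b) - 1 / (a - b)\<close> of the pulled back Cauchy kernel.\<close>

definition kernel_reg :: "(complex \<Rightarrow> complex) \<Rightarrow> complex \<Rightarrow> complex \<Rightarrow> complex" where
  "kernel_reg f a b = segment_mean of_real (deriv (deriv f)) a b / divdiff f a b"

lemma
  assumes "open U" "convex U" "f holomorphic_on U" "inj_on f U"
  shows continuous_on_kernel_reg: "continuous_on (U \<times> U) (\<lambda>(a, b). kernel_reg f a b)"
    and kernel_reg_holomorphic: "b \<in> U \<Longrightarrow> (\<lambda>a. kernel_reg f a b) holomorphic_on U"
      "a \<in> U \<Longrightarrow> (\<lambda>b. kernel_reg f a b) holomorphic_on U"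
proof -
  have f'': "deriv (deriv f) holomorphic_on U"
    using assms by (intro holomorphic_deriv)
  have p: "continuous_on {0..1} complex_of_real"
    by (intro continuous_intros)
  show "continuous_on (U \<times> U) (\<lambda>(a, b). kernel_reg f a b)"
    using continuous_on_divdiff[OF assms(1-3)] continuous_on_segment_mean[OF assms(2) holomorphic_on_imp_continuous_on[OF f''] p]
      divdiff_nonzero[OF assms]
    unfolding kernel_reg_def case_prod_beta by (auto intro!: continuous_on_divide)
  show "(\<lambda>a. kernel_reg f a b) holomorphic_on U" if "b \<in> U"
    unfolding kernel_reg_def
    using divdiff_nonzero[OF assms] that
    by (intro holomorphic_on_divide divdiff_holomorphic segment_mean_holomorphic assms f'' p) auto
  show "(\<lambda>b. kernel_reg f a b) holomorphic_on U" if "a \<in> U"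
    unfolding kernel_reg_def
    using divdiff_nonzero[OF assms] that
    by (intro holomorphic_on_divide divdiff_holomorphic segment_mean_holomorphic assms f'' p) auto
qed

text \<open>Logarithmic derivative in \<open>a\<close> of
  \<open>f a - f b = (a - b) * divdiff f a b\<close>.\<close>

lemma kernel_reg_eq:
  assumes "open U" "convex U" "f holomorphic_on U" "inj_on f U" "a \<in> U" "b \<in> U" "a \<noteq> b"
  shows "deriv f a / (f a - f b) = 1 / (a - b) + kernel_reg f a b"
proof -
  let ?D2 = "segment_mean of_real (deriv (deriv f)) a b"
  have nz: "divdiff f a b \<noteq> 0" "a - b \<noteq> 0"
    using divdiff_nonzero[OF assms(1-6)] assms(7) by auto
  have "((\<lambda>a. divdiff f a b) has_field_derivative ?D2) (at a)"
    using segment_mean_has_field_derivative(1)[OF assms(1,2) holomorphic_deriv[OF assms(3,1)], where p = "\<lambda>_. 1"] assms(5,6)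
    by (simp add: divdiff_def)
  then have "((\<lambda>a. (a - b) * divdiff f a b) has_field_derivative (divdiff f a b + (a - b) * ?D2)) (at a)"
    by (auto intro!: derivative_eq_intros)
  moreover have "((\<lambda>a. (a - b) * divdiff f a b) has_field_derivative deriv f a) (at a)"
  proof (rule has_field_derivative_transform_within_open[OF _ assms(1,5)])
    show "((\<lambda>a. f a - f b) has_field_derivative deriv f a) (at a)"
      using holomorphic_derivI[OF assms(3,1,5)] by (auto intro!: derivative_eq_intros)
  qed (use divdiff_mult[OF assms(1-3) _ assms(6)] in auto)
  ultimately have "deriv f a = divdiff f a b + (a - b) * ?D2"
    by (rule DERIV_unique[symmetric])
  moreover have "f a - f b = (a - b) * divdiff f a b"
    using divdiff_mult[OF assms(1-3,5,6)] by simp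
  ultimately show ?thesis
    using nz by (simp add: kernel_reg_def add_divide_distrib)
qed

section \<open>Hermitian form, numerical range and resolvent\<close>

definition cip :: "complex^'n \<Rightarrow> complex^'n \<Rightarrow> complex" where
  "cip x y = (\<Sum>k\<in>UNIV. cnj (x $ k) * y $ k)"

lemma cip_add_right: "cip x (y + z) = cip x y + cip x z"
  by (simp add: cip_def algebra_simps sum.distrib)

lemma cip_add_left: "cip (x + y) z = cip x z + cip y z"
  by (simp add: cip_def algebra_simps sum.distrib)

lemma cip_diff_right: "cip x (y - z) = cip x y - cip x z"
  by (simp add: cip_def algebra_simps sum_subtractf)

lemma cip_diff_left: "cip (x - y) z = cip x z - cip y z"
  by (simp add: cip_def algebra_simps sum_subtractf)

lemma cip_smult_right: "cip x (c *s y) = c * cip x y"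
  by (simp add: cip_def sum_distrib_left mult_ac)

lemma cip_smult_left: "cip (c *s x) y = cnj c * cip x y"
  by (simp add: cip_def sum_distrib_left mult_ac)

lemma cnj_cip: "cnj (cip x y) = cip y x"
  by (simp add: cip_def mult_ac)

lemma cip_zero [simp]: "cip 0 x = 0" "cip x 0 = 0"
  by (simp_all add: cip_def)

lemma Re_cip: "Re (cip x y) = x \<bullet> y"
  by (simp add: cip_def inner_vec_def inner_complex_def)

lemma cip_self: "cip x x = of_real ((norm x)\<^sup>2)"
proof (rule complex_eqI)
  show "Re (cip x x) = Re (of_real ((norm x)\<^sup>2))"
    by (simp add: Re_cip power2_norm_eq_inner)
  show "Im (cip x x) = Im (of_real ((norm x)\<^sup>2))"
    using arg_cong[OF cnj_cip[of x x], of Im] by simp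
qed

lemma norm_smult: "norm (c *s x) = norm c * norm (x :: complex^'n)"
proof -
  have "cip (c *s x) (c *s x) = (c * cnj c) * cip x x"
    by (simp only: cip_smult_left cip_smult_right mult_ac)
  then have "of_real ((norm (c *s x))\<^sup>2) = complex_of_real ((norm c * norm x)\<^sup>2)"
    by (simp only: cip_self complex_norm_square[symmetric] of_real_mult[symmetric] power_mult_distrib)
  then have "(norm (c *s x))\<^sup>2 = (norm c * norm x)\<^sup>2"
    by (simp only: of_real_eq_iff)
  then show ?thesis
    by (rule power2_eq_imp_eq) simp_all
qed

lemma norm_cip_le: "norm (cip x y) \<le> norm x * norm y"
proof -
  \<comment> \<open>A rotation that turns the form into its modulus, so that the real Cauchy-Schwarz
    inequality applies; \<open>c\<close> is 0 when the form vanishes.\<close>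
  define c where "c = cnj (sgn (cip x y))"
  have "Re (c * cip x y) = norm (cip x y)"
    by (cases "cip x y = 0")
       (simp_all add: c_def sgn_eq complex_norm_square[symmetric] mult.commute divide_simps power2_eq_square
         flip: of_real_mult)
  then have "norm (cip x y) = x \<bullet> (c *s y)"
    by (simp add: Re_cip[symmetric] cip_smult_right)
  also have "\<dots> \<le> norm x * norm (c *s y)"
    by (rule norm_cauchy_schwarz)
  also have "\<dots> \<le> norm x * norm y"
    by (intro mult_left_mono) (simp_all add: norm_smult c_def norm_sgn)
  finally show ?thesis .
qed

lemma mult_smult_vector: "B *v (c *s x) = c *s (B *v (x :: complex^'n))"
  by (rule vector_scalar_commute)

lemma mat_vector_mult: "mat z *v x = z *s (x :: complex^'n)"
  by (simp add: vec_eq_iff matrix_vector_mult_def mat_def if_distrib if_distribR cong: if_cong)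

lemma conj_transpose_nth [simp]: "conj_transpose B $ i $ j = cnj (B $ j $ i)"
  by (simp add: conj_transpose_def map_matrix_def transpose_def)

lemma conj_transpose_conj_transpose [simp]: "conj_transpose (conj_transpose B) = B"
  by (simp add: vec_eq_iff)

lemma conj_transpose_mult: "conj_transpose (B ** C) = conj_transpose C ** conj_transpose B"
  by (simp add: vec_eq_iff matrix_matrix_mult_def mult.commute)

lemma conj_transpose_add: "conj_transpose (B + C) = conj_transpose B + conj_transpose C"
  by (simp add: vec_eq_iff)

lemma cip_conj_transpose: "cip (conj_transpose B *v x) y = cip x (B *v y)"
proof -
  have "cip (conj_transpose B *v x) y = (\<Sum>k\<in>UNIV. \<Sum>l\<in>UNIV. B $ l $ k * cnj (x $ l) * y $ k)"
    by (simp add: cip_def matrix_vector_mult_def sum_distrib_right)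
  also have "\<dots> = (\<Sum>l\<in>UNIV. \<Sum>k\<in>UNIV. B $ l $ k * cnj (x $ l) * y $ k)"
    by (rule sum.swap)
  also have "\<dots> = cip x (B *v y)"
    by (simp add: cip_def matrix_vector_mult_def sum_distrib_left mult_ac)
  finally show ?thesis .
qed

lemma cip_conj_transpose_right: "cip x (conj_transpose B *v y) = cip (B *v x) y"
  using cip_conj_transpose[of "conj_transpose B" x y] by simp

lemma matrix_vector_mult_axis_nth: "(B *v axis v 1) $ u = (B :: complex^'n^'m) $ u $ v"
  by (simp add: matrix_vector_mult_def axis_def if_distrib cong: if_cong)

section \<open>Spectral norm\<close>

definition opnorm :: "complex^'n^'m \<Rightarrow> real" where
  "opnorm B = onorm ((*v) B)"

lemma norm_matrix_vector_le: "norm (B *v x) \<le> opnorm B * norm x"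
  unfolding opnorm_def by (rule onorm) simp

lemma opnorm_nonneg [simp]: "0 \<le> opnorm B"
  unfolding opnorm_def by (rule onorm_pos_le) simp

lemma opnorm_le: "(\<And>x. norm (B *v x) \<le> c * norm x) \<Longrightarrow> opnorm B \<le> c"
  unfolding opnorm_def by (rule onorm_le)

lemma opnorm_mult_le: "opnorm (B ** C) \<le> opnorm B * opnorm C"
proof (rule opnorm_le)
  fix x
  have "norm (B ** C *v x) \<le> opnorm B * norm (C *v x)"
    by (simp add: matrix_vector_mul_assoc[symmetric] norm_matrix_vector_le)
  also have "\<dots> \<le> opnorm B * (opnorm C * norm x)"
    by (intro mult_left_mono norm_matrix_vector_le) simp
  finally show "norm (B ** C *v x) \<le> opnorm B * opnorm C * norm x"
    by (simp add: mult.assoc)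
qed

lemma opnorm_add_le: "opnorm (B + C) \<le> opnorm B + opnorm C"
proof (rule opnorm_le)
  fix x
  show "norm ((B + C) *v x) \<le> (opnorm B + opnorm C) * norm x"
    using norm_triangle_ineq[of "B *v x" "C *v x"] norm_matrix_vector_le[of B x] norm_matrix_vector_le[of C x]
    by (simp add: matrix_vector_mult_add_rdistrib distrib_right)
qed

lemma norm_entry_le_opnorm: "norm (B $ u $ v) \<le> opnorm B"
proof -
  have "norm (B $ u $ v) = norm ((B *v axis v 1) $ u)"
    by (simp add: matrix_vector_mult_axis_nth)
  also have "\<dots> \<le> norm (B *v axis v 1)"
    by (rule Finite_Cartesian_Product.norm_nth_le)
  also have "\<dots> \<le> opnorm B"
    using norm_matrix_vector_le[of B "axis v 1"] by simp
  finally show ?thesis .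
qed

lemma opnorm_le_norm: "opnorm B \<le> norm B" for B :: "complex^'n^'n"
proof (rule opnorm_le)
  fix x
  have "norm (B *v x) \<le> norm (norm x *\<^sub>R B)"
    unfolding norm_vec_def[of "B *v x"] norm_vec_def[of "norm x *\<^sub>R B"]
  proof (rule L2_set_mono)
    fix i
    have "(B *v x) $ i = cip (\<chi> k. cnj (B $ i $ k)) x"
      by (simp add: cip_def matrix_vector_mult_def)
    also have "norm \<dots> \<le> norm (\<chi> k. cnj (B $ i $ k)) * norm x"
      by (rule norm_cip_le)
    also have "norm (\<chi> k. cnj (B $ i $ k)) = norm (B $ i)"
      by (simp add: norm_vec_def)
    finally show "norm ((B *v x) $ i) \<le> norm ((norm x *\<^sub>R B) $ i)"
      by (simp add: mult.commute)
  qed simp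
  then show "norm (B *v x) \<le> norm B * norm x"
    by (simp add: mult.commute)
qed

lemma norm_matrix_le_sum: "norm (B :: complex^'n^'m) \<le> (\<Sum>i\<in>UNIV. \<Sum>j\<in>UNIV. norm (B $ i $ j))"
proof -
  have "norm B \<le> (\<Sum>i\<in>UNIV. norm (B $ i))"
    unfolding norm_vec_def[of B] by (rule L2_set_le_sum) simp
  also have "\<dots> \<le> (\<Sum>i\<in>UNIV. \<Sum>j\<in>UNIV. norm (B $ i $ j))"
    unfolding norm_vec_def by (intro sum_mono L2_set_le_sum) simp
  finally show ?thesis .
qed

lemma opnorm_conj_transpose_le: "opnorm (conj_transpose B) \<le> opnorm B"
proof (rule opnorm_le)
  fix x
  let ?y = "conj_transpose B *v x"
  have "complex_of_real ((norm ?y)\<^sup>2) = cip x (B *v ?y)"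
    by (simp only: cip_self[symmetric] cip_conj_transpose)
  then have "(norm ?y)\<^sup>2 = norm (cip x (B *v ?y))"
    by (metis norm_of_real abs_of_nonneg zero_le_power2)
  also have "\<dots> \<le> norm x * (opnorm B * norm ?y)"
    by (intro order.trans[OF norm_cip_le] mult_left_mono norm_matrix_vector_le) simp
  finally have "norm ?y * norm ?y \<le> (opnorm B * norm x) * norm ?y"
    by (simp add: power2_eq_square mult_ac)
  then show "norm ?y \<le> opnorm B * norm x"
    by (cases "norm ?y = 0") (auto simp: mult_le_cancel_right)
qed

lemma opnorm_conj_transpose [simp]: "opnorm (conj_transpose B) = opnorm B"
  using opnorm_conj_transpose_le[of B] opnorm_conj_transpose_le[of "conj_transpose B"] by simp

text \<open>The C*-identity: the squared length of \<open>B *v x\<close> is the form of the product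
  at \<open>x\<close>. It converts norms of self-adjoint products into powers of
  \<open>opnorm B\<close>.\<close>

lemma opnorm_conj_transpose_mult: "opnorm (conj_transpose B ** B) = (opnorm B)\<^sup>2"
proof (rule antisym)
  show "opnorm (conj_transpose B ** B) \<le> (opnorm B)\<^sup>2"
    using opnorm_mult_le[of "conj_transpose B" B] by (simp add: power2_eq_square)
  let ?c = "opnorm (conj_transpose B ** B)"
  have "opnorm B \<le> sqrt ?c"
  proof (rule opnorm_le)
    fix x
    have "complex_of_real ((norm (B *v x))\<^sup>2) = cip x ((conj_transpose B ** B) *v x)"
      by (simp only: cip_self[symmetric] cip_conj_transpose_right matrix_vector_mul_assoc[symmetric])
    then have "(norm (B *v x))\<^sup>2 = norm (cip x ((conj_transpose B ** B) *v x))"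
      by (metis norm_of_real abs_of_nonneg zero_le_power2)
    also have "\<dots> \<le> norm x * (?c * norm x)"
      by (intro order.trans[OF norm_cip_le] mult_left_mono norm_matrix_vector_le) simp
    also have "\<dots> = (sqrt ?c * norm x)\<^sup>2"
      by (simp add: power_mult_distrib power2_eq_square)
    finally show "norm (B *v x) \<le> sqrt ?c * norm x"
      by (rule power2_le_imp_le) simp
  qed
  then have "(opnorm B)\<^sup>2 \<le> (sqrt ?c)\<^sup>2"
    by (rule power_mono) simp
  then show "(opnorm B)\<^sup>2 \<le> ?c"
    by simp
qed

text \<open>Normality regroups the product of the adjoint of \<open>B ** B\<close> with
  \<open>B ** B\<close> into the square of \<open>?P\<close>; the C*-identity is then applied to
  \<open>B ** B\<close>, to \<open>?P\<close> and to \<open>B\<close>.\<close>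

lemma opnorm_normal_square:
  assumes "B ** conj_transpose B = conj_transpose B ** B"
  shows "opnorm (B ** B) = (opnorm B)\<^sup>2"
proof -
  let ?P = "conj_transpose B ** B"
  have P: "conj_transpose ?P = ?P"
    by (simp add: conj_transpose_mult)
  have "conj_transpose (B ** B) ** (B ** B) = conj_transpose ?P ** ?P"
  proof -
    have "conj_transpose (B ** B) ** (B ** B) = conj_transpose B ** (conj_transpose B ** B) ** B"
      by (simp only: conj_transpose_mult matrix_mul_assoc)
    also have "\<dots> = conj_transpose B ** (B ** conj_transpose B) ** B"
      by (simp only: assms)
    also have "\<dots> = conj_transpose ?P ** ?P"
      by (simp only: P matrix_mul_assoc)
    finally show ?thesis .
  qed
  then have "(opnorm (B ** B))\<^sup>2 = (opnorm ?P)\<^sup>2"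
    by (simp only: opnorm_conj_transpose_mult[symmetric])
  then have "opnorm (B ** B) = opnorm ?P"
    by (rule power2_eq_imp_eq) simp_all
  then show ?thesis
    by (simp add: opnorm_conj_transpose_mult)
qed

section \<open>Numerical range and spectrum\<close>

lemma numerical_range_eq: "numerical_range A = {cip x (A *v x) | x. norm x = 1}"
  by (simp add: numerical_range_def cip_def)

lemma numerical_range_nonempty: "numerical_range A \<noteq> {}"
proof -
  have "norm (axis undefined 1 :: complex^'n) = 1"
    by simp
  then show ?thesis
    unfolding numerical_range_eq by blast
qed

lemma compact_numerical_range: "compact (numerical_range A)"
proof -
  have "numerical_range A = (\<lambda>x. cip x (A *v x)) ` sphere 0 1"
    by (auto simp: numerical_range_eq)
  moreover have "continuous_on (sphere 0 1) (\<lambda>x. cip x (A *v x))"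
    unfolding cip_def matrix_vector_mult_def by (intro continuous_intros)
  ultimately show ?thesis
    by (simp add: compact_continuous_image)
qed

lemma norm_numerical_range_le: "z \<in> numerical_range A \<Longrightarrow> norm z \<le> opnorm A"
  unfolding numerical_range_eq using norm_cip_le norm_matrix_vector_le[of A]
  by (fastforce intro: order.trans)

lemma cip_in_numerical_range:
  assumes "x \<noteq> 0"
  obtains w where "w \<in> numerical_range A" "cip x (A *v x) = w * of_real ((norm x)\<^sup>2)"
proof
  let ?y = "of_real (1 / norm x) *s x"
  have "norm ?y = 1"
    using assms by (simp add: norm_smult norm_divide)
  then show "cip ?y (A *v ?y) \<in> numerical_range A"
    by (auto simp: numerical_range_eq)
  show "cip x (A *v x) = cip ?y (A *v ?y) * of_real ((norm x)\<^sup>2)"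
    using assms by (simp add: mult_smult_vector cip_smult_left cip_smult_right power2_eq_square)
qed

lemma matrix_spectrum_subset_numerical_range: "matrix_spectrum A \<subseteq> numerical_range A"
proof
  fix z assume "z \<in> matrix_spectrum A"
  then obtain x where x: "x \<noteq> 0" "A *v x = z *s x"
    by (auto simp: matrix_spectrum_def)
  obtain w where "w \<in> numerical_range A" "cip x (A *v x) = w * of_real ((norm x)\<^sup>2)"
    using cip_in_numerical_range[OF x(1)] .
  with x show "z \<in> numerical_range A"
    by (simp add: cip_smult_right cip_self)
qed

section \<open>Resolvent\<close>

definition resolvent :: "complex^'n^'n \<Rightarrow> complex \<Rightarrow> complex^'n^'n" where
  "resolvent A z = matrix_inv (mat z - A)"

lemma notin_matrix_spectrum_iff: "z \<notin> matrix_spectrum A \<longleftrightarrow> invertible (mat z - A)"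
proof -
  have "invertible (mat z - A) \<longleftrightarrow> (\<forall>x. (mat z - A) *v x = 0 \<longrightarrow> x = 0)"
    by (simp add: invertible_left_inverse matrix_left_invertible_ker)
  then show ?thesis
    by (auto simp: matrix_spectrum_def matrix_vector_mult_diff_rdistrib mat_vector_mult)
qed

lemma
  assumes "z \<notin> matrix_spectrum A"
  shows resolvent_right: "(mat z - A) ** resolvent A z = mat 1"
    and resolvent_left: "resolvent A z ** (mat z - A) = mat 1"
proof -
  have "\<exists>B. (mat z - A) ** B = mat 1 \<and> B ** (mat z - A) = mat 1"
    using assms by (simp add: notin_matrix_spectrum_iff invertible_def)
  from someI_ex[OF this] show "(mat z - A) ** resolvent A z = mat 1" "resolvent A z ** (mat z - A) = mat 1"
    unfolding resolvent_def matrix_inv_def by blast+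
qed

lemma resolvent_eqI:
  assumes "z \<notin> matrix_spectrum A" "(mat z - A) ** B = C"
  shows "B = resolvent A z ** C"
proof -
  have "resolvent A z ** C = (resolvent A z ** (mat z - A)) ** B"
    by (simp only: assms(2)[symmetric] matrix_mul_assoc)
  then show ?thesis
    by (simp add: resolvent_left[OF assms(1)])
qed

text \<open>For \<open>y\<close> the image of \<open>x\<close> under the resolvent,
  \<open>cip y x\<close> is \<open>z - w\<close> times the squared norm of \<open>y\<close>, where
  \<open>w\<close> is the Rayleigh quotient of \<open>y\<close> and so lies in the numerical range.
  Cauchy-Schwarz does the rest.\<close>

lemma opnorm_resolvent_le:
  assumes "0 < d" "\<And>w. w \<in> numerical_range A \<Longrightarrow> d \<le> norm (z - w)"
  shows "opnorm (resolvent A z) \<le> 1 / d"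
proof (rule opnorm_le)
  fix x
  have z: "z \<notin> matrix_spectrum A"
    using assms matrix_spectrum_subset_numerical_range by fastforce
  let ?y = "resolvent A z *v x"
  have x: "(mat z - A) *v ?y = x"
    by (simp add: matrix_vector_mul_assoc resolvent_right[OF z])
  show "norm ?y \<le> 1 / d * norm x"
  proof (cases "?y = 0")
    case True
    then show ?thesis using assms(1) by simp
  next
    case False
    obtain w where w: "w \<in> numerical_range A" "cip ?y (A *v ?y) = w * of_real ((norm ?y)\<^sup>2)"
      using cip_in_numerical_range[OF False] .
    have "cip ?y x = cip ?y ((mat z - A) *v ?y)"
      by (simp only: x)
    also have "\<dots> = (z - w) * of_real ((norm ?y)\<^sup>2)"
      using w(2) by (simp add: matrix_vector_mult_diff_rdistrib mat_vector_mult cip_diff_right cip_smult_right cip_self algebra_simps)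
    finally have "norm (z - w) * (norm ?y)\<^sup>2 = norm (cip ?y x)"
      by (simp add: norm_mult norm_power)
    also have "\<dots> \<le> norm ?y * norm x"
      by (rule norm_cip_le)
    finally have "norm (z - w) * norm ?y \<le> norm x"
      using False by (simp add: power2_eq_square)
    moreover have "d * norm ?y \<le> norm (z - w) * norm ?y"
      by (intro mult_right_mono assms w) simp
    ultimately show ?thesis
      using assms(1) by (simp add: field_simps)
  qed
qed

text \<open>Cramer's rule exhibits the entries as quotients of determinants, from which their
  holomorphy in \<open>z\<close> is read off.\<close>

lemma resolvent_cramer:
  assumes "z \<notin> matrix_spectrum A"
  shows "resolvent A z $ r $ s =
    det (\<chi> i j. if j = r then axis s 1 $ i else (mat z - A) $ i $ j) / det (mat z - A)"
    and "det (mat z - A) \<noteq> 0"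
proof -
  show nz: "det (mat z - A) \<noteq> 0"
    using assms by (simp add: notin_matrix_spectrum_iff invertible_det_nz)
  have "(mat z - A) *v (resolvent A z *v axis s 1) = axis s 1"
    by (simp add: matrix_vector_mul_assoc resolvent_right[OF assms])
  then have "resolvent A z *v axis s 1 =
      (\<chi> k. det (\<chi> i j. if j = k then axis s 1 $ i else (mat z - A) $ i $ j) / det (mat z - A))"
    using cramer[OF nz] by blast
  then show "resolvent A z $ r $ s =
    det (\<chi> i j. if j = r then axis s 1 $ i else (mat z - A) $ i $ j) / det (mat z - A)"
    by (simp add: vec_eq_iff matrix_vector_mult_axis_nth)
qed

lemma holomorphic_on_det:
  fixes M :: "complex \<Rightarrow> complex^'n^'n"
  assumes "\<And>i j. (\<lambda>z. M z $ i $ j) holomorphic_on S"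
  shows "(\<lambda>z. det (M z)) holomorphic_on S"
  unfolding det_def by (intro holomorphic_intros assms)

lemma mat_entry_holomorphic: "(\<lambda>z. (mat z - A) $ i $ j) holomorphic_on S"
  by (cases "i = j") (auto simp: mat_def intro!: holomorphic_intros)

lemma resolvent_holomorphic: "(\<lambda>z. resolvent A z $ r $ s) holomorphic_on - matrix_spectrum A"
proof -
  have "(\<lambda>z. det (\<chi> i j. if j = r then axis s 1 $ i else (mat z - A) $ i $ j) / det (mat z - A))
      holomorphic_on - matrix_spectrum A"
  proof (intro holomorphic_on_divide holomorphic_on_det)
    fix i j
    show "(\<lambda>z. (\<chi> i j. if j = r then axis s 1 $ i else (mat z - A) $ i $ j) $ i $ j) holomorphic_on - matrix_spectrum A"
      using mat_entry_holomorphic[of A i j] by (cases "j = r") simp_all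
  next
    show "(\<lambda>z. (mat z - A) $ i $ j) holomorphic_on - matrix_spectrum A" for i j
      by (rule mat_entry_holomorphic)
    show "det (mat z - A) \<noteq> 0" if "z \<in> - matrix_spectrum A" for z
      using resolvent_cramer(2) that by blast
  qed
  then show ?thesis
    by (rule holomorphic_transform) (simp add: resolvent_cramer(1))
qed

text \<open>Eigenvalues are the zeros of the entire function \<open>det (mat z - A)\<close>,
  confined to a compact disc. Its nonzero value at \<open>opnorm A + 1\<close> shows that it is not
  identically 0.\<close>

lemma finite_matrix_spectrum: "finite (matrix_spectrum A)"
proof -
  let ?f = "\<lambda>z. det (mat z - A)" and ?r = "complex_of_real (opnorm A + 1)"
  have det: "z \<in> matrix_spectrum A \<longleftrightarrow> ?f z = 0" for z
    using notin_matrix_spectrum_iff[of z A] invertible_det_nz[of "mat z - A"] by blast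
  have bound: "norm z \<le> opnorm A" if "z \<in> matrix_spectrum A" for z
    using that matrix_spectrum_subset_numerical_range norm_numerical_range_le by blast
  have spec: "matrix_spectrum A = {z \<in> cball 0 (opnorm A). ?f z = 0}"
    using det bound by auto
  have nz: "?f ?r \<noteq> 0"
    using det[of ?r] bound[of ?r] opnorm_nonneg[of A] by (auto simp del: of_real_add)
  show ?thesis
  proof (cases "?f constant_on UNIV")
    case True
    then obtain c where "\<And>z. ?f z = c"
      unfolding constant_on_def by blast
    then have "matrix_spectrum A = {}"
      using nz det by auto
    then show ?thesis
      by simp
  next
    case False
    show ?thesis
      unfolding spec
      by (rule holomorphic_compact_finite_zeros[where S = UNIV])
         (use False in \<open>auto intro!: holomorphic_on_det mat_entry_holomorphic\<close>)
  qed
qed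

lemma matrix_diff_ldistrib: "A ** (B - C) = A ** B - A ** (C :: 'a::ring_1^'n^'m)"
  by (simp add: vec_eq_iff matrix_matrix_mult_def algebra_simps sum_subtractf)

lemma matrix_diff_rdistrib: "(A - B) ** C = A ** C - B ** (C :: 'a::ring_1^'n^'m)"
  by (simp add: vec_eq_iff matrix_matrix_mult_def algebra_simps sum_subtractf)

lemma resolvent_diff:
  assumes "z \<notin> matrix_spectrum A" "z \<notin> matrix_spectrum B"
  shows "resolvent B z - resolvent A z = resolvent B z ** (B - A) ** resolvent A z"
proof -
  have "resolvent B z ** (B - A) ** resolvent A z =
      resolvent B z ** ((mat z - A) - (mat z - B)) ** resolvent A z"
    by simp
  also have "\<dots> = resolvent B z ** ((mat z - A) ** resolvent A z) - (resolvent B z ** (mat z - B)) ** resolvent A z"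
    by (simp only: matrix_mul_assoc matrix_diff_ldistrib matrix_diff_rdistrib)
  finally show ?thesis
    by (simp add: resolvent_left resolvent_right assms)
qed

section \<open>Functional calculus on the unit circle\<close>

lemma filterlim_norm_minus_at_top: "filterlim (\<lambda>z::complex. norm z - c) at_top at_infinity"
proof -
  have "filterlim (\<lambda>z::complex. - c + norm z) at_top at_infinity"
    by (rule filterlim_tendsto_add_at_top[OF tendsto_const]) (rule filterlim_norm_at_top)
  then show ?thesis by simp
qed

lemma notin_matrix_spectrum_large: "opnorm A < norm z \<Longrightarrow> z \<notin> matrix_spectrum A"
  using matrix_spectrum_subset_numerical_range norm_numerical_range_le by fastforce

lemma resolvent_tendsto_0: "((\<lambda>z. resolvent A z $ r $ s) \<longlongrightarrow> 0) at_infinity"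
proof (rule Lim_null_comparison)
  show "eventually (\<lambda>z. norm (resolvent A z $ r $ s) \<le> inverse (norm z - opnorm A)) at_infinity"
  proof (rule eventually_at_infinityI)
    fix z :: complex assume z: "opnorm A + 1 \<le> norm z"
    have "norm z - opnorm A \<le> norm (z - w)" if "w \<in> numerical_range A" for w :: complex
      using norm_numerical_range_le[OF that] norm_triangle_ineq2[of z w] by simp
    then have "opnorm (resolvent A z) \<le> 1 / (norm z - opnorm A)"
      using z by (intro opnorm_resolvent_le) auto
    then show "norm (resolvent A z $ r $ s) \<le> inverse (norm z - opnorm A)"
      using norm_entry_le_opnorm[of "resolvent A z" r s] by (simp add: inverse_eq_divide)
  qed
  show "((\<lambda>z::complex. inverse (norm z - opnorm A)) \<longlongrightarrow> 0) at_infinity"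
    by (rule tendsto_inverse_0_at_top[OF filterlim_norm_minus_at_top])
qed

text \<open>Trades a factor \<open>z\<close> in front of a resolvent for a factor \<open>A\<close>,
  at the cost of a term with one resolvent fewer.\<close>

lemma resolvent_mult:
  assumes "z \<notin> matrix_spectrum A"
  shows "z * resolvent A z $ r $ s = mat 1 $ r $ s + (\<Sum>k\<in>UNIV. A $ r $ k * resolvent A z $ k $ s)"
proof -
  have "mat 1 $ r $ s = ((mat z - A) ** resolvent A z) $ r $ s"
    by (simp only: resolvent_right[OF assms])
  also have "\<dots> = (\<Sum>k\<in>UNIV. (mat z $ r $ k - A $ r $ k) * resolvent A z $ k $ s)"
    by (simp add: matrix_matrix_mult_def)
  also have "\<dots> = (\<Sum>k\<in>UNIV. mat z $ r $ k * resolvent A z $ k $ s) - (\<Sum>k\<in>UNIV. A $ r $ k * resolvent A z $ k $ s)"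
    by (simp add: algebra_simps sum_subtractf)
  also have "(\<Sum>k\<in>UNIV. mat z $ r $ k * resolvent A z $ k $ s) = z * resolvent A z $ r $ s"
    by (simp add: mat_def if_distrib if_distribR cong: if_cong)
  finally show ?thesis by simp
qed

lemma resolvent_times_tendsto: "((\<lambda>z. z * resolvent A z $ r $ s) \<longlongrightarrow> mat 1 $ r $ s) at_infinity"
proof (rule tendsto_cong[THEN iffD2])
  show "eventually (\<lambda>z. z * resolvent A z $ r $ s = mat 1 $ r $ s + (\<Sum>k\<in>UNIV. A $ r $ k * resolvent A z $ k $ s)) at_infinity"
    by (rule eventually_at_infinityI[of "opnorm A + 1"])
       (intro resolvent_mult notin_matrix_spectrum_large, simp)
  have "((\<lambda>z. mat 1 $ r $ s + (\<Sum>k\<in>UNIV. A $ r $ k * resolvent A z $ k $ s)) \<longlongrightarrow>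
      mat 1 $ r $ s + (\<Sum>k\<in>UNIV. A $ r $ k * 0)) at_infinity"
    by (intro tendsto_intros resolvent_tendsto_0)
  then show "((\<lambda>z. mat 1 $ r $ s + (\<Sum>k\<in>UNIV. A $ r $ k * resolvent A z $ k $ s)) \<longlongrightarrow> mat 1 $ r $ s) at_infinity"
    by simp
qed

section \<open>Univalent maps past the closed unit disc\<close>

locale disc_map =
  fixes F :: "complex \<Rightarrow> complex" and R :: real
  assumes R: "1 < R" and holF: "F holomorphic_on ball 0 R" and injF: "inj_on F (ball 0 R)"
begin

lemma in_ball: "norm z \<le> 1 \<Longrightarrow> z \<in> ball (0::complex) R"
  using R by auto

lemma holdF: "deriv F holomorphic_on ball 0 R"
  by (intro holomorphic_deriv holF) simp

lemma continuous_on_sphere: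
  assumes "h holomorphic_on ball 0 R"
  shows "continuous_on (sphere 0 1) h"
  by (rule continuous_on_subset[OF holomorphic_on_imp_continuous_on[OF assms]]) (use R in auto)

lemmas divdiff_F_nonzero = divdiff_nonzero[OF open_ball convex_ball holF injF]
lemmas kernel_F_holomorphic = kernel_reg_holomorphic[OF open_ball convex_ball holF injF]
lemmas kernel_F_eq = kernel_reg_eq[OF open_ball convex_ball holF injF]

text \<open>The argument principle for the injective \<open>F\<close>: in the splitting of the
  pulled back kernel, the Cauchy kernel contributes 1 and the regular part has no pole.\<close>

lemma circle_mean_kernel_inside:
  assumes "norm w < 1"
  shows "circle_mean (\<lambda>z. z * (deriv F z / (F z - F w))) = 1"
proof -
  have w: "w \<in> ball 0 R"
    using assms by (intro in_ball) simp
  have kr: "(\<lambda>z. kernel_reg F z w) holomorphic_on ball 0 R"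
    by (rule kernel_F_holomorphic(1)[OF w])
  have "circle_mean (\<lambda>z. z * (deriv F z / (F z - F w))) = circle_mean (\<lambda>z. z / (z - w) + z * kernel_reg F z w)"
  proof (rule circle_mean_cong)
    fix z :: complex assume "norm z = 1"
    then have "z \<in> ball 0 R" "z \<noteq> w"
      using assms in_ball[of z] by auto
    from kernel_F_eq[OF this(1) w this(2)]
    show "z * (deriv F z / (F z - F w)) = z / (z - w) + z * kernel_reg F z w"
      by (simp add: algebra_simps)
  qed
  also have "\<dots> = circle_mean (\<lambda>z. z / (z - w)) + circle_mean (\<lambda>z. z * kernel_reg F z w)"
  proof (rule circle_mean_add)
    show "continuous_on (sphere 0 1) (\<lambda>z. z / (z - w))"
      using assms by (auto intro!: continuous_intros)
    show "continuous_on (sphere 0 1) (\<lambda>z. z * kernel_reg F z w)"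
      by (intro continuous_intros continuous_on_sphere kr)
  qed
  also have "\<dots> = 1"
    using circle_mean_Cauchy_kernel[OF assms] circle_mean_mult_holomorphic[OF kr R] by simp
  finally show ?thesis .
qed

definition contour :: "real \<Rightarrow> complex" where
  "contour = F \<circ> circlepath 0 1"

lemma valid_path_contour: "valid_path contour"
  unfolding contour_def
  by (rule valid_path_compose_holomorphic[OF _ holF]) (use R in auto)

lemma loop_contour: "pathfinish contour = pathstart contour"
  by (simp add: contour_def pathfinish_compose pathstart_compose)

lemma path_image_contour: "path_image contour = F ` sphere 0 1"
  by (simp add: contour_def path_image_compose)

lemma contour_integral_contour:
  "contour_integral contour g = 2 * of_real pi * \<i> * circle_mean (\<lambda>z. z * (deriv F z * g (F z)))"
proof -
  have "F analytic_on ball 0 R"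
    using holF by (simp add: analytic_on_open)
  then have "contour_integral contour g = contour_integral (circlepath 0 1) (\<lambda>w. deriv F w * g (F w))"
    unfolding contour_def by (rule contour_integral_comp_analyticW) (use R in auto)
  then show ?thesis
    by (simp add: contour_integral_circlepath_eq_circle_mean)
qed

lemma winding_number_contour_eq:
  assumes "p \<notin> F ` sphere 0 1"
  shows "winding_number contour p = circle_mean (\<lambda>z. z * (deriv F z / (F z - p)))"
proof -
  have "winding_number contour p = 1 / (2 * of_real pi * \<i>) * contour_integral contour (\<lambda>w. 1 / (w - p))"
    using winding_number_valid_path[OF valid_path_contour, of p] assms by (simp add: path_image_contour)
  then show ?thesis
    by (simp add: contour_integral_contour)
qed

lemma image_ball_disjoint_sphere: "F ` ball 0 1 \<inter> F ` sphere 0 1 = {}"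
proof -
  have "F w \<noteq> F z" if "norm w < 1" "norm z = 1" for w z
    using inj_onD[OF injF, of w z] in_ball[of w] in_ball[of z] that by auto
  then show ?thesis
    by auto
qed

lemma winding_number_contour_inside:
  assumes "p \<in> F ` ball 0 1"
  shows "winding_number contour p = 1"
proof -
  have "p \<notin> F ` sphere 0 1"
    using assms image_ball_disjoint_sphere by blast
  then show ?thesis
    using assms circle_mean_kernel_inside by (auto simp: winding_number_contour_eq)
qed

lemma winding_number_contour_outside:
  assumes "p \<notin> F ` ball 0 R"
  shows "winding_number contour p = 0"
proof -
  have "F ` sphere 0 1 \<subseteq> F ` ball 0 R"
    using R by auto
  then have "p \<notin> F ` sphere 0 1"
    using assms by blast
  moreover have "circle_mean (\<lambda>z. z * (deriv F z / (F z - p))) = 0"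
    using assms by (intro circle_mean_mult_holomorphic[OF _ R] holomorphic_intros holF holdF) auto
  ultimately show ?thesis
    by (simp add: winding_number_contour_eq)
qed

text \<open>Moving the contour to infinity: by the residue theorem only the winding numbers matter.\<close>

lemma circle_mean_eq_limit_at_infinity:
  assumes "finite P" "P \<subseteq> F ` ball 0 1" "g holomorphic_on - P" "((\<lambda>z. z * g z) \<longlongrightarrow> L) at_infinity"
  shows "circle_mean (\<lambda>z. z * (deriv F z * g (F z))) = L"
proof -
  let ?m = "circle_mean (\<lambda>z. z * (deriv F z * g (F z)))"
  have hol: "g holomorphic_on UNIV - P"
    using assms(3) by (simp add: Compl_eq_Diff_UNIV)
  have "contour_integral contour g = 2 * pi * \<i> * (\<Sum>p\<in>P. winding_number contour p * residue g p)"
    using assms(1,2) hol image_ball_disjoint_sphere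
    by (intro Residue_theorem[where S = UNIV] valid_path_contour loop_contour)
       (auto simp: path_image_contour)
  then have m: "?m = (\<Sum>p\<in>P. residue g p)"
    using winding_number_contour_inside assms(2) by (simp add: contour_integral_contour subset_iff)
  have "norm (?m - L) \<le> e" if "e > 0" for e
  proof -
    obtain B where B: "\<And>z. B \<le> norm z \<Longrightarrow> dist (z * g z) L < e"
      using tendstoD[OF assms(4) \<open>e > 0\<close>] unfolding eventually_at_infinity by auto
    obtain C where C: "\<And>p. p \<in> P \<Longrightarrow> norm p \<le> C"
      using finite_imp_bounded[OF assms(1)] unfolding bounded_iff by auto
    \<comment> \<open>A circle that encloses \<open>P\<close> and on which \<open>z * g z\<close> is
      within \<open>e\<close> of \<open>L\<close>. Both it and \<open>contour\<close> yield the full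
      sum of residues.\<close>
    define r where "r = max (\<bar>B\<bar> + 1) (\<bar>C\<bar> + 1)"
    have r: "r > 0" "B \<le> r" "\<And>p. p \<in> P \<Longrightarrow> norm p < r"
      using C by (fastforce simp: r_def)+
    have "contour_integral (circlepath 0 r) g = 2 * pi * \<i> * (\<Sum>p\<in>P. winding_number (circlepath 0 r) p * residue g p)"
      using assms(1) hol r
      by (intro Residue_theorem[where S = UNIV]) (auto simp: less_imp_neq)
    also have "\<dots> = 2 * pi * \<i> * ?m"
      unfolding m using r by (simp add: winding_number_circlepath)
    finally have "?m = circle_mean (\<lambda>z. of_real r * z * g (of_real r * z))"
      using r(1) by (simp add: contour_integral_circlepath_eq_circle_mean)
    moreover have cont: "continuous_on (sphere 0 1) (\<lambda>z. of_real r * z * g (of_real r * z))"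
    proof (intro continuous_intros continuous_on_compose2[OF holomorphic_on_imp_continuous_on[OF assms(3)]])
      have "of_real r * z \<notin> P" if "norm z = 1" for z :: complex
        using r(1) r(3)[of "of_real r * z"] that by (auto simp: norm_mult)
      then show "(\<lambda>z. complex_of_real r * z) ` sphere 0 1 \<subseteq> - P"
        by auto
    qed
    ultimately have "?m - L = circle_mean (\<lambda>z. of_real r * z * g (of_real r * z) - L)"
      by (simp add: circle_mean_diff)
    also have "norm \<dots> \<le> e"
    proof (rule circle_mean_bound)
      fix z :: complex assume "norm z = 1"
      then have "B \<le> norm (of_real r * z)"
        using r by (simp add: norm_mult)
      from B[OF this] show "norm (of_real r * z * g (of_real r * z) - L) \<le> e"
        by (simp add: dist_norm)
    qed (intro continuous_intros cont)
    finally show ?thesis .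
  qed
  then have "norm (?m - L) \<le> 0"
    by (rule field_le_epsilon[where y = 0, simplified])
  then show ?thesis by simp
qed

end

section \<open>Functions of a matrix in disc coordinates\<close>

locale disc_calculus = disc_map +
  fixes A :: "complex^'n^'n"
  assumes W: "numerical_range A \<subseteq> F ` ball 0 1"
begin

lemma spectrum_subset: "matrix_spectrum A \<subseteq> F ` ball 0 1"
  using W matrix_spectrum_subset_numerical_range by blast

lemma sphere_notin_numerical_range: "norm z = 1 \<Longrightarrow> F z \<notin> numerical_range A"
  using W image_ball_disjoint_sphere by auto

lemma sphere_notin_spectrum: "norm z = 1 \<Longrightarrow> F z \<notin> matrix_spectrum A"
  using sphere_notin_numerical_range matrix_spectrum_subset_numerical_range by blast

text \<open>The resolvent entry together with the pulled back line element of
  \<open>contour\<close>, normalised so that \<open>circle_mean\<close> absorbs the factor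
  \<open>1 / (2 \<pi> \<i>)\<close>.\<close>

definition kern :: "complex \<Rightarrow> 'n \<Rightarrow> 'n \<Rightarrow> complex" where
  "kern z r s = z * deriv F z * resolvent A (F z) $ r $ s"

lemma continuous_on_resolvent_F: "continuous_on (sphere 0 1) (\<lambda>z. resolvent A (F z) $ r $ s)"
  by (rule continuous_on_compose2[OF holomorphic_on_imp_continuous_on[OF resolvent_holomorphic] continuous_on_sphere[OF holF]])
     (use sphere_notin_spectrum in auto)

lemma continuous_on_kern: "continuous_on (sphere 0 1) (\<lambda>z. kern z r s)"
  unfolding kern_def by (intro continuous_intros continuous_on_sphere holdF continuous_on_resolvent_F)

text \<open>The argument lives on the disc and not on its image: \<open>fcalc h\<close> stands for
  \<open>k(A)\<close> with \<open>k (F z) = h z\<close>, so that the inverse of \<open>F\<close>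
  never appears.\<close>

definition fcalc :: "(complex \<Rightarrow> complex) \<Rightarrow> complex^'n^'n" where
  "fcalc h = (\<chi> r s. circle_mean (\<lambda>z. h z * kern z r s))"

lemma fcalc_nth: "fcalc h $ r $ s = circle_mean (\<lambda>z. h z * kern z r s)"
  by (simp add: fcalc_def)

lemma fcalc_cong: "(\<And>z. norm z = 1 \<Longrightarrow> h z = h' z) \<Longrightarrow> fcalc h = fcalc h'"
  by (auto simp: vec_eq_iff fcalc_nth intro!: circle_mean_cong)

lemma fcalc_one: "fcalc (\<lambda>_. 1) = mat 1"
proof -
  have "circle_mean (\<lambda>z. z * (deriv F z * resolvent A (F z) $ r $ s)) = mat 1 $ r $ s" for r s
    by (rule circle_mean_eq_limit_at_infinity[OF finite_matrix_spectrum spectrum_subset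
          resolvent_holomorphic resolvent_times_tendsto])
  then show ?thesis
    by (simp add: vec_eq_iff fcalc_nth kern_def mult.assoc)
qed

lemma fcalc_cmult: "fcalc (\<lambda>z. c * h z) $ r $ s = c * fcalc h $ r $ s"
  by (simp add: fcalc_nth circle_mean_cmult mult.assoc)

lemma fcalc_diff:
  assumes "continuous_on (sphere 0 1) h" "continuous_on (sphere 0 1) h'"
  shows "fcalc (\<lambda>z. h z - h' z) = fcalc h - fcalc h'"
  by (simp add: vec_eq_iff fcalc_nth left_diff_distrib circle_mean_diff continuous_on_mult assms continuous_on_kern)

lemma fcalc_mult_F:
  assumes "h holomorphic_on ball 0 R"
  shows "fcalc (\<lambda>z. F z * h z) = A ** fcalc h"
proof -
  have "fcalc (\<lambda>z. F z * h z) $ r $ s = (A ** fcalc h) $ r $ s" for r s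
  proof -
    have "fcalc (\<lambda>z. F z * h z) $ r $ s =
      circle_mean (\<lambda>z. z * (deriv F z * h z * mat 1 $ r $ s) + (\<Sum>k\<in>UNIV. A $ r $ k * (h z * kern z k s)))"
      unfolding fcalc_nth
    proof (rule circle_mean_cong)
      fix z :: complex assume z: "norm z = 1"
      have "F z * h z * kern z r s = z * deriv F z * h z * (F z * resolvent A (F z) $ r $ s)"
        by (simp add: kern_def)
      also have "\<dots> = z * (deriv F z * h z * mat 1 $ r $ s) + (\<Sum>k\<in>UNIV. A $ r $ k * (h z * kern z k s))"
        unfolding resolvent_mult[OF sphere_notin_spectrum[OF z]]
        by (simp add: kern_def algebra_simps sum_distrib_left)
      finally show "F z * h z * kern z r s = z * (deriv F z * h z * mat 1 $ r $ s) + (\<Sum>k\<in>UNIV. A $ r $ k * (h z * kern z k s))" .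
    qed
    also have "\<dots> = circle_mean (\<lambda>z. z * (deriv F z * h z * mat 1 $ r $ s)) + (\<Sum>k\<in>UNIV. circle_mean (\<lambda>z. A $ r $ k * (h z * kern z k s)))"
      by (subst circle_mean_add)
         (auto intro!: circle_mean_sum continuous_intros continuous_on_sphere[OF holdF] continuous_on_sphere[OF assms] continuous_on_kern)
    also have "circle_mean (\<lambda>z. z * (deriv F z * h z * mat 1 $ r $ s)) = 0"
      by (intro circle_mean_mult_holomorphic[OF _ R] holomorphic_intros holdF assms)
    finally show ?thesis
      by (simp add: circle_mean_cmult matrix_matrix_mult_def fcalc_nth)
  qed
  then show ?thesis
    by (simp add: vec_eq_iff)
qed

text \<open>With \<open>k (F z) = h z\<close>, this is the divided difference of \<open>k\<close> at
  \<open>F a\<close> and \<open>F b\<close>, written without a singularity at \<open>a = b\<close>.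
  In \<open>quot_calc\<close> the second variable is replaced by \<open>A\<close>.\<close>

definition quot :: "(complex \<Rightarrow> complex) \<Rightarrow> complex \<Rightarrow> complex \<Rightarrow> complex" where
  "quot h a b = divdiff h a b / divdiff F a b"

definition quot_calc :: "(complex \<Rightarrow> complex) \<Rightarrow> complex \<Rightarrow> complex^'n^'n" where
  "quot_calc h a = fcalc (quot h a)"

context
  fixes h assumes h: "h holomorphic_on ball 0 R"
begin

lemma quot_mult:
  assumes "a \<in> ball 0 R" "b \<in> ball 0 R"
  shows "(F a - F b) * quot h a b = h a - h b"
proof -
  have "(F a - F b) * quot h a b = (a - b) * divdiff F a b * (divdiff h a b / divdiff F a b)"
    by (simp only: quot_def divdiff_mult[OF open_ball convex_ball holF assms])
  also have "\<dots> = h a - h b"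
    using divdiff_F_nonzero[OF assms] divdiff_mult[OF open_ball convex_ball h assms] by simp
  finally show ?thesis .
qed

lemma quot_holomorphic:
  shows "b \<in> ball 0 R \<Longrightarrow> (\<lambda>a. quot h a b) holomorphic_on ball 0 R"
    and "a \<in> ball 0 R \<Longrightarrow> (\<lambda>b. quot h a b) holomorphic_on ball 0 R"
  unfolding quot_def using divdiff_F_nonzero
  by (auto intro!: holomorphic_on_divide divdiff_holomorphic[OF open_ball convex_ball h] divdiff_holomorphic[OF open_ball convex_ball holF])

lemma continuous_on_quot: "continuous_on (ball 0 R \<times> ball 0 R) (\<lambda>(a, b). quot h a b)"
  unfolding quot_def case_prod_beta
  using divdiff_F_nonzero continuous_on_divdiff[OF open_ball convex_ball h] continuous_on_divdiff[OF open_ball convex_ball holF]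
  by (auto intro!: continuous_on_divide simp: case_prod_beta)

text \<open>Holomorphy extends to the points that \<open>F\<close> maps into the spectrum, where the
  resolvent is singular. This is what lets Cauchy's theorem be applied to a product containing a
  resolvent.\<close>

lemma quot_calc_holomorphic: "(\<lambda>a. quot_calc h a $ r $ s) holomorphic_on ball 0 R"
  unfolding quot_calc_def fcalc_nth
proof (rule circle_mean_holomorphic_param)
  show "continuous_on (ball 0 R \<times> sphere 0 1) (\<lambda>(a, z). quot h a z * kern z r s)"
    unfolding case_prod_beta
  proof (rule continuous_on_mult)
    show "continuous_on (ball 0 R \<times> sphere 0 1) (\<lambda>p. quot h (fst p) (snd p))"
      by (rule continuous_on_subset[OF continuous_on_quot[unfolded case_prod_beta]]) (use R in auto)
    show "continuous_on (ball 0 R \<times> sphere 0 1) (\<lambda>p. kern (snd p) r s)"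
      by (rule continuous_on_compose2[OF continuous_on_kern]) (auto intro!: continuous_intros)
  qed
  show "(\<lambda>a. quot h a z * kern z r s) holomorphic_on ball 0 R" if "norm z = 1" for z
    by (intro holomorphic_intros quot_holomorphic in_ball) (use that in simp)
qed simp

text \<open>The difference quotient with \<open>A\<close> in its second variable: multiplication by
  \<open>mat (F z) - A\<close> under the integral cancels the denominator and leaves
  \<open>h z\<close> minus the calculus of \<open>h\<close>.\<close>

lemma quot_calc_eq:
  assumes z: "norm z = 1"
  shows "quot_calc h z = resolvent A (F z) ** (mat (h z) - fcalc h)"
proof (rule resolvent_eqI[OF sphere_notin_spectrum[OF z]])
  have zb: "z \<in> ball 0 R"
    using z by (intro in_ball) simp
  note q = quot_holomorphic(2)[OF zb]
  have "A ** quot_calc h z = fcalc (\<lambda>b. F b * quot h z b)"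
    unfolding quot_calc_def by (rule fcalc_mult_F[OF q, symmetric])
  moreover have "(mat (F z) ** quot_calc h z) = fcalc (\<lambda>b. F z * quot h z b)"
    by (simp add: vec_eq_iff fcalc_cmult quot_calc_def matrix_matrix_mult_def mat_def if_distrib if_distribR cong: if_cong)
  ultimately have "(mat (F z) - A) ** quot_calc h z = fcalc (\<lambda>b. F z * quot h z b - F b * quot h z b)"
    by (subst fcalc_diff) (auto simp: matrix_diff_rdistrib intro!: continuous_intros continuous_on_sphere[OF holF] continuous_on_sphere[OF q])
  also have "\<dots> = fcalc (\<lambda>b. h z * 1 - h b)"
    using quot_mult[OF zb in_ball] by (intro fcalc_cong) (simp add: left_diff_distrib)
  also have "\<dots> = fcalc (\<lambda>b. h z * 1) - fcalc h"
    by (intro fcalc_diff continuous_intros continuous_on_sphere h)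
  also have "fcalc (\<lambda>b. h z * 1) = mat (h z)"
    by (simp only: vec_eq_iff fcalc_cmult fcalc_one) (simp add: mat_def)
  finally show "(mat (F z) - A) ** quot_calc h z = mat (h z) - fcalc h" .
qed

lemma quot_calc_nth:
  assumes z: "norm z = 1"
  shows "quot_calc h z $ r $ s = h z * resolvent A (F z) $ r $ s - (\<Sum>k\<in>UNIV. resolvent A (F z) $ r $ k * fcalc h $ k $ s)"
proof -
  have "(resolvent A (F z) ** mat (h z)) $ r $ s = h z * resolvent A (F z) $ r $ s"
    by (simp add: matrix_matrix_mult_def mat_def if_distrib if_distribR mult.commute cong: if_cong)
  moreover have "(resolvent A (F z) ** fcalc h) $ r $ s = (\<Sum>k\<in>UNIV. resolvent A (F z) $ r $ k * fcalc h $ k $ s)"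
    by (simp add: matrix_matrix_mult_def)
  ultimately show ?thesis
    unfolding quot_calc_eq[OF z] matrix_diff_ldistrib by simp
qed

end

text \<open>A double contour integral is avoided: \<open>quot_calc h\<close> is holomorphic in the
  disc, so its mean against \<open>z * g z * deriv F z\<close> is 0. Expanding it on the circle as
  the resolvent times \<open>mat (h z) - fcalc h\<close> gives the product rule.\<close>

lemma fcalc_mult:
  assumes g: "g holomorphic_on ball 0 R" and h: "h holomorphic_on ball 0 R"
  shows "fcalc (\<lambda>z. g z * h z) = fcalc g ** fcalc h"
proof -
  have "fcalc (\<lambda>z. g z * h z) $ r $ s = (fcalc g ** fcalc h) $ r $ s" for r s
  proof -
    have "0 = circle_mean (\<lambda>z. z * (g z * deriv F z * quot_calc h z $ r $ s))"
      by (rule circle_mean_mult_holomorphic[symmetric, OF _ R]) (intro holomorphic_intros g holdF quot_calc_holomorphic h)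
    also have "\<dots> = circle_mean (\<lambda>z. g z * h z * kern z r s - (\<Sum>k\<in>UNIV. g z * kern z r k * fcalc h $ k $ s))"
      by (rule circle_mean_cong)
         (simp add: quot_calc_nth[OF h] kern_def algebra_simps sum_distrib_left)
    also have "\<dots> = circle_mean (\<lambda>z. g z * h z * kern z r s) - (\<Sum>k\<in>UNIV. circle_mean (\<lambda>z. g z * kern z r k * fcalc h $ k $ s))"
      by (subst circle_mean_diff)
         (auto intro!: circle_mean_sum continuous_intros continuous_on_sphere[OF g] continuous_on_sphere[OF h] continuous_on_kern)
    finally show ?thesis
      by (simp add: circle_mean_cmult_right fcalc_nth matrix_matrix_mult_def)
  qed
  then show ?thesis
    by (simp add: vec_eq_iff)
qed

text \<open>The \<open>(u, v)\<close> entry of the Cauchy integral of \<open>h R E\<^sub>i\<^sub>j R\<close>, which will be the Frechet derivative.\<close>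

definition lcalc :: "(complex \<Rightarrow> complex) \<Rightarrow> 'n \<Rightarrow> 'n \<Rightarrow> 'n \<Rightarrow> 'n \<Rightarrow> complex" where
  "lcalc h u i j v = circle_mean (\<lambda>z. h z * kern z u i * resolvent A (F z) $ j $ v)"

text \<open>A product of two resolvents decays too fast at infinity to leave a residue
  there.\<close>

lemma lcalc_one: "lcalc (\<lambda>_. 1) u i j v = 0"
proof -
  have "((\<lambda>z. (z * resolvent A z $ u $ i) * resolvent A z $ j $ v) \<longlongrightarrow> mat 1 $ u $ i * 0) at_infinity"
    by (intro tendsto_mult resolvent_times_tendsto resolvent_tendsto_0)
  then have "((\<lambda>z. z * (resolvent A z $ u $ i * resolvent A z $ j $ v)) \<longlongrightarrow> 0) at_infinity"
    by (simp add: mult.assoc)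
  then have "circle_mean (\<lambda>z. z * (deriv F z * (resolvent A (F z) $ u $ i * resolvent A (F z) $ j $ v))) = 0"
    by (intro circle_mean_eq_limit_at_infinity[OF finite_matrix_spectrum spectrum_subset] holomorphic_intros resolvent_holomorphic)
  then show ?thesis
    by (simp add: lcalc_def kern_def mult.assoc)
qed

text \<open>The integral of two resolvents becomes two successive one-variable calculi. On the
  circle \<open>quot_calc h\<close> differs from \<open>h\<close> times the resolvent by the
  resolvent times \<open>fcalc h\<close>; that correction carries \<open>lcalc\<close> of the
  constant 1 and vanishes.\<close>

lemma lcalc_eq_fcalc_quot_calc:
  assumes h: "h holomorphic_on ball 0 R"
  shows "lcalc h u i j v = fcalc (\<lambda>z. quot_calc h z $ j $ v) $ u $ i"
proof -
  have "fcalc (\<lambda>z. quot_calc h z $ j $ v) $ u $ i =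
      circle_mean (\<lambda>z. h z * kern z u i * resolvent A (F z) $ j $ v -
        (\<Sum>k\<in>UNIV. 1 * kern z u i * resolvent A (F z) $ j $ k * fcalc h $ k $ v))"
    unfolding fcalc_nth
    by (rule circle_mean_cong) (simp add: quot_calc_nth[OF h] algebra_simps sum_distrib_left fcalc_nth)
  also have "\<dots> = lcalc h u i j v - (\<Sum>k\<in>UNIV. lcalc (\<lambda>_. 1) u i j k * fcalc h $ k $ v)"
    unfolding lcalc_def circle_mean_cmult_right[symmetric]
    by (subst circle_mean_diff)
       (auto intro!: circle_mean_sum continuous_intros continuous_on_sphere[OF h] continuous_on_kern continuous_on_resolvent_F)
  finally show ?thesis
    by (simp add: lcalc_one)
qed

text \<open>The left resolvent absorbs the factor \<open>F z\<close>. This recursion yields the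
  values on powers of \<open>F\<close>.\<close>

lemma lcalc_mult_F:
  assumes h: "h holomorphic_on ball 0 R"
  shows "lcalc (\<lambda>z. F z * h z) u i j v = mat 1 $ u $ i * fcalc h $ j $ v + (\<Sum>k\<in>UNIV. A $ u $ k * lcalc h k i j v)"
proof -
  have "lcalc (\<lambda>z. F z * h z) u i j v =
      circle_mean (\<lambda>z. mat 1 $ u $ i * (h z * kern z j v) + (\<Sum>k\<in>UNIV. A $ u $ k * (h z * kern z k i * resolvent A (F z) $ j $ v)))"
    unfolding lcalc_def
  proof (rule circle_mean_cong)
    fix z :: complex assume z: "norm z = 1"
    have "F z * h z * kern z u i * resolvent A (F z) $ j $ v = z * deriv F z * h z * (F z * resolvent A (F z) $ u $ i) * resolvent A (F z) $ j $ v"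
      by (simp add: kern_def)
    also have "\<dots> = mat 1 $ u $ i * (h z * kern z j v) + (\<Sum>k\<in>UNIV. A $ u $ k * (h z * kern z k i * resolvent A (F z) $ j $ v))"
      unfolding resolvent_mult[OF sphere_notin_spectrum[OF z]]
      by (simp add: kern_def algebra_simps sum_distrib_left sum_distrib_right)
    finally show "F z * h z * kern z u i * resolvent A (F z) $ j $ v = mat 1 $ u $ i * (h z * kern z j v) + (\<Sum>k\<in>UNIV. A $ u $ k * (h z * kern z k i * resolvent A (F z) $ j $ v))" .
  qed
  also have "\<dots> = circle_mean (\<lambda>z. mat 1 $ u $ i * (h z * kern z j v)) + (\<Sum>k\<in>UNIV. circle_mean (\<lambda>z. A $ u $ k * (h z * kern z k i * resolvent A (F z) $ j $ v)))"
    by (subst circle_mean_add)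
       (auto intro!: circle_mean_sum continuous_intros continuous_on_sphere[OF h] continuous_on_kern continuous_on_resolvent_F)
  finally show ?thesis
    by (simp add: circle_mean_cmult fcalc_nth lcalc_def)
qed

end

section \<open>The conjugate Cauchy transform\<close>

lemma circle_mean_swap:
  assumes "continuous_on (sphere 0 1 \<times> sphere 0 1) (\<lambda>(w, z). k w z)"
  shows "circle_mean (\<lambda>w. circle_mean (k w)) = circle_mean (\<lambda>z. circle_mean (\<lambda>w. k w z))"
proof -
  have "continuous_on (cbox (0, 0) (1, 1)) (\<lambda>p. (\<lambda>(w, z). k w z) (cis (2 * pi * fst p), cis (2 * pi * snd p)))"
    by (rule continuous_on_compose2[OF assms]) (auto intro!: continuous_intros)
  then have "continuous_on (cbox (0, 0) (1, 1)) (\<lambda>(s, t). k (cis (2 * pi * s)) (cis (2 * pi * t)))"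
    by (simp add: case_prod_beta)
  from integral_swap_continuous[OF this] show ?thesis
    by (simp add: circle_mean_def)
qed

text \<open>All poles lie inside the smaller circle, so both circles collect the same
  residues.\<close>

lemma circle_mean_change_radius:
  assumes "finite P" "P \<subseteq> ball 0 \<rho>" "\<phi> holomorphic_on ball 0 R - P" "0 < \<rho>" "\<rho> \<le> 1" "1 < R"
  shows "circle_mean (\<lambda>z. of_real \<rho> * z * \<phi> (of_real \<rho> * z)) = circle_mean (\<lambda>z. z * \<phi> z)"
proof -
  have *: "2 * of_real pi * \<i> * circle_mean (\<lambda>z. of_real r * z * \<phi> (of_real r * z)) = 2 * pi * \<i> * (\<Sum>p\<in>P. residue \<phi> p)"
    if r: "\<rho> \<le> r" "r \<le> 1" for r
  proof -
    have "contour_integral (circlepath 0 r) \<phi> = 2 * pi * \<i> * (\<Sum>p\<in>P. winding_number (circlepath 0 r) p * residue \<phi> p)"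
    proof (rule Residue_theorem[OF _ _ assms(1,3)])
      show "path_image (circlepath 0 r) \<subseteq> ball 0 R - P"
        using r assms by auto
      show "\<forall>z. z \<notin> ball 0 R \<longrightarrow> winding_number (circlepath 0 r) z = 0"
        using r assms by (auto intro!: winding_number_zero_outside[of _ "ball 0 R"])
    qed auto
    also have "(\<Sum>p\<in>P. winding_number (circlepath 0 r) p * residue \<phi> p) = (\<Sum>p\<in>P. residue \<phi> p)"
      using r assms by (intro sum.cong refl) (subst winding_number_circlepath, auto)
    finally show ?thesis
      using r assms by (simp add: contour_integral_circlepath_eq_circle_mean)
  qed
  show ?thesis
    using *[of \<rho>] *[of 1] assms by simp
qed

text \<open>On the circle \<open>cnj z = 1 / z\<close>, so the conjugated integrand is
  \<open>h z / (1 - cnj w * z)\<close>. This is holomorphic past the circle and has the value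
  \<open>h 0\<close> at 0, whatever \<open>w\<close> is.\<close>

lemma cnj_circle_mean_Cauchy:
  assumes "h holomorphic_on ball 0 R" "1 < R" "norm w < 1"
  shows "circle_mean (\<lambda>z. cnj (h z) * (z / (z - w))) = cnj (h 0)"
proof -
  \<comment> \<open>The pole of the conjugated integrand has modulus \<open>1 / norm w\<close>; a
    radius between 1 and that value is chosen.\<close>
  obtain R' where R': "1 < R'" "R' \<le> R" "R' * norm w < 1"
  proof (cases "w = 0")
    case False
    define t where "t = (1 + 1 / norm w) / 2"
    have "1 < 1 / norm w"
      using False assms(3) by simp
    then have "1 < t"
      by (simp add: t_def)
    have "t * norm w = (norm w + 1) / 2"
      using False by (simp add: t_def distrib_right)
    then have "t * norm w < 1"
      using assms(3) by simp
    moreover have "min R t * norm w \<le> t * norm w"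
      by (intro mult_right_mono) auto
    ultimately have "min R t * norm w < 1"
      by simp
    then show ?thesis
      using that[of "min R t"] \<open>1 < t\<close> assms(2) by simp
  qed (use assms(2) in \<open>auto intro: that[of R]\<close>)
  have nz: "1 - cnj w * z \<noteq> 0" if "z \<in> ball 0 R'" for z
  proof
    assume "1 - cnj w * z = 0"
    then have "norm (cnj w * z) = 1" by simp
    moreover have "norm (cnj w * z) \<le> R' * norm w"
      using mult_right_mono[of "norm z" R' "norm w"] that by (simp add: norm_mult mult.commute)
    ultimately show False using R' by simp
  qed
  have "(\<lambda>z. h z / (1 - cnj w * z)) holomorphic_on ball 0 R'"
    using nz R' by (intro holomorphic_intros holomorphic_on_subset[OF assms(1)]) auto
  from circle_mean_holomorphic[OF this R'(1)]
  have "circle_mean (\<lambda>z. h z / (1 - cnj w * z)) = h 0"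
    by simp
  moreover have "circle_mean (\<lambda>z. cnj (cnj (h z) * (z / (z - w)))) = circle_mean (\<lambda>z. h z / (1 - cnj w * z))"
  proof (rule circle_mean_cong)
    fix z :: complex assume z: "norm z = 1"
    then have "cnj z * z = 1"
      using complex_norm_square[of z] by (simp add: mult.commute)
    moreover from this have "z \<noteq> 0" by auto
    ultimately have cz: "cnj z = 1 / z"
      by (simp add: field_simps)
    have "1 / z - cnj w = (1 - cnj w * z) / z"
      using \<open>z \<noteq> 0\<close> by (simp add: diff_divide_distrib)
    then show "cnj (cnj (h z) * (z / (z - w))) = h z / (1 - cnj w * z)"
      using \<open>z \<noteq> 0\<close> by (simp add: cz)
  qed
  ultimately have "cnj (circle_mean (\<lambda>z. cnj (h z) * (z / (z - w)))) = h 0"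
    by (simp only: circle_mean_cnj[symmetric])
  from arg_cong[OF this, of cnj] show ?thesis
    by simp
qed

text \<open>In \<open>support\<close>, \<open>z * deriv F z\<close> is the outer normal of the image
  curve at \<open>F z\<close>, and the image of the closed disc lies on the inner side of the
  supporting line there. The radius \<open>\<rho>\<close> leaves room to move the contour
  inwards.\<close>

locale convex_disc_calculus = disc_calculus F R A for F R and A :: "complex^'n^'n" +
  fixes \<rho> :: real
  assumes support: "\<And>z w. norm z = 1 \<Longrightarrow> norm w \<le> 1 \<Longrightarrow> 0 \<le> Re ((F z - F w) / (z * deriv F z))"
    and \<rho>: "0 < \<rho>" "\<rho> < 1" and W\<rho>: "numerical_range A \<subseteq> F ` ball 0 \<rho>"
begin

lemma deriv_F_nonzero: "z \<in> ball 0 R \<Longrightarrow> deriv F z \<noteq> 0"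
  by (rule holomorphic_injective_imp_regular[OF holF open_ball injF])

lemma Re_inverse_nonneg: "0 \<le> Re c \<Longrightarrow> 0 \<le> Re (inverse c)"
  by simp

text \<open>For \<open>z \<noteq> w\<close> the quantity is twice the real part of
  \<open>z * deriv F z / (F z - F w)\<close>, because \<open>z / (z - w)\<close> has real part 1/2
  on the circle. The inverse of that quotient is the one in \<open>support\<close>, and inversion
  preserves a nonnegative real part.\<close>

lemma boundary_kernel_nonneg:
  assumes "norm z = 1" "norm w = 1"
  shows "0 \<le> 1 + 2 * Re (z * kernel_reg F z w)"
proof -
  have w: "w \<in> ball 0 R"
    using assms by (intro in_ball) simp
  have off: "0 \<le> 1 + 2 * Re (z * kernel_reg F z w)" if z: "z \<in> sphere 0 1 - {w}" for z
  proof -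
    have z1: "norm z = 1" "z \<noteq> w" and zb: "z \<in> ball 0 R"
      using z R by auto
    have half: "Re (z / (z - w)) = 1 / 2"
    proof -
      have "z / (z - w) + cnj (z / (z - w)) = 1"
      proof -
        have "cnj z * z = 1" "cnj w * w = 1"
          using complex_norm_square[of z] complex_norm_square[of w] z1 assms by (simp_all add: mult.commute)
        moreover from this have "z \<noteq> 0" "w \<noteq> 0" by auto
        ultimately have "cnj z = 1 / z" "cnj w = 1 / w"
          by (simp_all add: field_simps)
        then have "cnj (z / (z - w)) = (1 / z) / ((w - z) / (z * w))"
          using \<open>z \<noteq> 0\<close> \<open>w \<noteq> 0\<close> by (simp add: diff_divide_distrib)
        also have "\<dots> = - (w / (z - w))"
          using \<open>z \<noteq> 0\<close> \<open>w \<noteq> 0\<close> minus_divide_right[of w "z - w"] by simp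
        finally show ?thesis
          using z1 by (simp add: diff_divide_distrib[symmetric])
      qed
      then have "2 * Re (z / (z - w)) = 1"
        using complex_add_cnj[of "z / (z - w)"] by (simp only: of_real_eq_1_iff)
      then show ?thesis by simp
    qed
    have "0 \<le> Re ((F z - F w) / (z * deriv F z))"
      using support z1 assms by simp
    then have "0 \<le> Re (inverse ((F z - F w) / (z * deriv F z)))"
      by (rule Re_inverse_nonneg)
    also have "inverse ((F z - F w) / (z * deriv F z)) = z * (deriv F z / (F z - F w))"
      by (simp add: inverse_divide)
    also have "\<dots> = z / (z - w) + z * kernel_reg F z w"
      unfolding kernel_F_eq[OF zb w z1(2)] by (simp add: algebra_simps)
    finally show ?thesis
      using half by simp
  qed
  \<comment> \<open>The diagonal \<open>z = w\<close> is a limit of the case just settled.\<close>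
  have "w islimpt sphere (0::complex) 1"
  proof (rule connected_imp_perfect)
    have "(1::complex) \<in> sphere 0 1" "(-1::complex) \<in> sphere 0 1" "(1::complex) \<noteq> -1"
      by auto
    then show "sphere 0 1 \<noteq> {x}" for x :: complex
      by (metis singletonD)
  qed (use assms in \<open>auto simp: connected_sphere\<close>)
  then have "w \<in> closure (sphere 0 1 - {w})"
    by (simp add: islimpt_in_closure)
  then have "sphere 0 1 \<subseteq> closure (sphere 0 1 - {w})"
    using closure_subset[of "sphere 0 1 - {w}"] by blast
  moreover have "closure (sphere 0 1 - {w}) \<subseteq> sphere 0 1"
    by (rule closure_minimal) auto
  ultimately have cl: "closure (sphere 0 1 - {w}) = sphere 0 1"
    by blast
  note ck = continuous_on_sphere[OF kernel_F_holomorphic(1)[OF w]]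
  have "continuous_on (closure (sphere 0 1 - {w})) (\<lambda>z. 1 + 2 * Re (z * kernel_reg F z w))"
    unfolding cl by (intro continuous_intros ck)
  moreover have "z \<in> closure (sphere 0 1 - {w})"
    unfolding cl using assms by simp
  ultimately show ?thesis
    using off by (rule continuous_ge_on_closure)
qed

text \<open>The Cauchy transform of the boundary values of \<open>cnj h\<close>; by convexity its modulus on the circle
  is bounded by that of \<open>h\<close>.\<close>

definition mate :: "(complex \<Rightarrow> complex) \<Rightarrow> complex \<Rightarrow> complex" where
  "mate h w = cnj (h 0) + circle_mean (\<lambda>z. cnj (h z) * (z * kernel_reg F z w))"

context
  fixes h assumes h: "h holomorphic_on ball 0 R"
begin

lemma continuous_on_cnj_h: "continuous_on (sphere 0 1) (\<lambda>z. cnj (h z))"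
  by (intro continuous_intros continuous_on_sphere h)

lemma mate_holomorphic: "mate h holomorphic_on ball 0 R"
proof -
  have "(\<lambda>w. circle_mean (\<lambda>z. cnj (h z) * (z * kernel_reg F z w))) holomorphic_on ball 0 R"
  proof (rule circle_mean_holomorphic_param)
    have "continuous_on (ball 0 R \<times> sphere 0 1) (\<lambda>p. (\<lambda>(a, b). kernel_reg F a b) (snd p, fst p))"
      by (rule continuous_on_compose2[OF continuous_on_kernel_reg[OF open_ball convex_ball holF injF]])
         (use R in \<open>auto intro!: continuous_intros\<close>)
    moreover have "continuous_on (ball 0 R \<times> sphere 0 1) (\<lambda>p. h (snd p))"
      by (rule continuous_on_compose2[OF continuous_on_sphere[OF h]]) (auto intro!: continuous_intros)
    ultimately show "continuous_on (ball 0 R \<times> sphere 0 1) (\<lambda>(w, z). cnj (h z) * (z * kernel_reg F z w))"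
      unfolding case_prod_beta by (auto intro!: continuous_on_mult continuous_intros)
    show "(\<lambda>w. cnj (h z) * (z * kernel_reg F z w)) holomorphic_on ball 0 R" if "norm z = 1" for z
      by (intro holomorphic_intros kernel_F_holomorphic(2) in_ball) (use that in simp)
  qed simp
  then show ?thesis
    unfolding mate_def[abs_def] by (intro holomorphic_intros)
qed

text \<open>For \<open>w\<close> inside, the term \<open>cnj (h 0)\<close> of \<open>mate\<close> is
  the transform against the Cauchy kernel of the disc, so \<open>mate\<close> is the full Cauchy
  transform. The defining form makes sense on and beyond the circle as well.\<close>

lemma mate_inside:
  assumes "norm w < 1"
  shows "mate h w = circle_mean (\<lambda>z. cnj (h z) * (z * (deriv F z / (F z - F w))))"
proof -
  have w: "w \<in> ball 0 R"
    using assms by (intro in_ball) simp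
  have "mate h w = circle_mean (\<lambda>z. cnj (h z) * (z / (z - w))) + circle_mean (\<lambda>z. cnj (h z) * (z * kernel_reg F z w))"
    by (simp only: mate_def cnj_circle_mean_Cauchy[OF h R assms])
  also have "\<dots> = circle_mean (\<lambda>z. cnj (h z) * (z / (z - w)) + cnj (h z) * (z * kernel_reg F z w))"
  proof (rule circle_mean_add[symmetric])
    show "continuous_on (sphere 0 1) (\<lambda>z. cnj (h z) * (z / (z - w)))"
      using assms by (auto intro!: continuous_intros continuous_on_sphere[OF h])
    show "continuous_on (sphere 0 1) (\<lambda>z. cnj (h z) * (z * kernel_reg F z w))"
      by (intro continuous_intros continuous_on_sphere h kernel_F_holomorphic(1)[OF w])
  qed
  also have "\<dots> = circle_mean (\<lambda>z. cnj (h z) * (z * (deriv F z / (F z - F w))))"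
  proof (rule circle_mean_cong)
    fix z :: complex assume "norm z = 1"
    then have "z \<in> ball 0 R" "z \<noteq> w"
      using assms in_ball[of z] by auto
    from kernel_F_eq[OF this(1) w this(2)]
    show "cnj (h z) * (z / (z - w)) + cnj (h z) * (z * kernel_reg F z w) = cnj (h z) * (z * (deriv F z / (F z - F w)))"
      by (simp add: algebra_simps)
  qed
  finally show ?thesis .
qed

text \<open>By the maximum principle only the circle matters. There \<open>mate h w\<close> is the
  mean of \<open>cnj (h z)\<close> against the nonnegative kernel
  \<open>1 + 2 * Re (z * kernel_reg F z w)\<close>, whose total mass is 1.\<close>

lemma mate_bound:
  assumes c: "\<And>z. norm z \<le> 1 \<Longrightarrow> norm (h z) \<le> 1" and w: "norm w \<le> 1"
  shows "norm (mate h w) \<le> 1"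
proof (rule maximum_modulus_frontier[where f = "mate h" and S = "cball 0 1"])
  show "mate h holomorphic_on interior (cball 0 1)"
    using R by (intro holomorphic_on_subset[OF mate_holomorphic]) auto
  show "continuous_on (closure (cball 0 1)) (mate h)"
    using R by (intro holomorphic_on_imp_continuous_on holomorphic_on_subset[OF mate_holomorphic]) auto
  fix w assume "w \<in> frontier (cball (0::complex) 1)"
  then have w: "norm w = 1" and wb: "w \<in> ball 0 R"
    using R by auto
  note kr = kernel_F_holomorphic(1)[OF wb]
  note ck = continuous_on_sphere[OF kr]
  have ch: "cnj (h 0) = circle_mean (\<lambda>z. cnj (h z))"
    by (simp add: circle_mean_cnj circle_mean_holomorphic[OF h R])
  \<comment> \<open>A mean that vanishes by Cauchy's theorem is added in conjugated form; it
    completes the complex kernel to a real one.\<close>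
  have "circle_mean (\<lambda>z. z * (h z * kernel_reg F z w)) = 0"
    by (intro circle_mean_mult_holomorphic[OF _ R] holomorphic_intros h kr)
  then have z1: "circle_mean (\<lambda>z. cnj (z * (h z * kernel_reg F z w))) = 0"
    by (simp only: circle_mean_cnj complex_cnj_zero)
  have "mate h w = circle_mean (\<lambda>z. cnj (h z)) + circle_mean (\<lambda>z. cnj (h z) * (z * kernel_reg F z w)) + circle_mean (\<lambda>z. cnj (z * (h z * kernel_reg F z w)))"
    by (simp only: mate_def ch z1 add_0_right)
  also have "\<dots> = circle_mean (\<lambda>z. cnj (h z) + cnj (h z) * (z * kernel_reg F z w) + cnj (z * (h z * kernel_reg F z w)))"
  proof -
    have ca: "continuous_on (sphere 0 1) (\<lambda>z. cnj (h z))" "continuous_on (sphere 0 1) (\<lambda>z. cnj (h z) * (z * kernel_reg F z w))"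
      "continuous_on (sphere 0 1) (\<lambda>z. cnj (z * (h z * kernel_reg F z w)))"
      by (intro continuous_intros continuous_on_sphere[OF h] ck)+
    show ?thesis
      by (simp only: circle_mean_add[OF continuous_on_add[OF ca(1,2)] ca(3)] circle_mean_add[OF ca(1,2)])
  qed
  also have "\<dots> = circle_mean (\<lambda>z. cnj (h z) * of_real (1 + 2 * Re (z * kernel_reg F z w)))"
  proof (rule circle_mean_cong)
    fix z
    have "complex_of_real (1 + 2 * Re (z * kernel_reg F z w)) = 1 + z * kernel_reg F z w + cnj (z * kernel_reg F z w)"
      using complex_add_cnj[of "z * kernel_reg F z w"] by simp
    then show "cnj (h z) + cnj (h z) * (z * kernel_reg F z w) + cnj (z * (h z * kernel_reg F z w)) = cnj (h z) * of_real (1 + 2 * Re (z * kernel_reg F z w))"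
      by (simp only: complex_cnj_mult) (simp only: algebra_simps mult_1_left)
  qed
  \<comment> \<open>The majorant is the real part of a holomorphic function, so its mean is read off
    at 0.\<close>
  also have "norm \<dots> \<le> Re (circle_mean (\<lambda>z. 1 + z * kernel_reg F z w + z * kernel_reg F z w))"
  proof (rule circle_mean_norm_le)
    show "continuous_on (sphere 0 1) (\<lambda>z. cnj (h z) * of_real (1 + 2 * Re (z * kernel_reg F z w)))"
      "continuous_on (sphere 0 1) (\<lambda>z. 1 + z * kernel_reg F z w + z * kernel_reg F z w)"
      by (intro continuous_intros continuous_on_sphere[OF h] ck)+
    fix z :: complex assume z: "norm z = 1"
    have "norm (cnj (h z) * of_real (1 + 2 * Re (z * kernel_reg F z w))) = norm (h z) * (1 + 2 * Re (z * kernel_reg F z w))"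
      using boundary_kernel_nonneg[OF z w] by (simp add: norm_mult del: of_real_add of_real_mult)
    also have "\<dots> \<le> 1 * (1 + 2 * Re (z * kernel_reg F z w))"
      using boundary_kernel_nonneg[OF z w] c[of z] z by (intro mult_right_mono) auto
    finally show "norm (cnj (h z) * of_real (1 + 2 * Re (z * kernel_reg F z w))) \<le> Re (1 + z * kernel_reg F z w + z * kernel_reg F z w)"
      by simp
  qed
  also have "circle_mean (\<lambda>z. 1 + z * kernel_reg F z w + z * kernel_reg F z w) = 1"
    using circle_mean_holomorphic[of "\<lambda>z. 1 + z * kernel_reg F z w + z * kernel_reg F z w" R] R kr
    by (simp add: holomorphic_intros)
  finally show "norm (mate h w) \<le> 1"
    by simp
qed (use w in auto)

text \<open>Inside the disc the Cauchy transform has no singular kernel, so the calculus is moved to a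
  smaller circle that still surrounds the numerical range.\<close>

lemma fcalc_mate: "fcalc (mate h) $ r $ s = circle_mean (\<lambda>z. cnj (h z) * kern z r s)"
proof -
  let ?m = "\<lambda>z::complex. of_real \<rho> * z"
  have in1: "norm (?m z) < 1" if "z \<in> ball 0 (1 / \<rho>)" for z
    using that \<rho> by (simp add: norm_mult field_simps)
  have img: "?m ` ball 0 1 = ball 0 \<rho>"
  proof
    show "ball 0 \<rho> \<subseteq> ?m ` ball 0 1"
    proof
      fix x :: complex assume "x \<in> ball 0 \<rho>"
      then have "x = ?m (x / of_real \<rho>)" "x / of_real \<rho> \<in> ball 0 1"
        using \<rho> by (auto simp: norm_divide)
      then show "x \<in> ?m ` ball 0 1" by blast
    qed
  qed (use \<rho> in \<open>auto simp: norm_mult\<close>)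
  have dF: "deriv (\<lambda>w. F (?m w)) z = of_real \<rho> * deriv F (?m z)" if "z \<in> ball 0 (1 / \<rho>)" for z
  proof (rule DERIV_imp_deriv)
    have "?m z \<in> ball 0 R"
      using in1[OF that] R by simp
    then have "(F has_field_derivative deriv F (?m z)) (at (?m z))"
      using holF holomorphic_derivI by blast
    moreover have "(?m has_field_derivative of_real \<rho>) (at z)"
      by (auto intro!: derivative_eq_intros)
    ultimately have "((\<lambda>w. F (?m w)) has_field_derivative deriv F (?m z) * of_real \<rho>) (at z)"
      by (rule DERIV_chain2)
    then show "((\<lambda>w. F (?m w)) has_field_derivative of_real \<rho> * deriv F (?m z)) (at z)"
      by (simp only: mult.commute)
  qed
  \<comment> \<open>The same matrix in the coordinates of the map dilated by \<open>\<rho>\<close>,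
    whose unit circle corresponds to the circle of radius \<open>\<rho>\<close>.\<close>
  interpret S: disc_calculus "\<lambda>w. F (?m w)" "1 / \<rho>" A
  proof
    show "1 < 1 / \<rho>"
      using \<rho> by simp
    show "(\<lambda>w. F (?m w)) holomorphic_on ball 0 (1 / \<rho>)"
    proof (rule holomorphic_on_compose_gen[of ?m _ F "ball 0 R", unfolded o_def])
      show "?m holomorphic_on ball 0 (1 / \<rho>)"
        by (intro holomorphic_intros)
      show "?m ` ball 0 (1 / \<rho>) \<subseteq> ball 0 R"
        using in1 R by fastforce
    qed (rule holF)
    show "inj_on (\<lambda>w. F (?m w)) (ball 0 (1 / \<rho>))"
    proof (rule inj_onI)
      fix x y assume xy: "x \<in> ball 0 (1 / \<rho>)" "y \<in> ball 0 (1 / \<rho>)" "F (?m x) = F (?m y)"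
      have "?m x \<in> ball 0 R" "?m y \<in> ball 0 R"
        using in1[OF xy(1)] in1[OF xy(2)] R by simp_all
      then have "?m x = ?m y"
        by (rule inj_onD[OF injF xy(3)])
      then show "x = y"
        using \<rho> by simp
    qed
    show "numerical_range A \<subseteq> (\<lambda>w. F (?m w)) ` ball 0 1"
      using W\<rho> unfolding img[symmetric] image_image .
  qed
  \<comment> \<open>Since \<open>F z\<close> lies outside the image of the smaller disc, the dilated
    calculus of \<open>1 / (F z - F w)\<close> in \<open>w\<close> is the resolvent at
    \<open>F z\<close>.\<close>
  have inner: "circle_mean (\<lambda>w. cnj (h z) * (z * (deriv F z / (F z - F (?m w)))) * S.kern w r s) = cnj (h z) * kern z r s"
    if z: "norm z = 1" for z
  proof -
    have nz: "F z - F (?m w) \<noteq> 0" if "w \<in> ball 0 (1 / \<rho>)" for w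
      using in1[OF that] image_ball_disjoint_sphere z by fastforce
    have hol: "(\<lambda>w. 1 / (F z - F (?m w))) holomorphic_on ball 0 (1 / \<rho>)"
      by (intro holomorphic_intros S.holF nz)
    note c = S.continuous_on_sphere[OF hol] S.continuous_on_sphere[OF S.holF]
    have "(mat (F z) - A) ** S.fcalc (\<lambda>w. 1 / (F z - F (?m w))) =
        mat (F z) ** S.fcalc (\<lambda>w. 1 / (F z - F (?m w))) - S.fcalc (\<lambda>w. F (?m w) * (1 / (F z - F (?m w))))"
      by (simp only: matrix_diff_rdistrib S.fcalc_mult_F[OF hol])
    also have "mat (F z) ** S.fcalc (\<lambda>w. 1 / (F z - F (?m w))) = S.fcalc (\<lambda>w. F z * (1 / (F z - F (?m w))))"
      by (simp only: vec_eq_iff S.fcalc_cmult) (simp add: matrix_matrix_mult_def mat_def if_distrib if_distribR cong: if_cong)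
    also have "\<dots> - S.fcalc (\<lambda>w. F (?m w) * (1 / (F z - F (?m w)))) =
        S.fcalc (\<lambda>w. F z * (1 / (F z - F (?m w))) - F (?m w) * (1 / (F z - F (?m w))))"
      by (rule S.fcalc_diff[symmetric]) (intro continuous_on_mult continuous_on_const c)+
    also have "\<dots> = S.fcalc (\<lambda>_. 1)"
    proof (rule S.fcalc_cong)
      fix w :: complex assume "norm w = 1"
      then have "F z - F (?m w) \<noteq> 0"
        using nz[of w] \<rho> by simp
      then show "F z * (1 / (F z - F (?m w))) - F (?m w) * (1 / (F z - F (?m w))) = 1"
        by (simp add: diff_divide_distrib[symmetric])
    qed
    finally have "S.fcalc (\<lambda>w. 1 / (F z - F (?m w))) = resolvent A (F z)"
      using resolvent_eqI[OF sphere_notin_spectrum[OF z], of "S.fcalc (\<lambda>w. 1 / (F z - F (?m w)))" "mat 1"]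
      by (simp add: S.fcalc_one)
    then have "resolvent A (F z) $ r $ s = circle_mean (\<lambda>w. 1 / (F z - F (?m w)) * S.kern w r s)"
      by (simp only: S.fcalc_nth[symmetric])
    then have "cnj (h z) * kern z r s = circle_mean (\<lambda>w. cnj (h z) * (z * deriv F z) * (1 / (F z - F (?m w)) * S.kern w r s))"
      by (simp only: circle_mean_cmult kern_def mult.assoc)
    then show ?thesis
      by (simp add: mult_ac)
  qed
  \<comment> \<open>The poles of \<open>\<phi>\<close>: they lie in the disc of radius
    \<open>\<rho>\<close>, so the unit circle may be replaced by the circle of that radius.\<close>
  define P where "P = {w \<in> ball 0 R. F w \<in> matrix_spectrum A}"
  define \<phi> where "\<phi> = (\<lambda>w. mate h w * deriv F w * resolvent A (F w) $ r $ s)"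
  have "finite P"
    unfolding P_def using finite_vimage_IntI[OF finite_matrix_spectrum injF, of A]
    by (simp add: vimage_def Int_def conj_commute)
  moreover have "P \<subseteq> ball 0 \<rho>"
  proof
    fix w assume "w \<in> P"
    then have "w \<in> ball 0 R" "F w \<in> F ` ball 0 \<rho>"
      using W\<rho> matrix_spectrum_subset_numerical_range by (auto simp: P_def)
    then obtain w' where "w' \<in> ball 0 \<rho>" "F w = F w'" by blast
    moreover from this have "w' \<in> ball 0 R"
      using \<rho> R by auto
    ultimately show "w \<in> ball 0 \<rho>"
      using inj_onD[OF injF] \<open>w \<in> ball 0 R\<close> by blast
  qed
  moreover have "\<phi> holomorphic_on ball 0 R - P"
  proof -
    have "(\<lambda>w. resolvent A (F w) $ r $ s) holomorphic_on ball 0 R - P"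
      by (rule holomorphic_on_compose_gen[OF _ resolvent_holomorphic, unfolded o_def])
         (auto simp: P_def intro!: holomorphic_on_subset[OF holF])
    then show ?thesis
      unfolding \<phi>_def
      by (intro holomorphic_intros holomorphic_on_subset[OF mate_holomorphic] holomorphic_on_subset[OF holdF]) auto
  qed
  ultimately have "circle_mean (\<lambda>z. z * \<phi> z) = circle_mean (\<lambda>z. of_real \<rho> * z * \<phi> (of_real \<rho> * z))"
    using \<rho> R by (intro circle_mean_change_radius[symmetric]) auto
  moreover have "fcalc (mate h) $ r $ s = circle_mean (\<lambda>z. z * \<phi> z)"
    by (simp add: fcalc_nth \<phi>_def kern_def mult_ac)
  ultimately have "fcalc (mate h) $ r $ s = circle_mean (\<lambda>w. mate h (?m w) * S.kern w r s)"
  proof -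
    assume eq: "circle_mean (\<lambda>z. z * \<phi> z) = circle_mean (\<lambda>z. of_real \<rho> * z * \<phi> (of_real \<rho> * z))"
      "fcalc (mate h) $ r $ s = circle_mean (\<lambda>z. z * \<phi> z)"
    have "circle_mean (\<lambda>z. of_real \<rho> * z * \<phi> (of_real \<rho> * z)) = circle_mean (\<lambda>w. mate h (?m w) * S.kern w r s)"
    proof (rule circle_mean_cong)
      fix z :: complex assume "norm z = 1"
      then have "z \<in> ball 0 (1 / \<rho>)"
        using \<rho> by simp
      from dF[OF this] show "of_real \<rho> * z * \<phi> (of_real \<rho> * z) = mate h (?m z) * S.kern z r s"
        unfolding \<phi>_def S.kern_def by (simp only:) (simp only: mult_ac)
    qed
    then show ?thesis
      using eq by simp
  qed
  \<comment> \<open>On the smaller circle \<open>mate\<close> is a Cauchy integral with nonsingular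
    kernel. Exchanging the means then leaves \<open>inner\<close>.\<close>
  also have "\<dots> = circle_mean (\<lambda>w. circle_mean (\<lambda>z. cnj (h z) * (z * (deriv F z / (F z - F (?m w)))) * S.kern w r s))"
  proof (rule circle_mean_cong)
    fix w :: complex assume "norm w = 1"
    then have "norm (?m w) < 1"
      using \<rho> by (simp add: norm_mult)
    then show "mate h (?m w) * S.kern w r s = circle_mean (\<lambda>z. cnj (h z) * (z * (deriv F z / (F z - F (?m w)))) * S.kern w r s)"
      by (simp only: mate_inside circle_mean_cmult_right)
  qed
  also have "\<dots> = circle_mean (\<lambda>z. circle_mean (\<lambda>w. cnj (h z) * (z * (deriv F z / (F z - F (?m w)))) * S.kern w r s))"
  proof (rule circle_mean_swap)
    have c1: "continuous_on (sphere 0 1 \<times> sphere 0 1) (\<lambda>p. g (snd p))" if "continuous_on (sphere 0 1) g" for g :: "complex \<Rightarrow> complex"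
      by (rule continuous_on_compose2[OF that]) (auto intro!: continuous_intros)
    have c2: "continuous_on (sphere 0 1 \<times> sphere 0 1) (\<lambda>p. g (fst p))" if "continuous_on (sphere 0 1) g" for g :: "complex \<Rightarrow> complex"
      by (rule continuous_on_compose2[OF that]) (auto intro!: continuous_intros)
    have nz: "F z - F (?m w) \<noteq> 0" if "norm z = 1" "norm w = 1" for z w
    proof -
      have "norm (?m w) < 1"
        using \<rho> that by (simp add: norm_mult)
      then show ?thesis
        using image_ball_disjoint_sphere that by fastforce
    qed
    show "continuous_on (sphere 0 1 \<times> sphere 0 1) (\<lambda>(w, z). cnj (h z) * (z * (deriv F z / (F z - F (?m w)))) * S.kern w r s)"
      unfolding case_prod_beta
    proof (rule continuous_on_mult[OF continuous_on_mult[OF c1[OF continuous_on_cnj_h]] c2[OF S.continuous_on_kern]],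
        rule continuous_on_mult[OF c1[OF continuous_on_id]], rule continuous_on_divide)
      show "continuous_on (sphere 0 1 \<times> sphere 0 1) (\<lambda>p. deriv F (snd p))"
        by (rule c1[OF continuous_on_sphere[OF holdF]])
      show "continuous_on (sphere 0 1 \<times> sphere 0 1) (\<lambda>p. F (snd p) - F (?m (fst p)))"
        by (rule continuous_on_diff[OF c1[OF continuous_on_sphere[OF holF]] c2[OF S.continuous_on_sphere[OF S.holF]]])
    qed (use nz in auto)
  qed
  also have "\<dots> = circle_mean (\<lambda>z. cnj (h z) * kern z r s)"
    by (rule circle_mean_cong) (rule inner)
  finally show ?thesis .
qed

end

end

section \<open>The theorem of Crouzeix and Palencia\<close>

lemma Re_mult_of_real: "Re (c * of_real r) = Re c * r"
  by simp

lemma matrix_add_rdistrib: "(A + B) ** C = A ** C + B ** (C :: 'a::semiring_1^'n^'m)"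
  by (simp add: vec_eq_iff matrix_matrix_mult_def distrib_right sum.distrib)

context convex_disc_calculus
begin

definition kmat :: "complex \<Rightarrow> complex^'n^'n" where
  "kmat z = (\<chi> r s. kern z r s)"

lemma kmat_mult_vector: "kmat z *v x = (z * deriv F z) *s (resolvent A (F z) *v x)"
  by (simp add: vec_eq_iff kmat_def kern_def matrix_vector_mult_def sum_distrib_left mult_ac)

lemma cip_circle_mean_kern:
  assumes "continuous_on (sphere 0 1) g"
  shows "cip y ((\<chi> r s. circle_mean (\<lambda>z. g z * kern z r s)) *v x) = circle_mean (\<lambda>z. g z * cip y (kmat z *v x))"
proof -
  have "circle_mean (\<lambda>z. g z * cip y (kmat z *v x)) = circle_mean (\<lambda>z. \<Sum>r\<in>UNIV. \<Sum>s\<in>UNIV. cnj (y $ r) * x $ s * (g z * kern z r s))"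
    by (rule circle_mean_cong) (simp add: cip_def matrix_vector_mult_def kmat_def sum_distrib_left mult_ac)
  also have "\<dots> = (\<Sum>r\<in>UNIV. \<Sum>s\<in>UNIV. circle_mean (\<lambda>z. cnj (y $ r) * x $ s * (g z * kern z r s)))"
    by (subst circle_mean_sum, simp, intro continuous_intros assms continuous_on_kern,
        intro sum.cong refl circle_mean_sum continuous_intros assms continuous_on_kern) simp
  also have "\<dots> = (\<Sum>r\<in>UNIV. \<Sum>s\<in>UNIV. cnj (y $ r) * x $ s * circle_mean (\<lambda>z. g z * kern z r s))"
    by (simp only: circle_mean_cmult)
  also have "\<dots> = cip y ((\<chi> r s. circle_mean (\<lambda>z. g z * kern z r s)) *v x)"
    by (simp add: cip_def matrix_vector_mult_def sum_distrib_left mult_ac)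
  finally show ?thesis by simp
qed

lemma continuous_on_cip_kmat: "continuous_on (sphere 0 1) (\<lambda>z. cip y (kmat z *v x))"
  unfolding cip_def matrix_vector_mult_def kmat_def
  by (simp, intro continuous_intros continuous_on_kern)

text \<open>With \<open>y\<close> the resolvent applied to \<open>x\<close> and \<open>w\<close> the
  Rayleigh quotient of \<open>y\<close>, the sign is that of the real part of
  \<open>(F z - w) / (z * deriv F z)\<close>. As \<open>w\<close> lies in the image of the disc,
  \<open>support\<close> applies.\<close>

lemma kmat_accretive:
  assumes z: "norm z = 1"
  shows "0 \<le> Re (cip x (kmat z *v x))"
proof (cases "resolvent A (F z) *v x = 0")
  case True
  then show ?thesis
    by (simp add: kmat_mult_vector)
next
  case False
  define y where "y = resolvent A (F z) *v x"
  define c where "c = z * deriv F z"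
  have c: "c \<noteq> 0"
    using deriv_F_nonzero[of z] in_ball[of z] z by (auto simp: c_def)
  have x: "(mat (F z) - A) *v y = x"
    by (simp add: y_def matrix_vector_mul_assoc resolvent_right[OF sphere_notin_spectrum[OF z]])
  obtain w where w: "w \<in> numerical_range A" "cip y (A *v y) = w * of_real ((norm y)\<^sup>2)"
    using cip_in_numerical_range[of y A] False by (auto simp: y_def)
  obtain w' where w': "w = F w'" "norm w' \<le> 1"
    using W w(1) by force
  have q: "0 \<le> Re ((F z - w) / c)"
    using support[OF z w'(2)] by (simp add: c_def w'(1))
  have "cip y x = cip y ((mat (F z) - A) *v y)"
    by (simp only: x)
  also have "\<dots> = (F z - w) * of_real ((norm y)\<^sup>2)"
    using w(2) by (simp add: matrix_vector_mult_diff_rdistrib mat_vector_mult cip_diff_right cip_smult_right cip_self algebra_simps)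
  finally have "cip x y = cnj (F z - w) * of_real ((norm y)\<^sup>2)"
    using cnj_cip[of y x] by simp
  then have "cip x (kmat z *v x) = c * cnj (F z - w) * of_real ((norm y)\<^sup>2)"
    by (simp add: kmat_mult_vector cip_smult_right y_def[symmetric] c_def mult.assoc)
  then have "Re (cip x (kmat z *v x)) = Re (c * cnj (F z - w)) * (norm y)\<^sup>2"
    by (simp only: Re_mult_of_real)
  moreover have "Re (c * cnj (F z - w)) = Re ((F z - w) / c) * (norm c)\<^sup>2"
  proof -
    have "c * cnj (F z - w) = cnj ((F z - w) / c) * of_real ((norm c)\<^sup>2)"
      unfolding complex_norm_square using c by simp
    then have "Re (c * cnj (F z - w)) = Re (cnj ((F z - w) / c)) * (norm c)\<^sup>2"
      by (simp only: Re_mult_of_real)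
    then show ?thesis by (simp only: cnj.sel)
  qed
  ultimately show ?thesis
    using q by simp
qed

text \<open>The sesquilinear form of \<open>kmat z\<close> plus its adjoint, Hermitian and, by
  \<open>kmat_accretive\<close>, positive semidefinite on the circle.\<close>

definition pform :: "complex \<Rightarrow> complex^'n \<Rightarrow> complex^'n \<Rightarrow> complex" where
  "pform z x y = cip y (kmat z *v x) + cnj (cip x (kmat z *v y))"

text \<open>Positivity at \<open>x - c *s y\<close>, where \<open>c\<close> rotates the cross term
  to its modulus. This additive form of Cauchy-Schwarz passes through means over the circle by
  linearity.\<close>

lemma pform_le:
  assumes z: "norm z = 1"
  shows "norm (pform z x y) \<le> Re ((pform z x x + pform z y y) / 2)"
proof -
  define c where "c = sgn (pform z x y)"
  have cc: "Re (cnj c * pform z x y) = norm (pform z x y)"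
  proof (cases "pform z x y = 0")
    case False
    have "cnj c * pform z x y = of_real (norm (pform z x y))"
      using False complex_norm_square[of "pform z x y"] by (simp add: c_def sgn_eq field_simps power2_eq_square)
    then show ?thesis by simp
  qed simp
  have pos: "0 \<le> Re (pform z v v)" for v
    using kmat_accretive[OF z, of v] by (simp add: pform_def)
  have sym: "pform z y x = cnj (pform z x y)"
    by (simp add: pform_def)
  have "pform z (x - c *s y) (x - c *s y) =
      pform z x x - cnj c * pform z x y - c * pform z y x + (c * cnj c) * pform z y y"
    by (simp add: pform_def matrix_vector_mult_diff_distrib mult_smult_vector cip_diff_left cip_diff_right
        cip_smult_left cip_smult_right algebra_simps)
  then have "Re (pform z (x - c *s y) (x - c *s y)) =
      Re (pform z x x) - 2 * norm (pform z x y) + Re ((c * cnj c) * pform z y y)"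
    using cc by (simp add: sym)
  also have "Re ((c * cnj c) * pform z y y) = (norm c)\<^sup>2 * Re (pform z y y)"
    by (simp add: complex_norm_square[symmetric] del: of_real_power)
  also have "\<dots> \<le> 1 * Re (pform z y y)"
    by (intro mult_right_mono pos) (simp add: c_def norm_sgn)
  finally show ?thesis
    using pos[of "x - c *s y"] by simp
qed

text \<open>By \<open>fcalc_mate\<close>, the adjoint of the calculus of \<open>mate h\<close>
  integrates \<open>h\<close> against the adjoint kernel. The sum integrates \<open>h\<close>
  against the positive \<open>pform\<close>, whose total mass is twice the identity.\<close>

lemma opnorm_fcalc_add_mate:
  assumes h: "h holomorphic_on ball 0 R" and c: "\<And>z. norm z \<le> 1 \<Longrightarrow> norm (h z) \<le> 1"
  shows "opnorm (fcalc h + conj_transpose (fcalc (mate h))) \<le> 2"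
proof -
  let ?B = "fcalc h + conj_transpose (fcalc (mate h))"
  note ch = continuous_on_sphere[OF h]
  have form: "cip y (?B *v x) = circle_mean (\<lambda>z. h z * pform z x y)" for x y
  proof -
    have 1: "cip y (fcalc h *v x) = circle_mean (\<lambda>z. h z * cip y (kmat z *v x))"
      unfolding fcalc_def by (rule cip_circle_mean_kern[OF ch])
    have m: "fcalc (mate h) = (\<chi> r s. circle_mean (\<lambda>z. cnj (h z) * kern z r s))"
      by (simp add: vec_eq_iff fcalc_mate[OF h])
    have "cip x (fcalc (mate h) *v y) = circle_mean (\<lambda>z. cnj (h z) * cip x (kmat z *v y))"
      unfolding m by (rule cip_circle_mean_kern[OF continuous_on_cnj[OF ch]])
    then have "cip (fcalc (mate h) *v y) x = cnj (circle_mean (\<lambda>z. cnj (h z) * cip x (kmat z *v y)))"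
      by (metis cnj_cip)
    then have 2: "cip y (conj_transpose (fcalc (mate h)) *v x) = circle_mean (\<lambda>z. h z * cnj (cip x (kmat z *v y)))"
      by (simp add: cip_conj_transpose_right circle_mean_cnj[symmetric])
    have "cip y (?B *v x) = circle_mean (\<lambda>z. h z * cip y (kmat z *v x)) + circle_mean (\<lambda>z. h z * cnj (cip x (kmat z *v y)))"
      by (simp only: matrix_vector_mult_add_rdistrib cip_add_right 1 2)
    also have "\<dots> = circle_mean (\<lambda>z. h z * cip y (kmat z *v x) + h z * cnj (cip x (kmat z *v y)))"
      by (rule circle_mean_add[symmetric]) (intro continuous_intros ch continuous_on_cip_kmat)+
    finally show ?thesis
      by (simp only: pform_def distrib_left)
  qed
  have cp: "continuous_on (sphere 0 1) (\<lambda>z. pform z x y)" for x y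
    unfolding pform_def by (intro continuous_intros continuous_on_cip_kmat)
  have mass: "circle_mean (\<lambda>z. pform z x x) = 2 * of_real ((norm x)\<^sup>2)" for x
  proof -
    have 1: "circle_mean (\<lambda>z. cip x (kmat z *v x)) = of_real ((norm x)\<^sup>2)"
    proof -
      have "cip x (fcalc (\<lambda>_. 1) *v x) = circle_mean (\<lambda>z. 1 * cip x (kmat z *v x))"
        unfolding fcalc_def by (rule cip_circle_mean_kern[OF continuous_on_const])
      then show ?thesis
        by (simp add: fcalc_one cip_self)
    qed
    have "circle_mean (\<lambda>z. pform z x x) = circle_mean (\<lambda>z. cip x (kmat z *v x)) + circle_mean (\<lambda>z. cnj (cip x (kmat z *v x)))"
      unfolding pform_def by (rule circle_mean_add) (intro continuous_intros continuous_on_cip_kmat)+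
    then show ?thesis
      by (simp only: circle_mean_cnj 1) simp
  qed
  have bound: "norm (cip y (?B *v x)) \<le> (norm x)\<^sup>2 + (norm y)\<^sup>2" for x y
  proof -
    have "norm (circle_mean (\<lambda>z. h z * pform z x y)) \<le> Re (circle_mean (\<lambda>z. (pform z x x + pform z y y) / 2))"
    proof (rule circle_mean_norm_le)
      fix z :: complex assume z: "norm z = 1"
      have "norm (h z * pform z x y) \<le> 1 * norm (pform z x y)"
        unfolding norm_mult using c z by (intro mult_right_mono) auto
      also have "\<dots> \<le> Re ((pform z x x + pform z y y) / 2)"
        using pform_le[OF z] by simp
      finally show "norm (h z * pform z x y) \<le> Re ((pform z x x + pform z y y) / 2)" .
    qed (intro continuous_intros ch cp; simp)+
    also have "circle_mean (\<lambda>z. (pform z x x + pform z y y) / 2) = (circle_mean (\<lambda>z. pform z x x) + circle_mean (\<lambda>z. pform z y y)) * (1 / 2)"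
      by (simp only: circle_mean_add[OF cp cp, symmetric] circle_mean_cmult_right[symmetric]) simp
    also have "Re \<dots> = (norm x)\<^sup>2 + (norm y)\<^sup>2"
      by (simp add: mass)
    finally show ?thesis
      by (simp only: form)
  qed
  show ?thesis
  proof (rule opnorm_le)
    fix x
    let ?y = "?B *v x"
    show "norm ?y \<le> 2 * norm x"
    proof (cases "?y = 0 \<or> x = 0")
      case False
      \<comment> \<open>Scaling the test vector to the length of \<open>x\<close> turns the bound by
        a sum of squares into one by a product.\<close>
      let ?t = "complex_of_real (norm x / norm ?y)"
      have "cip (?t *s ?y) ?y = of_real (norm x * norm ?y)"
        using False by (simp add: cip_smult_left cip_self power2_eq_square)
      then have "norm (cip (?t *s ?y) ?y) = norm x * norm ?y"
        by (simp only: norm_of_real) simp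
      then have "norm x * norm ?y \<le> (norm x)\<^sup>2 + (norm (?t *s ?y))\<^sup>2"
        using bound[of "?t *s ?y" x] by simp
      also have "norm (?t *s ?y) = norm x"
        using False by (simp add: norm_smult norm_divide)
      finally have "norm x * norm ?y \<le> norm x * (2 * norm x)"
        by (simp add: power2_eq_square)
      then show ?thesis
        using False by simp
    qed auto
  qed
qed

section \<open>The best constant\<close>

definition unit_class :: "(complex \<Rightarrow> complex) set" where
  "unit_class = {h. h holomorphic_on ball 0 R \<and> (\<forall>z. norm z \<le> 1 \<longrightarrow> norm (h z) \<le> 1)}"

text \<open>A crude bound on the kernel entries. Finiteness of the supremum is what makes an
  estimate of the best constant in terms of itself meaningful.\<close>

lemma opnorm_fcalc_bdd_above: "bdd_above ((\<lambda>h. opnorm (fcalc h)) ` unit_class)"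
proof -
  have "\<exists>c. \<forall>z. norm z = 1 \<longrightarrow> norm (kern z r s) \<le> c" for r s
  proof -
    have "compact ((\<lambda>z. kern z r s) ` sphere 0 1)"
      by (intro compact_continuous_image continuous_on_kern) simp
    then have "bounded ((\<lambda>z. kern z r s) ` sphere 0 1)"
      by (rule compact_imp_bounded)
    then obtain b where "\<forall>x\<in>(\<lambda>z. kern z r s) ` sphere 0 1. norm x \<le> b"
      unfolding bounded_iff by blast
    then show ?thesis
      by (intro exI[of _ b]) simp
  qed
  then obtain c where c: "\<And>r s z. norm z = 1 \<Longrightarrow> norm (kern z r s) \<le> c r s"
    by metis
  show ?thesis
  proof (rule bdd_aboveI2)
    fix h assume "h \<in> unit_class"
    then have h: "h holomorphic_on ball 0 R" "\<And>z. norm z \<le> 1 \<Longrightarrow> norm (h z) \<le> 1"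
      by (auto simp: unit_class_def)
    have entry: "norm (fcalc h $ r $ s) \<le> c r s" for r s
      unfolding fcalc_nth
    proof (rule circle_mean_bound)
      fix z :: complex assume "norm z = 1"
      then show "norm (h z * kern z r s) \<le> c r s"
        using mult_mono[of "norm (h z)" 1 "norm (kern z r s)" "c r s"] h(2)[of z] c[of z r s]
        by (simp add: norm_mult)
    qed (intro continuous_intros continuous_on_sphere[OF h(1)] continuous_on_kern)
    have "opnorm (fcalc h) \<le> norm (fcalc h)"
      by (rule opnorm_le_norm)
    also have "\<dots> \<le> (\<Sum>r\<in>UNIV. \<Sum>s\<in>UNIV. norm (fcalc h $ r $ s))"
      by (rule norm_matrix_le_sum)
    also have "\<dots> \<le> (\<Sum>r\<in>UNIV. \<Sum>s\<in>UNIV. c r s)"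
      by (intro sum_mono entry)
    finally show "opnorm (fcalc h) \<le> (\<Sum>r\<in>UNIV. \<Sum>s\<in>UNIV. c r s)" .
  qed
qed

text \<open>The argument of Crouzeix and Palencia in the form of Ransford and Schwenninger: with
  \<open>B = h(A)\<close> and \<open>C = (mate h)(A)\<close> one has \<open>B C B = (h (mate h) h)(A)\<close>, so that \<open>(B B\<^sup>*)\<^sup>2\<close> is a
  difference of two products in each of which a factor is controlled.\<close>

lemma opnorm_fcalc_unit_class:
  assumes "h \<in> unit_class"
  shows "opnorm (fcalc h) \<le> 1 + sqrt 2"
proof -
  define K where "K = (SUP h\<in>unit_class. opnorm (fcalc h))"
  have K: "opnorm (fcalc h) \<le> K" if "h \<in> unit_class" for h
    unfolding K_def by (rule cSUP_upper[OF that opnorm_fcalc_bdd_above])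
  have K0: "0 \<le> K"
    by (rule order.trans[OF opnorm_nonneg K[OF assms]])
  have cube: "opnorm (fcalc h) ^ 3 \<le> 2 * K\<^sup>2 + K" if hu: "h \<in> unit_class" for h
  proof -
    have h: "h holomorphic_on ball 0 R" "\<And>z. norm z \<le> 1 \<Longrightarrow> norm (h z) \<le> 1"
      using hu by (auto simp: unit_class_def)
    note m = mate_holomorphic[OF h(1)] mate_bound[OF h]
    define B where "B = fcalc h"
    define C where "C = fcalc (mate h)"
    define D where "D = B + conj_transpose C"
    define P where "P = B ** conj_transpose B"
    define N where "N = opnorm B"
    have N: "0 \<le> N" "N \<le> K"
      using K[OF hu] by (simp_all add: N_def B_def)
    have D: "opnorm D \<le> 2"
      unfolding D_def B_def C_def by (rule opnorm_fcalc_add_mate[OF h])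
    have BCB: "B ** C ** B = fcalc (\<lambda>z. h z * mate h z * h z)"
      unfolding B_def C_def by (simp add: fcalc_mult[OF h(1) m(1)] fcalc_mult[OF holomorphic_on_mult[OF h(1) m(1)] h(1)])
    have "(\<lambda>z. h z * mate h z * h z) \<in> unit_class"
      unfolding unit_class_def
    proof (intro CollectI conjI allI impI)
      show "(\<lambda>z. h z * mate h z * h z) holomorphic_on ball 0 R"
        by (intro holomorphic_intros h m)
      fix z :: complex assume "norm z \<le> 1"
      then show "norm (h z * mate h z * h z) \<le> 1"
        using h(2)[of z] m(2)[of z] by (simp add: norm_mult mult_le_one)
    qed
    then have nBCB: "opnorm (B ** C ** B) \<le> K"
      unfolding BCB by (rule K)
    have nP: "opnorm P = N\<^sup>2"
      using opnorm_conj_transpose_mult[of "conj_transpose B"] by (simp add: P_def N_def)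
    have Psym: "conj_transpose P = P"
      by (simp add: P_def conj_transpose_mult)
    have "opnorm (P ** P) = N ^ 4"
      using opnorm_conj_transpose_mult[of P] by (simp add: Psym nP)
    \<comment> \<open>The adjoint of \<open>D\<close> is the adjoint of \<open>B\<close> plus
      \<open>C\<close>, so expanding the right-hand side yields both terms. The first factor pair is
      controlled by \<open>opnorm D \<le> 2\<close>, the second by
      \<open>opnorm (B ** C ** B) \<le> K\<close>.\<close>
    moreover have "P ** P + B ** C ** B ** conj_transpose B = B ** conj_transpose D ** P"
      unfolding D_def P_def
      by (simp only: conj_transpose_add conj_transpose_conj_transpose matrix_add_ldistrib matrix_add_rdistrib matrix_mul_assoc)
    then have "P ** P = B ** conj_transpose D ** P + (- 1) *\<^sub>R (B ** C ** B ** conj_transpose B)"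
      by (simp add: algebra_simps)
    moreover have "opnorm ((- 1) *\<^sub>R M) = opnorm M" for M :: "complex^'n^'n"
    proof -
      have "(*v) ((- 1) *\<^sub>R M) = (\<lambda>x. - (M *v x))"
        by (rule ext) (simp add: vec_eq_iff matrix_vector_mult_def sum_negf)
      then show ?thesis
        unfolding opnorm_def by (simp only: onorm_neg)
    qed
    ultimately have "N ^ 4 \<le> opnorm (B ** conj_transpose D ** P) + opnorm (B ** C ** B ** conj_transpose B)"
      by (metis opnorm_add_le)
    also have "\<dots> \<le> N * 2 * N\<^sup>2 + K * N"
    proof (rule add_mono)
      have "opnorm (B ** conj_transpose D ** P) \<le> opnorm (B ** conj_transpose D) * opnorm P"
        by (rule opnorm_mult_le)
      also have "\<dots> \<le> (N * 2) * N\<^sup>2"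
      proof -
        have "opnorm (B ** conj_transpose D) \<le> N * opnorm D"
          using opnorm_mult_le[of B "conj_transpose D"] by (simp add: N_def)
        also have "\<dots> \<le> N * 2"
          by (rule mult_left_mono[OF D N(1)])
        finally show ?thesis
          unfolding nP by (rule mult_right_mono) simp
      qed
      finally show "opnorm (B ** conj_transpose D ** P) \<le> N * 2 * N\<^sup>2" .
      have "opnorm (B ** C ** B ** conj_transpose B) \<le> opnorm (B ** C ** B) * N"
        using opnorm_mult_le[of "B ** C ** B" "conj_transpose B"] by (simp add: N_def)
      also have "\<dots> \<le> K * N"
        by (rule mult_right_mono[OF nBCB N(1)])
      finally show "opnorm (B ** C ** B ** conj_transpose B) \<le> K * N" .
    qed
    finally have "N * N ^ 3 \<le> N * (2 * N\<^sup>2 + K)"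
      by (simp add: power4_eq_xxxx power3_eq_cube power2_eq_square algebra_simps)
    then have "N ^ 3 \<le> 2 * N\<^sup>2 + K"
      using N K0 by (cases "N = 0") auto
    also have "\<dots> \<le> 2 * K\<^sup>2 + K"
      using power_mono[OF N(2,1), of 2] by simp
    finally show ?thesis
      by (simp add: N_def B_def)
  qed
  \<comment> \<open>The cube root is taken for each function before passing to the supremum.\<close>
  have "K \<le> root 3 (2 * K\<^sup>2 + K)"
  proof -
    have "opnorm (fcalc h) \<le> root 3 (2 * K\<^sup>2 + K)" if "h \<in> unit_class" for h
    proof -
      have "opnorm (fcalc h) = root 3 (opnorm (fcalc h) ^ 3)"
        by (simp add: real_root_power_cancel)
      also have "\<dots> \<le> root 3 (2 * K\<^sup>2 + K)"
        using cube[OF that] by simp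
      finally show ?thesis .
    qed
    then have "(SUP h\<in>unit_class. opnorm (fcalc h)) \<le> root 3 (2 * K\<^sup>2 + K)"
      using assms by (intro cSUP_least) auto
    then show ?thesis
      by (simp only: K_def[symmetric])
  qed
  then have "K ^ 3 \<le> root 3 (2 * K\<^sup>2 + K) ^ 3"
    using K0 by (rule power_mono)
  then have "K ^ 3 \<le> 2 * K\<^sup>2 + K"
    using K0 by simp
  \<comment> \<open>Completing the square; after cancelling \<open>K\<close> this is the origin of 1
    + sqrt 2.\<close>
  then have "K * (K - 1)\<^sup>2 \<le> K * 2"
    by (simp add: power3_eq_cube power2_eq_square algebra_simps)
  then have "K \<le> 1 + sqrt 2"
  proof (cases "K = 0")
    case False
    then have "(K - 1)\<^sup>2 \<le> 2"
      using \<open>K * (K - 1)\<^sup>2 \<le> K * 2\<close> K0 by simp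
    then show ?thesis
      using real_le_rsqrt by fastforce
  qed simp
  then show ?thesis
    using K[OF assms] by simp
qed

lemma opnorm_fcalc:
  assumes h: "h holomorphic_on ball 0 R" and c: "0 < c" "\<And>z. norm z \<le> 1 \<Longrightarrow> norm (h z) \<le> c"
  shows "opnorm (fcalc h) \<le> (1 + sqrt 2) * c"
proof -
  have "(\<lambda>z. of_real (1 / c) * h z) \<in> unit_class"
    unfolding unit_class_def using c by (auto intro!: holomorphic_intros h simp: norm_mult norm_divide field_simps)
  then have *: "opnorm (fcalc (\<lambda>z. of_real (1 / c) * h z)) \<le> 1 + sqrt 2"
    by (rule opnorm_fcalc_unit_class)
  show ?thesis
  proof (rule opnorm_le)
    fix x
    have "fcalc h *v x = of_real c *s (fcalc (\<lambda>z. of_real (1 / c) * h z) *v x)"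
      unfolding vec_eq_iff matrix_vector_mult_def vec_lambda_beta vector_smult_component fcalc_cmult
      using c by (simp add: sum_distrib_left)
    then have "norm (fcalc h *v x) = c * norm (fcalc (\<lambda>z. of_real (1 / c) * h z) *v x)"
      using c by (simp add: norm_smult)
    also have "\<dots> \<le> c * (opnorm (fcalc (\<lambda>z. of_real (1 / c) * h z)) * norm x)"
      using c by (intro mult_left_mono norm_matrix_vector_le) auto
    also have "\<dots> \<le> c * ((1 + sqrt 2) * norm x)"
      using c * by (intro mult_left_mono mult_right_mono) auto
    finally show "norm (fcalc h *v x) \<le> (1 + sqrt 2) * c * norm x"
      by (simp add: mult_ac)
  qed
qed

text \<open>Whatever commutes with \<open>A\<close> commutes with its resolvents. Taking
  \<open>M\<close> to be the adjoint of \<open>A\<close>, and then the adjoint of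
  \<open>fcalc h\<close>, makes \<open>fcalc h\<close> normal when \<open>A\<close> is.\<close>

lemma fcalc_commute:
  assumes "A ** M = M ** A" "h holomorphic_on ball 0 R"
  shows "fcalc h ** M = M ** fcalc h"
proof -
  have res: "resolvent A z ** M = M ** resolvent A z" if z: "z \<notin> matrix_spectrum A" for z
  proof -
    have mz: "mat z ** M = M ** mat z"
      by (simp add: vec_eq_iff matrix_matrix_mult_def mat_def if_distrib if_distribR mult.commute cong: if_cong)
    have "(mat z - A) ** (M ** resolvent A z) = M ** ((mat z - A) ** resolvent A z)"
      by (simp only: matrix_mul_assoc matrix_diff_ldistrib matrix_diff_rdistrib mz assms(1))
    also have "\<dots> = M"
      by (simp add: resolvent_right[OF z])
    finally show ?thesis
      using resolvent_eqI[OF z] by metis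
  qed
  have "(fcalc h ** M) $ r $ s = (M ** fcalc h) $ r $ s" for r s
  proof -
    note ch = continuous_on_sphere[OF assms(2)]
    have "(fcalc h ** M) $ r $ s = circle_mean (\<lambda>z. \<Sum>k\<in>UNIV. h z * kern z r k * M $ k $ s)"
      by (subst circle_mean_sum)
         (auto intro!: continuous_intros ch continuous_on_kern simp: matrix_matrix_mult_def fcalc_nth circle_mean_cmult_right)
    also have "\<dots> = circle_mean (\<lambda>z. \<Sum>k\<in>UNIV. M $ r $ k * (h z * kern z k s))"
    proof (rule circle_mean_cong)
      fix z :: complex assume "norm z = 1"
      then have "(resolvent A (F z) ** M) $ r $ s = (M ** resolvent A (F z)) $ r $ s"
        by (simp only: res[OF sphere_notin_spectrum])
      then have "h z * (z * deriv F z) * (\<Sum>k\<in>UNIV. resolvent A (F z) $ r $ k * M $ k $ s) =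
          h z * (z * deriv F z) * (\<Sum>k\<in>UNIV. M $ r $ k * resolvent A (F z) $ k $ s)"
        by (simp add: matrix_matrix_mult_def)
      then show "(\<Sum>k\<in>UNIV. h z * kern z r k * M $ k $ s) = (\<Sum>k\<in>UNIV. M $ r $ k * (h z * kern z k s))"
        by (simp add: kern_def sum_distrib_left mult_ac)
    qed
    also have "\<dots> = (M ** fcalc h) $ r $ s"
      by (subst circle_mean_sum)
         (auto intro!: continuous_intros ch continuous_on_kern simp: matrix_matrix_mult_def fcalc_nth circle_mean_cmult)
    finally show ?thesis .
  qed
  then show ?thesis
    by (simp add: vec_eq_iff)
qed

text \<open>For normal \<open>A\<close> the constant is removed by applying the general bound to \<open>h ^ (2 ^ k)\<close>.\<close>

lemma opnorm_fcalc_normal: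
  assumes normal: "normal_matrix A"
    and h: "h holomorphic_on ball 0 R" and c: "0 < c" "\<And>z. norm z \<le> 1 \<Longrightarrow> norm (h z) \<le> c"
  shows "opnorm (fcalc h) \<le> c"
proof -
  have norm_fcalc: "fcalc h ** conj_transpose (fcalc h) = conj_transpose (fcalc h) ** fcalc h"
    if h: "h holomorphic_on ball 0 R" for h
  proof -
    have "fcalc h ** conj_transpose A = conj_transpose A ** fcalc h"
      using normal by (intro fcalc_commute h) (simp add: normal_matrix_def)
    then have "conj_transpose (fcalc h ** conj_transpose A) = conj_transpose (conj_transpose A ** fcalc h)"
      by simp
    then have "A ** conj_transpose (fcalc h) = conj_transpose (fcalc h) ** A"
      by (simp add: conj_transpose_mult)
    then show ?thesis
      by (rule fcalc_commute[OF _ h])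
  qed
  have pow: "opnorm (fcalc (\<lambda>z. h z ^ (2 ^ k))) = opnorm (fcalc h) ^ (2 ^ k)" for k
  proof (induction k)
    case (Suc k)
    have hk: "(\<lambda>z. h z ^ (2 ^ k)) holomorphic_on ball 0 R"
      by (intro holomorphic_intros h)
    have "fcalc (\<lambda>z. h z ^ (2 ^ Suc k)) = fcalc (\<lambda>z. h z ^ (2 ^ k)) ** fcalc (\<lambda>z. h z ^ (2 ^ k))"
      unfolding fcalc_mult[OF hk hk, symmetric] by (simp add: power_add[symmetric] mult_2)
    then show ?case
      using Suc opnorm_normal_square[OF norm_fcalc[OF hk]] by (simp add: power_mult[symmetric] mult.commute)
  qed simp
  have bound: "opnorm (fcalc h) ^ (2 ^ k) \<le> (1 + sqrt 2) * c ^ (2 ^ k)" for k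
    unfolding pow[symmetric]
  proof (rule opnorm_fcalc)
    fix z :: complex assume "norm z \<le> 1"
    then show "norm (h z ^ 2 ^ k) \<le> c ^ 2 ^ k"
      using c(2) by (simp add: norm_power power_mono)
  qed (use c in \<open>auto intro!: holomorphic_intros h\<close>)
  show ?thesis
  proof (rule ccontr)
    assume "\<not> opnorm (fcalc h) \<le> c"
    then have q: "1 < opnorm (fcalc h) / c"
      using c(1) by simp
    then obtain n where n: "1 + sqrt 2 < (opnorm (fcalc h) / c) ^ n"
      using real_arch_pow by blast
    also have "\<dots> \<le> (opnorm (fcalc h) / c) ^ (2 ^ n)"
      using q by (intro power_increasing) (auto simp: less_imp_le)
    also have "\<dots> \<le> 1 + sqrt 2"
      using bound[of n] c(1) by (simp add: power_divide field_simps)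
    finally show False by simp
  qed
qed

end

section \<open>Toeplitz--Hausdorff and Study\<close>

lemma cip_combination:
  "cip (p *s x + q *s y) (N *v (p *s x + q *s y)) = cnj p * p * cip x (N *v x) + cnj p * q * cip x (N *v y)
    + cnj q * p * cip y (N *v x) + cnj q * q * cip y (N *v y)"
  by (simp add: matrix_vector_right_distrib mult_smult_vector cip_add_left cip_add_right
      cip_smult_left cip_smult_right algebra_simps)

text \<open>Toeplitz--Hausdorff.  Two unit vectors with distinct values \<open>a\<close>, \<open>b\<close> are joined by a segment; after
  rotating one of them, the value along the normalised segment stays on the line through \<open>a\<close> and \<open>b\<close>.\<close>

lemma convex_numerical_range: "convex (numerical_range A)"
proof (rule convexI)
  fix a b :: complex and u v :: real
  assume a: "a \<in> numerical_range A" and b: "b \<in> numerical_range A" and uv: "0 \<le> u" "0 \<le> v" "u + v = 1"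
  show "u *\<^sub>R a + v *\<^sub>R b \<in> numerical_range A"
  proof (cases "a = b")
    case True
    then show ?thesis
      using a uv by (simp add: scaleR_left_distrib[symmetric])
  next
    case False
    define d where "d = b - a"
    \<comment> \<open>The shift moves \<open>a\<close> to 0, so the values wanted are the real
      multiples of \<open>d\<close>.\<close>
    define N where "N = A - mat a"
    have d: "d \<noteq> 0"
      using False by (simp add: d_def)
    obtain x0 where x0: "norm x0 = 1" "cip x0 (A *v x0) = a"
      using a by (auto simp: numerical_range_eq)
    obtain y where y: "norm y = 1" "cip y (A *v y) = b"
      using b by (auto simp: numerical_range_eq)
    have N: "cip p (N *v q) = cip p (A *v q) - a * cip p q" for p q
      by (simp add: N_def matrix_vector_mult_diff_rdistrib mat_vector_mult cip_diff_right cip_smult_right)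
    define P where "P = cip x0 (N *v y) / d"
    define Q where "Q = cip y (N *v x0) / d"
    define e where "e = Q - cnj P"
    \<comment> \<open>A unimodular factor that makes \<open>c * e\<close> real. The cross terms
      divided by \<open>d\<close> have the same imaginary part as \<open>c * e\<close>, hence
      \<open>\<sigma>\<close> is real.\<close>
    define c where "c = (if e = 0 then 1 else cnj (sgn e))"
    have c: "norm c = 1" "Im (c * e) = 0"
    proof -
      show "norm c = 1"
        by (simp add: c_def norm_sgn)
      have "cnj e * e = of_real ((norm e)\<^sup>2)"
        using complex_norm_square[of e] by (simp only: mult.commute)
      then have "c * e = of_real (norm e)" if "e \<noteq> 0"
        using that by (simp add: c_def sgn_eq power2_eq_square)
      then show "Im (c * e) = 0"
        by (cases "e = 0") simp_all
    qed
    define x where "x = c *s x0"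
    have x: "norm x = 1" "cip x (N *v x) = 0"
      using c(1) x0 by (simp_all add: x_def norm_smult mult_smult_vector cip_smult_left cip_smult_right N cip_self)
    have Ny: "cip y (N *v y) = d"
      using y by (simp add: N cip_self d_def)
    define \<sigma> where "\<sigma> = (cip x (N *v y) + cip y (N *v x)) / d"
    have "Im \<sigma> = 0"
    proof -
      have "\<sigma> = cnj c * P + c * Q"
        by (simp add: \<sigma>_def x_def P_def Q_def mult_smult_vector cip_smult_left cip_smult_right add_divide_distrib)
      moreover have "c * e = c * Q - cnj (cnj c * P)"
        by (simp add: e_def right_diff_distrib)
      ultimately have "Im \<sigma> = Im (c * e)"
        by (simp only: minus_complex.sel plus_complex.sel cnj.sel)
      then show ?thesis
        using c(2) by simp
    qed
    then have \<sigma>: "\<sigma> = of_real (Re \<sigma>)"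
      by (simp add: complex_eq_iff)
    define z where "z = (\<lambda>s::real. of_real (1 - s) *s x + of_real s *s y)"
    have zN: "cip (z s) (N *v z s) = d * of_real (s\<^sup>2 + s * (1 - s) * Re \<sigma>)" for s
    proof -
      have "cip (z s) (N *v z s) = of_real (s * (1 - s)) * (cip x (N *v y) + cip y (N *v x)) + of_real (s * s) * d"
        unfolding z_def cip_combination x(2) Ny by (simp add: distrib_left mult_ac)
      also have "cip x (N *v y) + cip y (N *v x) = d * of_real (Re \<sigma>)"
        using d unfolding \<sigma>[symmetric] by (simp add: \<sigma>_def)
      finally show ?thesis
        by (simp add: power2_eq_square distrib_left mult_ac)
    qed
    \<comment> \<open>If the segment from \<open>x\<close> to \<open>y\<close> met 0, then
      \<open>y = - x\<close>, and both vectors would give the same value, contrary to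
      \<open>d \<noteq> 0\<close>.\<close>
    have z0: "z s \<noteq> 0" if "s \<in> {0..1}" for s
    proof
      assume "z s = 0"
      then have eq: "of_real (1 - s) *s x = - (of_real s *s y)"
        by (simp add: z_def eq_neg_iff_add_eq_0)
      then have "norm (of_real (1 - s) *s x) = norm (of_real s *s y)"
        by simp
      then have "\<bar>1 - s\<bar> = \<bar>s\<bar>"
        by (simp only: norm_smult norm_of_real x(1) y(1) mult_1_right)
      then have "s = 1 / 2"
        using that by simp
      have "y $ i = (- 1) * x $ i" for i
      proof -
        have "of_real (1 - s) * x $ i = - (of_real s * y $ i)"
          using arg_cong[OF eq, of "\<lambda>v. v $ i"] by (simp only: vector_smult_component vector_uminus_component)
        then show ?thesis
          unfolding \<open>s = 1 / 2\<close> by simp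
      qed
      then have "y = (- 1) *s x"
        by (simp add: vec_eq_iff)
      then have "cip y (N *v y) = cip x (N *v x)"
        by (simp only: mult_smult_vector cip_smult_left cip_smult_right) simp
      then show False
        using x(2) Ny d by simp
    qed
    \<comment> \<open>The position, on the line from \<open>a\<close> at 0 to \<open>b\<close> at 1,
      of the value at the normalised \<open>z s\<close>. Continuity gives every intermediate
      position.\<close>
    define \<phi> where "\<phi> = (\<lambda>s. (s\<^sup>2 + s * (1 - s) * Re \<sigma>) / (norm (z s))\<^sup>2)"
    have "continuous_on {0..1} z"
    proof -
      have "z = (\<lambda>s. \<chi> i. of_real (1 - s) * x $ i + of_real s * y $ i)"
        by (intro ext) (simp only: z_def vec_eq_iff vec_lambda_beta vector_add_component vector_smult_component simp_thms)
      then show ?thesis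
        by (simp only:) (intro continuous_on_vec_lambda continuous_intros)
    qed
    then have "continuous_on {0..1} \<phi>"
      unfolding \<phi>_def using z0 by (intro continuous_intros) auto
    moreover have "\<phi> 0 = 0" "\<phi> 1 = 1"
      using y(1) by (simp_all add: \<phi>_def z_def)
    ultimately obtain s where s: "0 \<le> s" "s \<le> 1" "\<phi> s = v"
      using IVT'[of \<phi> 0 v 1] uv by auto
    have zs: "z s \<noteq> 0"
      using z0 s by simp
    obtain w where w: "w \<in> numerical_range A" "cip (z s) (A *v z s) = w * of_real ((norm (z s))\<^sup>2)"
      using cip_in_numerical_range[OF zs] .
    have "(w - a) * of_real ((norm (z s))\<^sup>2) = cip (z s) (N *v z s)"
      by (simp only: N w(2) cip_self left_diff_distrib)
    also have "\<dots> = d * of_real (\<phi> s * (norm (z s))\<^sup>2)"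
      using zs by (simp only: zN \<phi>_def) simp
    also have "\<dots> = (d * of_real v) * of_real ((norm (z s))\<^sup>2)"
      by (simp add: s(3))
    finally have "w - a = d * of_real v"
      using zs by simp
    then have "w = a + d * of_real v"
      by (simp add: diff_eq_eq add.commute)
    moreover have u: "u = 1 - v"
      using uv(3) by simp
    ultimately have "w = u *\<^sub>R a + v *\<^sub>R b"
      unfolding u d_def scaleR_conv_of_real of_real_diff of_real_1 by (simp only: algebra_simps mult_1_left)
    then show ?thesis
      using w(1) by simp
  qed
qed

text \<open>Study's theorem, by Schwarz's lemma for \<open>\<xi> \<mapsto> k ((1 - t) g (c \<xi>) + t g \<xi>)\<close> with \<open>c = p / q\<close>.\<close>

lemma Study_convex:
  assumes g: "g holomorphic_on ball 0 1" and k: "k holomorphic_on U" and U: "convex U"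
    and gU: "\<And>z. z \<in> ball 0 1 \<Longrightarrow> g z \<in> U \<and> k (g z) = z"
    and kU: "\<And>z. z \<in> U \<Longrightarrow> k z \<in> ball 0 1"
    and pq: "norm p \<le> norm q" "norm q < 1" and t: "0 \<le> t" "t \<le> 1"
  shows "norm (k (of_real (1 - t) * g p + of_real t * g q)) \<le> norm q"
proof (cases "q = 0")
  case True
  then have "p = 0"
    using pq by simp
  with True gU[of 0] show ?thesis
    by (simp add: distrib_right[symmetric])
next
  case False
  define c where "c = p / q"
  have c: "norm c \<le> 1" "c * q = p"
    using False pq by (simp_all add: c_def norm_divide)
  have cb: "c * \<xi> \<in> ball 0 1" if "\<xi> \<in> ball 0 1" for \<xi>
    using that mult_right_mono[OF c(1), of "norm \<xi>"] by (simp add: norm_mult)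
  define \<psi> where "\<psi> = (\<lambda>\<xi>. k (of_real (1 - t) * g (c * \<xi>) + of_real t * g \<xi>))"
  have in_U: "of_real (1 - t) * g (c * \<xi>) + of_real t * g \<xi> \<in> U" if "\<xi> \<in> ball 0 1" for \<xi>
    using convexD[OF U, of "g (c * \<xi>)" "g \<xi>" "1 - t" t] gU cb[OF that] that t
    by (simp add: scaleR_conv_of_real)
  have gc: "(\<lambda>\<xi>. g (c * \<xi>)) holomorphic_on ball 0 1"
  proof (rule holomorphic_on_compose_gen[of "\<lambda>\<xi>. c * \<xi>" _ g "ball 0 1", unfolded o_def])
    show "(\<lambda>\<xi>. c * \<xi>) holomorphic_on ball 0 1"
      by (intro holomorphic_intros)
    show "(\<lambda>\<xi>. c * \<xi>) ` ball 0 1 \<subseteq> ball 0 1"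
      using cb by blast
  qed (rule g)
  have hol: "\<psi> holomorphic_on ball 0 1"
    unfolding \<psi>_def
  proof (rule holomorphic_on_compose_gen[of _ _ k U, unfolded o_def])
    show "(\<lambda>\<xi>. of_real (1 - t) * g (c * \<xi>) + of_real t * g \<xi>) holomorphic_on ball 0 1"
      by (intro holomorphic_intros gc g)
    show "(\<lambda>\<xi>. of_real (1 - t) * g (c * \<xi>) + of_real t * g \<xi>) ` ball 0 1 \<subseteq> U"
      using in_U by blast
  qed (rule k)
  have "\<psi> 0 = 0"
    using gU[of 0] by (simp add: \<psi>_def distrib_right[symmetric] flip: of_real_add)
  moreover have "norm (\<psi> \<xi>) < 1" if "norm \<xi> < 1" for \<xi>
    using kU[OF in_U[of \<xi>]] that by (simp add: \<psi>_def)
  ultimately have "norm (\<psi> q) \<le> norm q"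
    using Schwarz_Lemma(1)[OF hol] pq(2) by blast
  then show ?thesis
    by (simp add: \<psi>_def c(2))
qed

text \<open>Infinitesimal form of Study's theorem: from \<open>g p\<close> towards
  \<open>g q\<close> the modulus of \<open>k\<close> cannot exceed \<open>norm p\<close>. A positive
  real part would be a positive initial slope of \<open>m\<close>, which starts at its largest
  possible value, the square of \<open>norm p\<close>.\<close>

lemma Study_support:
  assumes g: "g holomorphic_on ball 0 1" and k: "k holomorphic_on U" and U: "open U" "convex U"
    and gU: "\<And>z. z \<in> ball 0 1 \<Longrightarrow> g z \<in> U \<and> k (g z) = z"
    and kU: "\<And>z. z \<in> U \<Longrightarrow> k z \<in> ball 0 1"
    and pq: "norm q \<le> norm p" "norm p < 1"
  shows "Re (cnj p * ((g q - g p) / deriv g p)) \<le> 0"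
proof (rule ccontr)
  assume "\<not> ?thesis"
  then have pos: "0 < Re (cnj p * ((g q - g p) / deriv g p))"
    by simp
  have p: "p \<in> ball 0 1"
    using pq by simp
  have gp: "g p \<in> U"
    using gU p by blast
  define m where "m = (\<lambda>t. Re (cnj p * k (of_real (1 - t) * g p + of_real t * g q)))"
  have g': "(g has_field_derivative deriv g p) (at p)"
    by (rule holomorphic_derivI[OF g open_ball p])
  have k': "(k has_field_derivative deriv k (g p)) (at (g p))"
    by (rule holomorphic_derivI[OF k U(1) gp])
  have inv: "deriv k (g p) * deriv g p = 1"
  proof (rule DERIV_unique)
    show "((\<lambda>z. k (g z)) has_field_derivative deriv k (g p) * deriv g p) (at p)"
      by (rule DERIV_chain2[OF k' g'])
    show "((\<lambda>z. k (g z)) has_field_derivative 1) (at p)"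
      by (rule has_field_derivative_transform_within_open[OF DERIV_ident open_ball p]) (use gU in auto)
  qed
  have "((\<lambda>t. of_real (1 - t) * g p + of_real t * g q) has_vector_derivative (g q - g p)) (at 0)"
    by (auto intro!: derivative_eq_intros simp: has_vector_derivative_def scaleR_conv_of_real algebra_simps)
  moreover have "(k has_field_derivative deriv k (g p)) (at (of_real (1 - 0) * g p + of_real 0 * g q))"
    using k' by simp
  ultimately have "((k \<circ> (\<lambda>t. of_real (1 - t) * g p + of_real t * g q)) has_vector_derivative (g q - g p) * deriv k (g p)) (at 0)"
    by (rule field_vector_diff_chain_at)
  then have "((\<lambda>t. cnj p * k (of_real (1 - t) * g p + of_real t * g q)) has_vector_derivative cnj p * ((g q - g p) * deriv k (g p))) (at 0)"
    by (auto intro!: derivative_eq_intros simp: o_def)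
  then have "(m has_vector_derivative Re (cnj p * ((g q - g p) * deriv k (g p)))) (at 0)"
    unfolding m_def by (rule bounded_linear.has_vector_derivative[OF bounded_linear_Re])
  then have "(m has_real_derivative Re (cnj p * ((g q - g p) * deriv k (g p)))) (at 0)"
    by (simp add: has_real_derivative_iff_has_vector_derivative)
  moreover have "(g q - g p) * deriv k (g p) = (g q - g p) / deriv g p"
  proof -
    have "deriv g p \<noteq> 0"
      using inv by auto
    then have "deriv k (g p) = 1 / deriv g p"
      using inv by (simp add: nonzero_eq_divide_eq)
    then show ?thesis
      by simp
  qed
  ultimately obtain \<delta> where \<delta>: "0 < \<delta>" "\<And>h. 0 < h \<Longrightarrow> h < \<delta> \<Longrightarrow> m 0 < m (0 + h)"
    using DERIV_pos_inc_right[of m _ 0] pos by auto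
  define h where "h = min (\<delta> / 2) 1"
  have h: "0 < h" "h < \<delta>" "h \<le> 1"
    using \<delta>(1) by (auto simp: h_def)
  \<comment> \<open>The two points are exchanged and the parameter is \<open>1 - h\<close>, because
    \<open>Study_convex\<close> bounds by the larger modulus.\<close>
  have "norm (k (of_real (1 - (1 - h)) * g q + of_real (1 - h) * g p)) \<le> norm p"
    by (rule Study_convex[OF g k U(2) gU kU pq]) (use h in auto)
  then have "norm (k (of_real (1 - h) * g p + of_real h * g q)) \<le> norm p"
    by (simp add: add.commute)
  then have "norm (cnj p * k (of_real (1 - h) * g p + of_real h * g q)) \<le> norm p * norm p"
    unfolding norm_mult by (intro mult_mono) auto
  then have "m h \<le> norm p * norm p"
    unfolding m_def using complex_Re_le_cmod order.trans by blast
  moreover have "m 0 = norm p * norm p"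
    using gU[OF p] complex_norm_square[of p] by (simp add: m_def cmod_power2 power2_eq_square[symmetric])
  ultimately show False
    using \<delta>(2)[of h] h by simp
qed

text \<open>By compactness the preimage of the numerical range has a largest modulus
  \<open>norm s < 1\<close>. With \<open>norm s < r0 < r < 1\<close>, dilation by \<open>r\<close>
  leaves the margin \<open>R = 1 / r\<close>, while \<open>\<rho> = r0 / r\<close> still encloses
  the numerical range.\<close>

lemma convex_disc_map_exists:
  assumes U: "open U" "convex U" "U \<noteq> UNIV" and A: "numerical_range A \<subseteq> U"
  obtains F R \<rho> where "convex_disc_calculus F R A \<rho>" "F ` ball 0 R = U"
proof -
  have "simply_connected U" "U \<noteq> {}"
    using U(2) convex_imp_simply_connected A numerical_range_nonempty by auto
  then obtain k g where k: "k holomorphic_on U" and g: "g holomorphic_on ball 0 1"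
    and kU: "\<And>z. z \<in> U \<Longrightarrow> k z \<in> ball 0 1 \<and> g (k z) = z"
    and gU: "\<And>z. z \<in> ball 0 1 \<Longrightarrow> g z \<in> U \<and> k (g z) = z"
    using Riemann_mapping_theorem[of U] U by blast
  have 1: "compact (k ` numerical_range A)"
    using A k by (intro compact_continuous_image compact_numerical_range)
      (auto intro: continuous_on_subset holomorphic_on_imp_continuous_on)
  have 2: "k ` numerical_range A \<noteq> {}"
    by (simp add: numerical_range_nonempty)
  have 3: "continuous_on (k ` numerical_range A) norm"
    by (intro continuous_intros)
  from continuous_attains_sup[OF 1 2 3] obtain s
    where s: "s \<in> k ` numerical_range A" "\<And>w. w \<in> k ` numerical_range A \<Longrightarrow> norm w \<le> norm s"
    by auto
  have s1: "norm s < 1"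
    using s(1) kU A by auto
  define r0 where "r0 = (1 + norm s) / 2"
  define r where "r = (1 + r0) / 2"
  have r: "norm s < r0" "r0 < r" "0 < r0" "r < 1" "0 < r"
    using s1 norm_ge_zero[of s] by (simp_all add: r0_def r_def add_pos_nonneg)
  let ?F = "\<lambda>z. g (of_real r * z)"
  have scale: "of_real r * z \<in> ball 0 1" if "z \<in> ball 0 (1 / r)" for z :: complex
    using that r by (simp add: norm_mult field_simps)
  have image: "?F ` ball 0 \<rho> = g ` ball 0 (r * \<rho>)" for \<rho>
  proof -
    have "(\<lambda>z::complex. of_real r * z) ` ball 0 \<rho> = ball 0 (r * \<rho>)"
    proof
      show "ball 0 (r * \<rho>) \<subseteq> (\<lambda>z::complex. of_real r * z) ` ball 0 \<rho>"
      proof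
        fix x :: complex assume "x \<in> ball 0 (r * \<rho>)"
        then have "x = of_real r * (x / of_real r)" "x / of_real r \<in> ball 0 \<rho>"
          using r by (auto simp: norm_divide field_simps)
        then show "x \<in> (\<lambda>z. of_real r * z) ` ball 0 \<rho>" by blast
      qed
    qed (use r in \<open>auto simp: norm_mult\<close>)
    then show ?thesis
      by (metis image_image)
  qed
  have "convex_disc_calculus ?F (1 / r) A (r0 / r)"
  proof
    show "1 < 1 / r" "0 < r0 / r" "r0 / r < 1"
      using r by simp_all
    show "?F holomorphic_on ball 0 (1 / r)"
    proof (rule holomorphic_on_compose_gen[of "\<lambda>z. of_real r * z" _ g "ball 0 1", unfolded o_def])
      show "(\<lambda>z. of_real r * z) holomorphic_on ball 0 (1 / r)"
        by (intro holomorphic_intros)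
      show "(\<lambda>z::complex. of_real r * z) ` ball 0 (1 / r) \<subseteq> ball 0 1"
        using scale by blast
    qed (rule g)
    show "inj_on ?F (ball 0 (1 / r))"
    proof (rule inj_onI)
      fix x y assume xy: "x \<in> ball 0 (1 / r)" "y \<in> ball 0 (1 / r)" "?F x = ?F y"
      then have "k (?F x) = k (?F y)"
        by simp
      then have "of_real r * x = of_real r * y"
        using gU[OF scale[OF xy(1)]] gU[OF scale[OF xy(2)]] by simp
      then show "x = y"
        using r by simp
    qed
    have "numerical_range A \<subseteq> g ` ball 0 r0"
    proof
      fix w assume w: "w \<in> numerical_range A"
      then have "norm (k w) < r0"
        using s(2)[of "k w"] r(1) by simp
      moreover have "w = g (k w)"
        using kU A w by auto
      ultimately show "w \<in> g ` ball 0 r0"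
        by auto
    qed
    then show W: "numerical_range A \<subseteq> ?F ` ball 0 (r0 / r)"
      unfolding image using r by simp
    have "ball (0::complex) (r0 / r) \<subseteq> ball 0 1"
      using r by (intro subset_ball) simp
    then show "numerical_range A \<subseteq> ?F ` ball 0 1"
      using W by blast
    fix z w :: complex assume z: "norm z = 1" and w: "norm w \<le> 1"
    have zb: "z \<in> ball 0 (1 / r)"
      using z r by simp
    have dF: "deriv ?F z = of_real r * deriv g (of_real r * z)"
    proof (rule DERIV_imp_deriv)
      have "(g has_field_derivative deriv g (of_real r * z)) (at (of_real r * z))"
        by (rule holomorphic_derivI[OF g open_ball scale[OF zb]])
      moreover have "((\<lambda>z. of_real r * z) has_field_derivative of_real r) (at z)"
        by (auto intro!: derivative_eq_intros)
      ultimately have "(?F has_field_derivative deriv g (of_real r * z) * of_real r) (at z)"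
        by (rule DERIV_chain2)
      then show "(?F has_field_derivative of_real r * deriv g (of_real r * z)) (at z)"
        by (simp only: mult.commute)
    qed
    have "Re (cnj (of_real r * z) * ((g (of_real r * w) - g (of_real r * z)) / deriv g (of_real r * z))) \<le> 0"
      using kU gU z w r by (intro Study_support[OF g k U(1,2)]) (auto simp: norm_mult)
    \<comment> \<open>On the circle \<open>cnj z = 1 / z\<close>. The factor \<open>r ^ 2\<close>
      collects one \<open>r\<close> from the dilated point and one from the chain rule; the sign
      comes from the reversed difference.\<close>
    moreover have "cnj (of_real r * z) * ((g (of_real r * w) - g (of_real r * z)) / deriv g (of_real r * z)) =
        of_real (- (r\<^sup>2)) * ((?F z - ?F w) / (z * deriv ?F z))"
    proof -
      have "cnj z * z = 1"
        using complex_norm_square[of z] z by (simp add: mult.commute)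
      moreover from this have z0: "z \<noteq> 0" by auto
      ultimately have cz: "cnj z = 1 / z"
        by (simp add: field_simps)
      have "cnj (of_real r * z) = of_real r / z"
        by (simp add: cz)
      then have "cnj (of_real r * z) * ((g (of_real r * w) - g (of_real r * z)) / deriv g (of_real r * z)) =
          of_real r / z * (- (?F z - ?F w) / deriv g (of_real r * z))"
        by (simp only: minus_diff_eq)
      also have "\<dots> = of_real (- (r\<^sup>2)) * ((?F z - ?F w) / (z * deriv ?F z))"
      proof -
        have "of_real r / z * (- X / D) = of_real (- (r\<^sup>2)) * (X / (z * (of_real r * D)))" for X D
          using r(5) by (simp add: power2_eq_square)
        then show ?thesis
          unfolding dF .
      qed
      finally show ?thesis .
    qed
    ultimately have "Re (of_real (- (r\<^sup>2)) * ((?F z - ?F w) / (z * deriv ?F z))) \<le> 0"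
      by (simp only:)
    moreover have "Re (of_real a * x) = a * Re x" for a x
      by simp
    ultimately have "- (r\<^sup>2) * Re ((?F z - ?F w) / (z * deriv ?F z)) \<le> 0"
      by (simp only:)
    then show "0 \<le> Re ((?F z - ?F w) / (z * deriv ?F z))"
      using r(5) by (simp add: zero_le_mult_iff)
  qed
  moreover have "?F ` ball 0 (1 / r) = U"
    unfolding image using r gU kU by (force simp: image_iff)
  ultimately show thesis
    by (rule that)
qed

section \<open>Matrix functions and their Frechet derivative\<close>

text \<open>By the residue theorem the Cauchy integral depends neither on the region nor on the contour.\<close>

lemma has_matrix_fun_residues:
  assumes "has_matrix_fun f A B"
  shows "B = (\<chi> r s. \<Sum>p\<in>matrix_spectrum A. residue (\<lambda>z. f z * resolvent A z $ r $ s) p)"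
proof -
  obtain \<Omega> \<gamma> where \<Omega>: "open \<Omega>" "connected \<Omega>" "f holomorphic_on \<Omega>"
    and \<gamma>: "valid_path \<gamma>" "pathfinish \<gamma> = pathstart \<gamma>" "path_image \<gamma> \<subseteq> \<Omega> - matrix_spectrum A"
    and w1: "\<forall>z\<in>matrix_spectrum A. winding_number \<gamma> z = 1"
    and w0: "\<forall>z. z \<notin> \<Omega> \<longrightarrow> winding_number \<gamma> z = 0"
    and B: "B = (\<chi> r s. 1 / (2 * of_real pi * \<i>) * contour_integral \<gamma> (\<lambda>z. f z * matrix_inv (mat z - A) $ r $ s))"
    using assms unfolding has_matrix_fun_def by blast
  have "contour_integral \<gamma> (\<lambda>z. f z * resolvent A z $ r $ s) =
      2 * pi * \<i> * (\<Sum>p\<in>matrix_spectrum A. residue (\<lambda>z. f z * resolvent A z $ r $ s) p)" for r s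
  proof -
    have hol: "(\<lambda>z. f z * resolvent A z $ r $ s) holomorphic_on \<Omega> - matrix_spectrum A"
      by (intro holomorphic_on_mult holomorphic_on_subset[OF \<Omega>(3)] holomorphic_on_subset[OF resolvent_holomorphic]) auto
    have "contour_integral \<gamma> (\<lambda>z. f z * resolvent A z $ r $ s) =
        2 * pi * \<i> * (\<Sum>p\<in>matrix_spectrum A. winding_number \<gamma> p * residue (\<lambda>z. f z * resolvent A z $ r $ s) p)"
      by (rule Residue_theorem[OF \<Omega>(1,2) finite_matrix_spectrum hol \<gamma> w0])
    then show ?thesis
      using w1 by simp
  qed
  then show ?thesis
    unfolding B resolvent_def by (simp add: vec_eq_iff)
qed

lemma matrix_fun_eqI:
  assumes "has_matrix_fun f A B"
  shows "matrix_fun f A = B"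
  unfolding matrix_fun_def
proof (rule the_equality, rule assms)
  fix B' assume "has_matrix_fun f A B'"
  from has_matrix_fun_residues[OF this] has_matrix_fun_residues[OF assms] show "B' = B"
    by simp
qed

lemma norm_complex_matrix: "norm (complex_matrix E) = norm (E :: real^'n^'m)"
  by (simp add: norm_vec_def map_matrix_def)

primrec matrix_pow :: "'a::semiring_1^'n^'n \<Rightarrow> nat \<Rightarrow> 'a^'n^'n" where
  "matrix_pow M 0 = mat 1"
| "matrix_pow M (Suc k) = M ** matrix_pow M k"

context disc_map
begin

lemma open_image: "open (F ` ball 0 R)" "open (F ` ball 0 1)"
proof -
  have "open (F ` V)" if "open V" "V \<subseteq> ball 0 R" for V
    using open_mapping_thm3[OF holomorphic_on_subset[OF holF that(2)] that(1)] inj_on_subset[OF injF that(2)] by blast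
  moreover have "ball 0 1 \<subseteq> ball (0::complex) R"
    using R by (intro subset_ball) simp
  ultimately show "open (F ` ball 0 R)" "open (F ` ball 0 1)"
    by blast+
qed

end

context disc_calculus
begin

text \<open>The image of \<open>ball 0 R\<close> and the curve \<open>contour\<close> are an
  admissible region and contour, by the two winding number computations.\<close>

lemma matrix_fun_eq_fcalc:
  assumes f: "f holomorphic_on F ` ball 0 R"
  shows "matrix_fun f A = fcalc (\<lambda>z. f (F z))"
proof (rule matrix_fun_eqI)
  show "has_matrix_fun f A (fcalc (\<lambda>z. f (F z)))"
    unfolding has_matrix_fun_def
  proof (intro exI conjI)
    show "open (F ` ball 0 R)"
      by (rule open_image)
    show "connected (F ` ball 0 R)"
      by (intro connected_continuous_image holomorphic_on_imp_continuous_on holF) simp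
    have sub: "ball 0 1 \<subseteq> ball (0::complex) R" "sphere 0 1 \<subseteq> ball (0::complex) R"
      using R by auto
    show "matrix_spectrum A \<subseteq> F ` ball 0 R"
      using spectrum_subset sub(1) by blast
    show "path_image contour \<subseteq> F ` ball 0 R - matrix_spectrum A"
      using sub(2) sphere_notin_spectrum by (auto simp: path_image_contour)
    show "\<forall>z\<in>matrix_spectrum A. winding_number contour z = 1"
      using spectrum_subset winding_number_contour_inside by blast
    show "\<forall>z. z \<notin> F ` ball 0 R \<longrightarrow> winding_number contour z = 0"
      using winding_number_contour_outside by blast
    show "fcalc (\<lambda>z. f (F z)) = (\<chi> r s. 1 / (2 * of_real pi * \<i>) *
        contour_integral contour (\<lambda>z. f z * matrix_inv (mat z - A) $ r $ s))"
      unfolding contour_integral_contour resolvent_def[symmetric]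
      by (simp add: vec_eq_iff fcalc_nth kern_def mult_ac)
  qed (fact f valid_path_contour loop_contour)+
qed

text \<open>Each point of the numerical range moves by at most the norm of the perturbation. One
  contour therefore serves all nearby matrices and stays at a distance of at least half of
  \<open>\<delta>\<close>, which bounds their resolvents uniformly.\<close>

lemma nearby_disc_calculus:
  obtains \<epsilon> where "0 < \<epsilon>"
    "\<forall>B. norm (B - A) < \<epsilon> \<longrightarrow> disc_calculus F R B \<and> (\<forall>z. norm z = 1 \<longrightarrow> opnorm (resolvent B (F z)) \<le> 1 / \<epsilon>)"
proof -
  obtain \<delta> where \<delta>: "0 < \<delta>" "(\<Union>x\<in>numerical_range A. ball x \<delta>) \<subseteq> F ` ball 0 1"
    using compact_subset_open_imp_ball_epsilon_subset[OF compact_numerical_range open_image(2) W] by blast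
  have near: "\<exists>w'\<in>numerical_range A. norm (w - w') < \<delta> / 2"
    if B: "norm (B - A) < \<delta> / 2" and w: "w \<in> numerical_range B" for B w
  proof -
    obtain x where x: "norm x = 1" "w = cip x (B *v x)"
      using w by (auto simp: numerical_range_eq)
    have "w - cip x (A *v x) = cip x ((B - A) *v x)"
      by (simp add: x(2) matrix_vector_mult_diff_rdistrib cip_diff_right)
    also have "norm \<dots> \<le> norm x * (opnorm (B - A) * norm x)"
      by (intro order.trans[OF norm_cip_le] mult_left_mono norm_matrix_vector_le) simp
    also have "\<dots> < \<delta> / 2"
      using opnorm_le_norm[of "B - A"] B by (simp add: x(1))
    finally show ?thesis
      using x(1) by (auto simp: numerical_range_eq)
  qed
  show thesis
  proof (rule that[of "\<delta> / 2"], goal_cases)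
    case 1
    show ?case
      using \<delta>(1) by simp
  next
    case 2
    show ?case
    proof (intro allI impI conjI)
      fix B :: "complex^'n^'n" assume B: "norm (B - A) < \<delta> / 2"
      have "w \<in> F ` ball 0 1" if w: "w \<in> numerical_range B" for w
      proof -
        obtain w' where "w' \<in> numerical_range A" "norm (w - w') < \<delta> / 2"
          using near[OF B w] by blast
        then have "w \<in> ball w' \<delta>"
          using \<delta>(1) by (simp add: dist_norm norm_minus_commute)
        then show ?thesis
          using \<delta>(2) \<open>w' \<in> numerical_range A\<close> by blast
      qed
      then show "disc_calculus F R B"
        by unfold_locales auto
      fix z :: complex assume z: "norm z = 1"
      have "\<delta> / 2 \<le> norm (F z - w)" if w: "w \<in> numerical_range B" for w
      proof -
        obtain w' where w': "w' \<in> numerical_range A" "norm (w - w') < \<delta> / 2"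
          using near[OF B w] by blast
        have "F z \<notin> ball w' \<delta>"
          using \<delta>(2) w'(1) image_ball_disjoint_sphere z by fastforce
        then have "\<delta> \<le> norm (F z - w')"
          by (simp add: dist_norm norm_minus_commute)
        also have "\<dots> \<le> norm (F z - w) + norm (w - w')"
          using norm_triangle_ineq[of "F z - w" "w - w'"] by simp
        finally show ?thesis
          using w'(2) by simp
      qed
      then show "opnorm (resolvent B (F z)) \<le> 1 / (\<delta> / 2)"
        using \<delta>(1) by (intro opnorm_resolvent_le) auto
    qed
  qed
qed

section \<open>Differentiation under the Cauchy integral\<close>

definition frechet_calc :: "(complex \<Rightarrow> complex) \<Rightarrow> complex^'n^'n \<Rightarrow> complex^'n^'n" where
  "frechet_calc h E = (\<chi> u v. circle_mean (\<lambda>z. h z * (z * deriv F z) * (resolvent A (F z) ** E ** resolvent A (F z)) $ u $ v))"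

lemma continuous_on_frechet_integrand:
  "continuous_on (sphere 0 1) (\<lambda>z. (resolvent A (F z) ** E ** resolvent A (F z)) $ u $ v)"
  unfolding matrix_matrix_mult_def by (simp, intro continuous_intros continuous_on_resolvent_F)

text \<open>Two uses of the resolvent identity write the remainder as a product of three resolvents
  alternating with two factors \<open>B - A\<close>, hence a quadratic bound with the uniform factor
  \<open>(1 / \<epsilon>) ^ 3\<close>.\<close>

lemma frechet_calc_remainder:
  assumes h: "h holomorphic_on ball 0 R"
  obtains C \<epsilon> where "0 \<le> C" "0 < \<epsilon>"
    "\<forall>B. norm (B - A) < \<epsilon> \<longrightarrow> disc_calculus F R B \<and>
      norm (disc_calculus.fcalc F B h - fcalc h - frechet_calc h (B - A)) \<le> C * (norm (B - A))\<^sup>2"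
proof -
  obtain \<epsilon> where \<epsilon>0: "0 < \<epsilon>"
    and near: "\<forall>B. norm (B - A) < \<epsilon> \<longrightarrow> disc_calculus F R B \<and> (\<forall>z. norm z = 1 \<longrightarrow> opnorm (resolvent B (F z)) \<le> 1 / \<epsilon>)"
    by (rule nearby_disc_calculus)
  have \<epsilon>: "0 < \<epsilon>"
    "\<And>B. norm (B - A) < \<epsilon> \<Longrightarrow> disc_calculus F R B"
    "\<And>B z. norm (B - A) < \<epsilon> \<Longrightarrow> norm z = 1 \<Longrightarrow> opnorm (resolvent B (F z)) \<le> 1 / \<epsilon>"
    using \<epsilon>0 near by blast+
  have "compact ((\<lambda>z. h z * (z * deriv F z)) ` sphere 0 1)"
    by (intro compact_continuous_image continuous_intros continuous_on_sphere[OF h] continuous_on_sphere[OF holdF]) simp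
  then have "bounded ((\<lambda>z. h z * (z * deriv F z)) ` sphere 0 1)"
    by (rule compact_imp_bounded)
  then obtain H where H: "0 < H" "\<forall>x\<in>(\<lambda>z. h z * (z * deriv F z)) ` sphere 0 1. norm x \<le> H"
    unfolding bounded_pos by blast
  define C where "C = (\<Sum>u\<in>(UNIV::'n set). \<Sum>v\<in>(UNIV::'n set). H * (1 / \<epsilon>) ^ 3)"
  show thesis
  proof (rule that[of C \<epsilon>], goal_cases)
    case 1
    show ?case
      unfolding C_def using H(1) \<epsilon>(1) by (intro sum_nonneg) simp
  next
    case 2
    show ?case
      by (rule \<epsilon>(1))
  next
    case 3
    show ?case
    proof (intro allI impI)
      fix B :: "complex^'n^'n" assume B: "norm (B - A) < \<epsilon>"
      interpret B: disc_calculus F R B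
        by (rule \<epsilon>(2)[OF B])
      have entry: "norm ((B.fcalc h - fcalc h - frechet_calc h (B - A)) $ u $ v) \<le> H * (1 / \<epsilon>) ^ 3 * (norm (B - A))\<^sup>2" for u v
      proof -
        let ?R = "\<lambda>z. resolvent A (F z)" and ?S = "\<lambda>z. resolvent B (F z)"
        let ?E = "B - A"
        let ?h = "\<lambda>z. h z * (z * deriv F z)"
        have ch: "continuous_on (sphere 0 1) ?h"
          by (intro continuous_intros continuous_on_sphere[OF h] continuous_on_sphere[OF holdF])
        note cont = continuous_on_mult[OF ch B.continuous_on_resolvent_F] continuous_on_mult[OF ch continuous_on_resolvent_F]
          continuous_on_mult[OF ch continuous_on_frechet_integrand]
        have diff: "(?S z - ?R z - ?R z ** ?E ** ?R z) $ u $ v = (?S z ** ?E ** ?R z ** ?E ** ?R z) $ u $ v"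
          if z: "norm z = 1" for z
        proof -
          have d: "?S z - ?R z = ?S z ** ?E ** ?R z"
            by (rule resolvent_diff[OF sphere_notin_spectrum[OF z] B.sphere_notin_spectrum[OF z]])
          have "?S z - ?R z - ?R z ** ?E ** ?R z = ?S z ** ?E ** ?R z - ?R z ** ?E ** ?R z"
            by (simp only: d)
          also have "\<dots> = (?S z - ?R z) ** ?E ** ?R z"
            by (simp only: matrix_diff_rdistrib)
          finally show ?thesis
            by (simp only: d)
        qed
        have "(B.fcalc h - fcalc h - frechet_calc h ?E) $ u $ v =
            circle_mean (\<lambda>z. ?h z * ?S z $ u $ v) - circle_mean (\<lambda>z. ?h z * ?R z $ u $ v) -
            circle_mean (\<lambda>z. ?h z * (?R z ** ?E ** ?R z) $ u $ v)"
          by (simp add: B.fcalc_nth fcalc_nth B.kern_def kern_def frechet_calc_def mult.assoc)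
        also have "\<dots> = circle_mean (\<lambda>z. ?h z * ?S z $ u $ v - ?h z * ?R z $ u $ v - ?h z * (?R z ** ?E ** ?R z) $ u $ v)"
          by (simp only: circle_mean_diff[OF continuous_on_diff[OF cont(1,2)] cont(3)] circle_mean_diff[OF cont(1,2)])
        also have "\<dots> = circle_mean (\<lambda>z. ?h z * (?S z - ?R z - ?R z ** ?E ** ?R z) $ u $ v)"
          by (simp only: vector_minus_component right_diff_distrib)
        also have "norm \<dots> \<le> H * (1 / \<epsilon>) ^ 3 * (norm ?E)\<^sup>2"
        proof (rule circle_mean_bound)
          show "continuous_on (sphere 0 1) (\<lambda>z. ?h z * (?S z - ?R z - ?R z ** ?E ** ?R z) $ u $ v)"
            unfolding vector_minus_component right_diff_distrib by (intro continuous_on_diff cont)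
          fix z :: complex assume z: "norm z = 1"
          have RS: "opnorm (?R z) \<le> 1 / \<epsilon>" "opnorm (?S z) \<le> 1 / \<epsilon>" "opnorm ?E \<le> norm ?E"
            using \<epsilon>(3)[OF _ z, of A] \<epsilon>(3)[OF B z] \<epsilon>(1) opnorm_le_norm[of ?E] by simp_all
          have m: "opnorm (M ** N) \<le> a * b" if "opnorm M \<le> a" "opnorm N \<le> b" for M N :: "complex^'n^'n" and a b
            using opnorm_mult_le[of M N] mult_mono[OF that] order.trans[OF opnorm_nonneg that(1)] by fastforce
          have "norm ((?S z ** ?E ** ?R z ** ?E ** ?R z) $ u $ v) \<le> opnorm (?S z ** ?E ** ?R z ** ?E ** ?R z)"
            by (rule norm_entry_le_opnorm)
          also have "\<dots> \<le> 1 / \<epsilon> * norm ?E * (1 / \<epsilon>) * norm ?E * (1 / \<epsilon>)"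
            by (intro m RS)
          finally have "norm ((?S z - ?R z - ?R z ** ?E ** ?R z) $ u $ v) \<le> (1 / \<epsilon>) ^ 3 * (norm ?E)\<^sup>2"
            by (simp only: diff[OF z]) (simp add: power3_eq_cube power2_eq_square)
          moreover have "norm (?h z) \<le> H"
            using H(2) z by simp
          ultimately have "norm (?h z) * norm ((?S z - ?R z - ?R z ** ?E ** ?R z) $ u $ v) \<le> H * ((1 / \<epsilon>) ^ 3 * (norm ?E)\<^sup>2)"
            using H(1) by (intro mult_mono) auto
          then show "norm (?h z * (?S z - ?R z - ?R z ** ?E ** ?R z) $ u $ v) \<le> H * (1 / \<epsilon>) ^ 3 * (norm ?E)\<^sup>2"
            by (simp only: norm_mult mult.assoc)
        qed
        finally show ?thesis .
      qed
      have "norm (B.fcalc h - fcalc h - frechet_calc h (B - A)) \<le>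
          (\<Sum>u\<in>UNIV. \<Sum>v\<in>UNIV. norm ((B.fcalc h - fcalc h - frechet_calc h (B - A)) $ u $ v))"
        by (rule norm_matrix_le_sum)
      also have "\<dots> \<le> (\<Sum>u\<in>(UNIV::'n set). \<Sum>v\<in>(UNIV::'n set). H * (1 / \<epsilon>) ^ 3 * (norm (B - A))\<^sup>2)"
        by (intro sum_mono entry)
      also have "\<dots> = C * (norm (B - A))\<^sup>2"
        by (simp add: C_def)
      finally show "disc_calculus F R B \<and> norm (B.fcalc h - fcalc h - frechet_calc h (B - A)) \<le> C * (norm (B - A))\<^sup>2"
        using B.disc_calculus_axioms by blast
    qed
  qed
qed

lemma frechet_calc_linear:
  assumes h: "h holomorphic_on ball 0 R"
  shows "linear (\<lambda>E :: real^'n^'n. frechet_calc h (complex_matrix E))"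
proof (rule linearI)
  fix D E :: "real^'n^'n" and c :: real
  have ch: "continuous_on (sphere 0 1) (\<lambda>z. h z * (z * deriv F z))"
    by (intro continuous_intros continuous_on_sphere[OF h] continuous_on_sphere[OF holdF])
  note cont = continuous_on_mult[OF ch continuous_on_frechet_integrand]
  have add: "complex_matrix (D + E) = complex_matrix D + complex_matrix E"
    by (simp add: vec_eq_iff map_matrix_def)
  show "frechet_calc h (complex_matrix (D + E)) = frechet_calc h (complex_matrix D) + frechet_calc h (complex_matrix E)"
    unfolding add frechet_calc_def
    by (simp only: matrix_add_ldistrib matrix_add_rdistrib vector_add_component distrib_left
        circle_mean_add[OF cont cont]) (simp add: vec_eq_iff)
  have *: "(M ** complex_matrix (c *\<^sub>R E) ** M) $ u $ v = of_real c * (M ** complex_matrix E ** M) $ u $ v"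
    for M :: "complex^'n^'n" and u v
    by (simp add: matrix_matrix_mult_def map_matrix_def sum_distrib_left sum_distrib_right mult_ac)
  have sc: "circle_mean (\<lambda>z. h z * (z * deriv F z) * (of_real c * (resolvent A (F z) ** complex_matrix E ** resolvent A (F z)) $ u $ v))
     = of_real c * circle_mean (\<lambda>z. h z * (z * deriv F z) * (resolvent A (F z) ** complex_matrix E ** resolvent A (F z)) $ u $ v)" for u v
    unfolding circle_mean_cmult[symmetric] by (rule circle_mean_cong) (simp only: mult_ac)
  show "frechet_calc h (complex_matrix (c *\<^sub>R E)) = c *\<^sub>R frechet_calc h (complex_matrix E)"
    unfolding frechet_calc_def by (simp only: * sc) (simp add: vec_eq_iff scaleR_conv_of_real[where 'a = complex])
qed

lemma matrix_fun_has_derivative: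
  assumes A0: "A = complex_matrix A0" and f: "f holomorphic_on F ` ball 0 R"
  shows "((\<lambda>X. matrix_fun f (complex_matrix X)) has_derivative (\<lambda>E. frechet_calc (\<lambda>z. f (F z)) (complex_matrix E))) (at A0)"
proof -
  have h: "(\<lambda>z. f (F z)) holomorphic_on ball 0 R"
    using holomorphic_on_compose[OF holF f] by (simp add: o_def)
  obtain C \<epsilon> where C: "0 \<le> C" "0 < \<epsilon>"
    "\<forall>B. norm (B - A) < \<epsilon> \<longrightarrow> disc_calculus F R B \<and>
      norm (disc_calculus.fcalc F B (\<lambda>z. f (F z)) - fcalc (\<lambda>z. f (F z)) - frechet_calc (\<lambda>z. f (F z)) (B - A)) \<le> C * (norm (B - A))\<^sup>2"
    by (rule frechet_calc_remainder[OF h])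
  let ?\<Phi> = "\<lambda>X. matrix_fun f (complex_matrix X)"
  let ?L = "\<lambda>E. frechet_calc (\<lambda>z. f (F z)) (complex_matrix E)"
  have bound: "norm (?\<Phi> X - ?\<Phi> A0 - ?L (X - A0)) / norm (X - A0) \<le> C * norm (X - A0)"
    if X: "norm (X - A0) < \<epsilon>" for X
  proof -
    have d: "complex_matrix X - A = complex_matrix (X - A0)"
      by (simp add: A0 vec_eq_iff map_matrix_def)
    have n: "norm (complex_matrix X - A) = norm (X - A0)"
      by (simp only: d norm_complex_matrix)
    then interpret X: disc_calculus F R "complex_matrix X"
      using C(3)[rule_format, of "complex_matrix X"] X by simp
    have "norm (?\<Phi> X - ?\<Phi> A0 - ?L (X - A0)) \<le> C * (norm (X - A0))\<^sup>2"
      using C(3)[rule_format, of "complex_matrix X"] X n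
      by (simp add: X.matrix_fun_eq_fcalc[OF f] matrix_fun_eq_fcalc[OF f] A0[symmetric] d)
    then show ?thesis
      by (cases "X = A0") (simp_all add: divide_le_eq power2_eq_square mult.assoc)
  qed
  show ?thesis
  proof (rule has_derivativeI_sandwich[of \<epsilon> _ _ _ _ "\<lambda>X. C * norm (X - A0)"])
    show "bounded_linear ?L"
      using frechet_calc_linear[OF h] by (simp add: linear_conv_bounded_linear)
    have "((\<lambda>X. C * norm (X - A0)) \<longlongrightarrow> C * norm (A0 - A0)) (at A0)"
      by (intro tendsto_intros)
    then show "((\<lambda>X. C * norm (X - A0)) \<longlongrightarrow> 0) (at A0)"
      by simp
  qed (use C(2) bound in \<open>auto simp: dist_norm\<close>)
qed

text \<open>The direction has rank one, so an entry of \<open>M ** E ** M\<close> splits into a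
  product of two entries of \<open>M\<close>.\<close>

lemma matrix_frechet_unit_matrix:
  assumes A0: "A = complex_matrix A0" and f: "f holomorphic_on F ` ball 0 R"
  shows "matrix_frechet f A0 (unit_matrix i j) $ u $ v = lcalc (\<lambda>z. f (F z)) u i j v"
proof -
  have "matrix_frechet f A0 (unit_matrix i j) = frechet_calc (\<lambda>z. f (F z)) (complex_matrix (unit_matrix i j))"
    unfolding matrix_frechet_def frechet_derivative_at[OF matrix_fun_has_derivative[OF A0 f], symmetric] ..
  moreover have "(M ** complex_matrix (unit_matrix i j) ** M) $ u $ v = M $ u $ i * M $ j $ v" for M :: "complex^'n^'n"
  proof -
    have E: "complex_of_real (unit_matrix i j $ r $ s) = (if r = i then if s = j then 1 else 0 else 0)" for r s
      by (simp add: unit_matrix_def axis_def)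
    have ME: "(M ** complex_matrix (unit_matrix i j)) $ u $ s = (if s = j then M $ u $ i else 0)" for s
      by (simp add: matrix_matrix_mult_def E if_distrib cong: if_cong)
    have "(M ** complex_matrix (unit_matrix i j) ** M) $ u $ v =
        (\<Sum>k\<in>UNIV. (M ** complex_matrix (unit_matrix i j)) $ u $ k * M $ k $ v)"
      by (simp add: matrix_matrix_mult_def[of "M ** complex_matrix (unit_matrix i j)"])
    also have "\<dots> = M $ u $ i * M $ j $ v"
      unfolding ME by (simp add: if_distribR if_distrib cong: if_cong)
    finally show ?thesis .
  qed
  ultimately show ?thesis
    by (simp only: frechet_calc_def lcalc_def kern_def vec_lambda_beta mult.assoc)
qed

section \<open>Powers and the bound for the bivariate integral\<close>

lemma fcalc_power: "fcalc (\<lambda>z. F z ^ k) = matrix_pow A k"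
proof (induction k)
  case (Suc k)
  have "(\<lambda>z. F z ^ k) holomorphic_on ball 0 R"
    by (intro holomorphic_intros holF)
  from fcalc_mult_F[OF this] Suc show ?case
    by (simp add: matrix_pow.simps)
qed (simp add: fcalc_one matrix_pow.simps)

lemma lcalc_power: "lcalc (\<lambda>z. F z ^ k) u i j v = (\<Sum>a<k. matrix_pow A a $ u $ i * matrix_pow A (k - 1 - a) $ j $ v)"
proof (induction k arbitrary: u)
  case (Suc k)
  have hol: "(\<lambda>z. F z ^ k) holomorphic_on ball 0 R"
    by (intro holomorphic_intros holF)
  have "lcalc (\<lambda>z. F z ^ Suc k) u i j v = mat 1 $ u $ i * matrix_pow A k $ j $ v +
      (\<Sum>w\<in>UNIV. A $ u $ w * (\<Sum>a<k. matrix_pow A a $ w $ i * matrix_pow A (k - 1 - a) $ j $ v))"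
    using lcalc_mult_F[OF hol] by (simp add: Suc fcalc_power)
  also have "(\<Sum>w\<in>UNIV. A $ u $ w * (\<Sum>a<k. matrix_pow A a $ w $ i * matrix_pow A (k - 1 - a) $ j $ v)) =
      (\<Sum>a<k. \<Sum>w\<in>UNIV. A $ u $ w * (matrix_pow A a $ w $ i * matrix_pow A (k - 1 - a) $ j $ v))"
    unfolding sum_distrib_left by (rule sum.swap)
  also have "\<dots> = (\<Sum>a<k. matrix_pow A (Suc a) $ u $ i * matrix_pow A (k - 1 - a) $ j $ v)"
    by (simp add: matrix_pow.simps matrix_matrix_mult_def sum_distrib_right mult.assoc)
  also have "mat 1 $ u $ i * matrix_pow A k $ j $ v + \<dots> = (\<Sum>a<Suc k. matrix_pow A a $ u $ i * matrix_pow A (Suc k - 1 - a) $ j $ v)"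
    by (subst sum.lessThan_Suc_shift) (simp add: matrix_pow.simps)
  finally show ?case .
qed (simp add: lcalc_one)

lemma lcalc_diff:
  assumes "g holomorphic_on ball 0 R" "h holomorphic_on ball 0 R"
  shows "lcalc (\<lambda>z. g z - h z) u i j v = lcalc g u i j v - lcalc h u i j v"
  unfolding lcalc_def left_diff_distrib
  by (intro circle_mean_diff continuous_intros continuous_on_sphere[OF assms(1)] continuous_on_sphere[OF assms(2)]
      continuous_on_kern continuous_on_resolvent_F)

lemma lcalc_sum:
  assumes "finite I" "\<And>k. k \<in> I \<Longrightarrow> g k holomorphic_on ball 0 R"
  shows "lcalc (\<lambda>z. \<Sum>k\<in>I. c k * g k z) u i j v = (\<Sum>k\<in>I. c k * lcalc (g k) u i j v)"
proof -
  have "lcalc (\<lambda>z. \<Sum>k\<in>I. c k * g k z) u i j v =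
      circle_mean (\<lambda>z. \<Sum>k\<in>I. c k * (g k z * kern z u i * resolvent A (F z) $ j $ v))"
    unfolding lcalc_def by (simp add: sum_distrib_right mult.assoc)
  also have "\<dots> = (\<Sum>k\<in>I. circle_mean (\<lambda>z. c k * (g k z * kern z u i * resolvent A (F z) $ j $ v)))"
    by (intro circle_mean_sum assms(1) continuous_intros continuous_on_sphere[OF assms(2)] continuous_on_kern continuous_on_resolvent_F)
  finally show ?thesis
    by (simp add: circle_mean_cmult lcalc_def)
qed

text \<open>Carried over to the image, \<open>quot\<close> is the divided difference of
  \<open>g\<close> itself. Convexity of the image keeps the segment of integration where
  \<open>deriv g\<close> is bounded.\<close>

lemma norm_quot_le:
  assumes conv: "convex (F ` ball 0 R)" and g: "g holomorphic_on F ` ball 0 R"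
    and bound: "\<And>w. w \<in> F ` ball 0 R \<Longrightarrow> norm (deriv g w) \<le> m"
    and ab: "a \<in> ball 0 R" "b \<in> ball 0 R"
  shows "norm (quot (\<lambda>z. g (F z)) a b) \<le> m"
proof -
  have h: "(\<lambda>z. g (F z)) holomorphic_on ball 0 R"
    using holomorphic_on_compose[OF holF g] by (simp add: o_def)
  have in_img: "F a \<in> F ` ball 0 R" "F b \<in> F ` ball 0 R"
    using ab by blast+
  have "quot (\<lambda>z. g (F z)) a b = divdiff g (F a) (F b)"
  proof (cases "a = b")
    case True
    have "deriv (\<lambda>z. g (F z)) a = deriv g (F a) * deriv F a"
      by (intro DERIV_imp_deriv DERIV_chain2[OF holomorphic_derivI[OF g open_image(1) in_img(1)] holomorphic_derivI[OF holF open_ball ab(1)]])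
    moreover have "deriv F a \<noteq> 0"
      using divdiff_F_nonzero[OF ab(1) ab(1)] by simp
    ultimately show ?thesis
      using True by (simp add: quot_def)
  next
    case False
    then have "F a - F b \<noteq> 0"
      using inj_onD[OF injF _ ab] by auto
    moreover have "(F a - F b) * quot (\<lambda>z. g (F z)) a b = (F a - F b) * divdiff g (F a) (F b)"
      using quot_mult[OF h ab] divdiff_mult[OF open_image(1) conv g in_img] by simp
    ultimately show ?thesis by simp
  qed
  then show ?thesis
    using divdiff_bound[OF open_image(1) conv g in_img bound] by simp
qed

text \<open>The bivariate estimate follows from two applications of the univariate one, because \<open>E\<^sub>i\<^sub>j\<close> has rank one.\<close>

lemma norm_lcalc_le:
  assumes conv: "convex (F ` ball 0 R)" and g: "g holomorphic_on F ` ball 0 R"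
    and bound: "\<And>w. w \<in> F ` ball 0 R \<Longrightarrow> norm (deriv g w) \<le> m" and pos: "0 < m" "0 < \<kappa>"
    and \<kappa>: "\<And>h c. h holomorphic_on ball 0 R \<Longrightarrow> 0 < c \<Longrightarrow> (\<And>z. norm z \<le> 1 \<Longrightarrow> norm (h z) \<le> c) \<Longrightarrow> opnorm (fcalc h) \<le> \<kappa> * c"
  shows "norm (lcalc (\<lambda>z. g (F z)) u i j v) \<le> \<kappa>\<^sup>2 * m"
proof -
  have h: "(\<lambda>z. g (F z)) holomorphic_on ball 0 R"
    using holomorphic_on_compose[OF holF g] by (simp add: o_def)
  \<comment> \<open>First use of \<open>\<kappa>\<close>, with one variable held at
    \<open>z\<close>. The second use is on the resulting scalar function of \<open>z\<close>, which
    is bounded by \<open>\<kappa> * m\<close>.\<close>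
  have inner: "norm (quot_calc (\<lambda>z. g (F z)) z $ j $ v) \<le> \<kappa> * m" if "norm z \<le> 1" for z
  proof -
    have "opnorm (quot_calc (\<lambda>z. g (F z)) z) \<le> \<kappa> * m"
      unfolding quot_calc_def
      by (rule \<kappa>[OF quot_holomorphic(2)[OF h in_ball[OF that]] pos(1)])
         (rule norm_quot_le[OF conv g bound in_ball[OF that] in_ball])
    then show ?thesis
      using norm_entry_le_opnorm order.trans by blast
  qed
  have "norm (lcalc (\<lambda>z. g (F z)) u i j v) \<le> opnorm (fcalc (\<lambda>z. quot_calc (\<lambda>z. g (F z)) z $ j $ v))"
    unfolding lcalc_eq_fcalc_quot_calc[OF h] by (rule norm_entry_le_opnorm)
  also have "\<dots> \<le> \<kappa> * (\<kappa> * m)"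
    using pos by (intro \<kappa> quot_calc_holomorphic[OF h] inner) auto
  finally show ?thesis
    by (simp add: power2_eq_square mult.assoc)
qed

end

section \<open>Walks and powers of the adjacency matrix\<close>

text \<open>Matrix powers detect walks, whereas \<open>geodesic_dist\<close> is an infimum over
  paths. Cutting out cycles only shortens a walk.\<close>

lemma (in wf_digraph) apath_of_awalk:
  assumes "awalk u p v"
  shows "\<exists>q. apath u q v \<and> length q \<le> length p"
  using assms
proof (induct rule: awalk_to_apath_induct)
  case (path p)
  then show ?case
    by (auto simp: apath_def)
next
  case (decomp p q r s)
  then have "length (q @ s) \<le> length p"
    using awalk_cyc_decomp_has_prop[of u p v] by auto
  moreover obtain p' where "apath u p' v" "length p' \<le> length (q @ s)"
    using decomp(4) by blast
  ultimately show ?case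
    using order.trans by blast
qed

text \<open>A nonzero sum has a nonzero summand, so each factor of the power yields one arc of the
  walk.\<close>

lemma awalk_of_matrix_pow_nonzero:
  assumes "pair_digraph G" "pverts G = UNIV"
    and "matrix_pow (complex_matrix (adjacency_matrix G w)) k $ u $ i \<noteq> 0"
  shows "\<exists>p. pre_digraph.awalk (with_proj G) u p i \<and> length p = k"
proof -
  interpret pair_digraph G by fact
  show ?thesis
    using assms(3)
  proof (induction k arbitrary: u)
    case 0
    then have "u = i"
      by (simp add: mat_def split: if_splits)
    then show ?case
      using assms(2) by (intro exI[of _ "[]"]) (simp add: awalk_Nil_iff)
  next
    case (Suc k)
    let ?A = "complex_matrix (adjacency_matrix G w)"
    have "(\<Sum>v\<in>UNIV. ?A $ u $ v * matrix_pow ?A k $ v $ i) \<noteq> 0"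
      using Suc.prems by (simp add: matrix_matrix_mult_def)
    then obtain v where "?A $ u $ v * matrix_pow ?A k $ v $ i \<noteq> 0"
      by (rule sum.not_neutral_contains_not_neutral)
    then have v: "?A $ u $ v \<noteq> 0" "matrix_pow ?A k $ v $ i \<noteq> 0"
      by simp_all
    from v(1) have "(u, v) \<in> parcs G"
      by (simp add: map_matrix_def adjacency_matrix_def split: if_splits)
    moreover obtain p where "awalk v p i" "length p = k"
      using Suc.IH[OF v(2)] by blast
    ultimately show ?case
      by (intro exI[of _ "(u, v) # p"]) (simp add: awalk_Cons_iff)
  qed
qed

lemma geodesic_dist_le_of_matrix_pow_nonzero:
  assumes "pair_digraph G" "pverts G = UNIV"
    and "matrix_pow (complex_matrix (adjacency_matrix G w)) k $ u $ i \<noteq> 0"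
  shows "geodesic_dist G u i \<le> enat k"
proof -
  interpret pair_digraph G by fact
  obtain p where p: "awalk u p i" "length p = k"
    using awalk_of_matrix_pow_nonzero[OF assms] by blast
  then obtain q where "apath u q i" "length q \<le> k"
    using apath_of_awalk by blast
  then have "geodesic_dist G u i \<le> enat (length q)"
    unfolding geodesic_dist_def by (intro INF_lower) simp
  also have "\<dots> \<le> enat k"
    using \<open>length q \<le> k\<close> by simp
  finally show ?thesis .
qed

text \<open>The function is the antiderivative of \<open>p\<close> with constant term 0. Integration
  raises the exponent to \<open>k + 1\<close> and \<open>lcalc_power\<close> returns walks of total
  length \<open>k\<close>, which is at most \<open>degree p\<close> and so below the sum of the
  distances.\<close>

lemma (in disc_calculus) lcalc_polynomial_eq_0:
  assumes "pair_digraph G" "pverts G = UNIV" and A: "A = complex_matrix (adjacency_matrix G w)"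
    and p: "p \<in> polys_deg_less (geodesic_dist G u i + geodesic_dist G j v)"
  shows "lcalc (\<lambda>z. \<Sum>k\<le>degree p. coeff p k / of_nat (Suc k) * F z ^ Suc k) u i j v = 0"
proof -
  have "coeff p k / of_nat (Suc k) * lcalc (\<lambda>z. F z ^ Suc k) u i j v = 0" if k: "k \<le> degree p" for k
  \<comment> \<open>For the zero polynomial there is no degree bound, as both distances may be 0;
    its coefficients vanish instead.\<close>
  proof (cases "p = 0")
    case False
    then have deg: "enat (degree p) < geodesic_dist G u i + geodesic_dist G j v"
      using p by (simp add: polys_deg_less_def)
    have "matrix_pow A a $ u $ i * matrix_pow A (Suc k - 1 - a) $ j $ v = 0" if a: "a < Suc k" for a
    proof (rule ccontr)
      assume "\<not> ?thesis"
      then have "matrix_pow A a $ u $ i \<noteq> 0" "matrix_pow A (Suc k - 1 - a) $ j $ v \<noteq> 0"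
        by auto
      then have "geodesic_dist G u i \<le> enat a" "geodesic_dist G j v \<le> enat (Suc k - 1 - a)"
        unfolding A by (auto intro: geodesic_dist_le_of_matrix_pow_nonzero[OF assms(1,2)])
      then have "geodesic_dist G u i + geodesic_dist G j v \<le> enat a + enat (Suc k - 1 - a)"
        by (rule add_mono)
      also have "\<dots> \<le> enat (degree p)"
        using a k by simp
      finally show False
        using deg by simp
    qed
    then have "lcalc (\<lambda>z. F z ^ Suc k) u i j v = 0"
      unfolding lcalc_power by (intro sum.neutral) simp
    then show ?thesis
      by (simp only: mult_zero_right)
  qed (use k in simp)
  then have "(\<Sum>k\<le>degree p. coeff p k / of_nat (Suc k) * lcalc (\<lambda>z. F z ^ Suc k) u i j v) = 0"
    by (intro sum.neutral ballI) (simp only: atMost_iff)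
  moreover have "lcalc (\<lambda>z. \<Sum>k\<le>degree p. coeff p k / of_nat (Suc k) * F z ^ Suc k) u i j v =
      (\<Sum>k\<le>degree p. coeff p k / of_nat (Suc k) * lcalc (\<lambda>z. F z ^ Suc k) u i j v)"
    by (rule lcalc_sum) (intro finite_atMost holomorphic_intros holF)+
  ultimately show ?thesis
    by (simp only:)
qed

text \<open>A metric neighbourhood is the Minkowski sum with a disc and hence convex by
  Toeplitz-Hausdorff. Being bounded, it is a proper subset of the plane, as a Riemann map
  requires.\<close>

lemma convex_neighbourhood_numerical_range:
  assumes "open V" "numerical_range A \<subseteq> V"
  obtains U where "open U" "convex U" "U \<noteq> UNIV" "numerical_range A \<subseteq> U" "U \<subseteq> V"
proof -
  obtain \<epsilon> where \<epsilon>: "0 < \<epsilon>" "(\<Union>x\<in>numerical_range A. ball x \<epsilon>) \<subseteq> V"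
    using compact_subset_open_imp_ball_epsilon_subset[OF compact_numerical_range assms] by blast
  let ?U = "\<Union>x\<in>numerical_range A. ball x \<epsilon>"
  have "?U = (\<Union>x\<in>numerical_range A. \<Union>y\<in>ball 0 \<epsilon>. {x + y})"
  proof (rule SUP_cong[OF refl])
    fix x :: complex
    have "z \<in> (\<Union>y\<in>ball 0 \<epsilon>. {x + y})" if "z \<in> ball x \<epsilon>" for z
      using that by (auto simp: dist_norm norm_minus_commute intro!: bexI[of _ "z - x"])
    then show "ball x \<epsilon> = (\<Union>y\<in>ball 0 \<epsilon>. {x + y})"
      by (auto simp: dist_norm)
  qed
  then have "convex ?U"
    using convex_sums[OF convex_numerical_range convex_ball] by simp
  moreover have "of_real (opnorm A + \<epsilon>) \<notin> ?U"
  proof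
    assume "of_real (opnorm A + \<epsilon>) \<in> ?U"
    then obtain x where x: "x \<in> numerical_range A" "dist x (of_real (opnorm A + \<epsilon>)) < \<epsilon>"
      by auto
    have "opnorm A + \<epsilon> = norm (of_real (opnorm A + \<epsilon>) :: complex)"
      using opnorm_nonneg[of A] \<epsilon>(1) by (simp only: norm_of_real)
    also have "\<dots> \<le> norm x + norm (of_real (opnorm A + \<epsilon>) - x)"
      using norm_triangle_sub[of "of_real (opnorm A + \<epsilon>)" x] by simp
    also have "\<dots> < opnorm A + \<epsilon>"
      using norm_numerical_range_le[OF x(1)] x(2) by (simp only: dist_norm norm_minus_commute)
    finally show False by simp
  qed
  then have "?U \<noteq> UNIV"
    by blast
  moreover have "numerical_range A \<subseteq> ?U"
    using \<epsilon>(1) by auto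
  moreover have "open ?U"
    by blast
  ultimately show thesis
    using \<epsilon>(2) by (intro that[of ?U])
qed

lemma matrix_frechet_entry_bound:
  fixes G :: "'n::finite pair_pre_digraph" and w :: "'n \<times> 'n \<Rightarrow> real"
  defines "A \<equiv> complex_matrix (adjacency_matrix G w)"
  assumes G: "pair_digraph G" "pverts G = UNIV"
    and f: "f analytic_on numerical_range A"
    and p: "p \<in> polys_deg_less (geodesic_dist G u i + geodesic_dist G j v)"
  shows "cmod (matrix_frechet f (adjacency_matrix G w) (unit_matrix i j) $ u $ v)
    \<le> (if normal_matrix A then 1 else (1 + sqrt 2)\<^sup>2) * (SUP z\<in>numerical_range A. cmod (deriv f z - poly p z))"
proof -
  \<comment> \<open>The constant for one variable; its square is the constant of the
    theorem.\<close>
  define \<kappa> where "\<kappa> = (if normal_matrix A then 1 else 1 + sqrt 2)"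
  have \<kappa>: "0 < \<kappa>" "(if normal_matrix A then 1 else (1 + sqrt 2)\<^sup>2) = \<kappa>\<^sup>2"
    using add_pos_pos[of 1 "sqrt 2"] by (simp_all add: \<kappa>_def)
  define s where "s = (SUP z\<in>numerical_range A. cmod (deriv f z - poly p z))"
  define q where "q = (\<lambda>x. \<Sum>k\<le>degree p. coeff p k / of_nat (Suc k) * x ^ Suc k)"
  define g where "g = (\<lambda>z. f z - q z)"
  obtain T where T: "open T" "numerical_range A \<subseteq> T" "f holomorphic_on T"
    using f analytic_on_holomorphic by blast
  have q': "(q has_field_derivative poly p z) (at z)" for z
  proof -
    have "((\<lambda>x. coeff p k / of_nat (Suc k) * x ^ Suc k) has_field_derivative coeff p k * z ^ k) (at z)" for k
      by (rule derivative_eq_intros refl | simp del: of_nat_Suc)+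
    then show ?thesis
      unfolding q_def poly_altdef by (intro DERIV_sum) auto
  qed
  have q: "q holomorphic_on S" for S
    unfolding q_def by (intro holomorphic_intros)
  have g': "deriv g z = deriv f z - poly p z" if "z \<in> T" for z
    unfolding g_def by (intro DERIV_imp_deriv DERIV_diff q' holomorphic_derivI[OF T(3,1) that])
  have cont: "continuous_on T (\<lambda>z. cmod (deriv f z - poly p z))"
    by (intro continuous_intros holomorphic_on_imp_continuous_on[OF holomorphic_deriv[OF T(3,1)]])
  have bdd: "bdd_above ((\<lambda>z. cmod (deriv f z - poly p z)) ` numerical_range A)"
    by (intro bounded_imp_bdd_above compact_imp_bounded compact_continuous_image compact_numerical_range
        continuous_on_subset[OF cont T(2)])
  have s: "cmod (deriv f z - poly p z) \<le> s" if "z \<in> numerical_range A" for z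
    unfolding s_def by (rule cSUP_upper[OF that bdd])
  have s0: "0 \<le> s"
    using numerical_range_nonempty[of A] s order.trans[OF norm_ge_zero] by blast
  \<comment> \<open>The slack \<open>\<delta>\<close> makes room for a neighbourhood of the
    numerical range, by continuity, and keeps the bound positive when \<open>s = 0\<close>.\<close>
  have bound: "cmod (matrix_frechet f (adjacency_matrix G w) (unit_matrix i j) $ u $ v) \<le> \<kappa>\<^sup>2 * (s + \<delta>)" if \<delta>: "0 < \<delta>" for \<delta>
  proof -
    let ?V = "T \<inter> (\<lambda>z. cmod (deriv f z - poly p z)) -` {..<s + \<delta>}"
    have "open ?V"
      by (rule continuous_open_preimage[OF cont T(1)]) simp
    moreover have "numerical_range A \<subseteq> ?V"
    proof
      fix z assume z: "z \<in> numerical_range A"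
      then show "z \<in> ?V"
        using T(2) s[OF z] \<delta> by auto
    qed
    ultimately obtain U where U: "open U" "convex U" "U \<noteq> UNIV" "numerical_range A \<subseteq> U" "U \<subseteq> ?V"
      by (rule convex_neighbourhood_numerical_range)
    obtain F R \<rho> where F: "convex_disc_calculus F R A \<rho>" "F ` ball 0 R = U"
      by (rule convex_disc_map_exists[OF U(1-4)])
    interpret convex_disc_calculus F R A \<rho> by (rule F(1))
    have fU: "f holomorphic_on U" and gU: "g holomorphic_on U"
      using U(5) unfolding g_def by (auto intro!: holomorphic_intros q holomorphic_on_subset[OF T(3)])
    have hol: "(\<lambda>z. f (F z)) holomorphic_on ball 0 R" "(\<lambda>z. q (F z)) holomorphic_on ball 0 R"
      using holomorphic_on_compose[OF holF, of f] holomorphic_on_compose[OF holF q] fU by (simp_all add: o_def F(2))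
    have zero: "lcalc (\<lambda>z. q (F z)) u i j v = 0"
      unfolding q_def by (rule lcalc_polynomial_eq_0[OF G _ p]) (simp add: A_def)
    have "matrix_frechet f (adjacency_matrix G w) (unit_matrix i j) $ u $ v = lcalc (\<lambda>z. f (F z)) u i j v"
      by (rule matrix_frechet_unit_matrix) (simp_all add: A_def F(2) fU)
    also have "\<dots> = lcalc (\<lambda>z. g (F z)) u i j v"
      unfolding g_def using lcalc_diff[OF hol] zero by simp
    also have "cmod \<dots> \<le> \<kappa>\<^sup>2 * (s + \<delta>)"
    proof (rule norm_lcalc_le)
      show "convex (F ` ball 0 R)" "g holomorphic_on F ` ball 0 R"
        by (simp_all add: F(2) U(2) gU)
      show "cmod (deriv g z) \<le> s + \<delta>" if "z \<in> F ` ball 0 R" for z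
        using that U(5) g' unfolding F(2) by force
      show "0 < s + \<delta>" "0 < \<kappa>"
        using s0 \<delta> \<kappa>(1) by simp_all
      fix h c assume "h holomorphic_on ball 0 R" "0 < c" "\<And>z. norm z \<le> 1 \<Longrightarrow> norm (h z) \<le> c"
      then show "opnorm (fcalc h) \<le> \<kappa> * c"
        using opnorm_fcalc opnorm_fcalc_normal by (simp add: \<kappa>_def)
    qed
    finally show ?thesis .
  qed
  have "cmod (matrix_frechet f (adjacency_matrix G w) (unit_matrix i j) $ u $ v) \<le> \<kappa>\<^sup>2 * s"
  proof (rule field_le_epsilon)
    fix e :: real assume e: "0 < e"
    have "0 < e / \<kappa>\<^sup>2"
      using e \<kappa>(1) by simp
    from bound[OF this] show "cmod (matrix_frechet f (adjacency_matrix G w) (unit_matrix i j) $ u $ v) \<le> \<kappa>\<^sup>2 * s + e"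
      using \<kappa>(1) by (simp add: distrib_left)
  qed
  then show ?thesis
    unfolding \<kappa>(2) s_def .
qed

theorem theorem5p4:
  fixes G :: "'n::finite pair_pre_digraph"
    and w :: "'n \<times> 'n \<Rightarrow> real"
    and f :: "complex \<Rightarrow> complex"
    and i j u v :: 'n
  assumes "pair_digraph G" and "pverts G = UNIV"
    and "\<And>e. e \<in> parcs G \<Longrightarrow> w e > 0"
    and "f analytic_on numerical_range (complex_matrix (adjacency_matrix G w))"
  shows "cmod (matrix_frechet f (adjacency_matrix G w) (unit_matrix i j) $ u $ v)
    \<le> (if normal_matrix (complex_matrix (adjacency_matrix G w)) then 1 else (1 + sqrt 2)\<^sup>2) *
      (INF p\<in>polys_deg_less (geodesic_dist G u i + geodesic_dist G j v).
        SUP z\<in>numerical_range (complex_matrix (adjacency_matrix G w)). cmod (deriv f z - poly p z))"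
proof -
  define A where "A = complex_matrix (adjacency_matrix G w)"
  define C :: real where "C = (if normal_matrix A then 1 else (1 + sqrt 2)\<^sup>2)"
  define L where "L = cmod (matrix_frechet f (adjacency_matrix G w) (unit_matrix i j) $ u $ v)"
  have C: "0 < C"
    using add_pos_pos[of 1 "sqrt 2"] by (simp add: C_def)
  \<comment> \<open>Division by \<open>C\<close> leaves a lower bound for an infimum, checked one
    polynomial at a time. The zero polynomial keeps the set nonempty even when both distances are
    0.\<close>
  have "L / C \<le> (INF p\<in>polys_deg_less (geodesic_dist G u i + geodesic_dist G j v).
      SUP z\<in>numerical_range A. cmod (deriv f z - poly p z))"
  proof (rule cINF_greatest)
    show "polys_deg_less (geodesic_dist G u i + geodesic_dist G j v) \<noteq> {}"
      by (auto simp: polys_deg_less_def)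
    fix p assume "p \<in> polys_deg_less (geodesic_dist G u i + geodesic_dist G j v)"
    then have "L \<le> C * (SUP z\<in>numerical_range A. cmod (deriv f z - poly p z))"
      unfolding L_def C_def A_def by (intro matrix_frechet_entry_bound assms)
    then show "L / C \<le> (SUP z\<in>numerical_range A. cmod (deriv f z - poly p z))"
      using C by (simp add: divide_le_eq mult.commute)
  qed
  then have "L \<le> C * (INF p\<in>polys_deg_less (geodesic_dist G u i + geodesic_dist G j v).
      SUP z\<in>numerical_range A. cmod (deriv f z - poly p z))"
    using C by (simp add: divide_le_eq mult.commute)
  then show ?thesis
    unfolding L_def C_def A_def .
qed

end
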